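(* Every graph that is isomorphic to an induced subgraph of some unigraph is apex-perfect. Consequently, every such graph $G$ satisfies $\chi(G)\le\omega(G)+1$.
   Context: All graphs are finite and simple; $\omega$ denotes the clique number and $\chi$ the chromatic number. A unigraph is a graph $G$ such that every graph with the same degree sequence as $G$ is isomorphic to $G$. A graph $G$ is apex-perfect if there exists a vertex $v\in V(G)$ such that $G-\{v\}$ is perfect. *)

theory Defs
  imports "Graph_Theory.Graph_Theory" "HOL-Library.Multiset"
begin

text \<open>
  Finite simple graphs are the digraphs satisfying the locale predicate \<open>graph\<close>: finite,
  loop-free, without parallel arcs, and symmetric, so that an edge is a pair of opposite arcs.
  The graph with no vertices is included. In such a graph the degree of a vertex is its
  out-degree (equivalently, its in-degree).
\<close>

definition degree_sequence :: "('a,'b) pre_digraph \<Rightarrow> nat list" where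
  "degree_sequence G =
     rev (sorted_list_of_multiset (image_mset (out_degree G) (mset_set (verts G))))"

text \<open>
  Graphs with equal degree sequences have equally many vertices and equally many arcs, so
  nothing is lost by letting the competitor \<open>H\<close> range over graphs with the same vertex and
  arc types as \<open>G\<close>; see \<open>unigraph_iso_any_type\<close> below.
\<close>

definition unigraph :: "('a,'b) pre_digraph \<Rightarrow> bool" where
  "unigraph G \<longleftrightarrow> graph G \<and>
     (\<forall>H :: ('a,'b) pre_digraph.
        graph H \<and> degree_sequence H = degree_sequence G \<longrightarrow> digraph_iso H G)"

definition clique :: "('a,'b) pre_digraph \<Rightarrow> 'a set \<Rightarrow> bool" where
  "clique G C \<longleftrightarrow> C \<subseteq> verts G \<and> (\<forall>u\<in>C. \<forall>v\<in>C. u \<noteq> v \<longrightarrow> u \<rightarrow>\<^bsub>G\<^esub> v)"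

definition clique_number :: "('a,'b) pre_digraph \<Rightarrow> nat" where
  "clique_number G = Max (card ` {C. clique G C})"

definition proper_colouring :: "('a,'b) pre_digraph \<Rightarrow> nat \<Rightarrow> ('a \<Rightarrow> nat) \<Rightarrow> bool" where
  "proper_colouring G k c \<longleftrightarrow>
     (\<forall>v\<in>verts G. c v < k) \<and> (\<forall>u v. u \<rightarrow>\<^bsub>G\<^esub> v \<longrightarrow> c u \<noteq> c v)"

definition chromatic_number :: "('a,'b) pre_digraph \<Rightarrow> nat" where
  "chromatic_number G = (LEAST k. \<exists>c. proper_colouring G k c)"

definition perfect_graph :: "('a,'b) pre_digraph \<Rightarrow> bool" where
  "perfect_graph G \<longleftrightarrow> graph G \<and>
     (\<forall>H. induced_subgraph H G \<longrightarrow> chromatic_number H = clique_number H)"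

definition apex_perfect :: "('a,'b) pre_digraph \<Rightarrow> bool" where
  "apex_perfect G \<longleftrightarrow> graph G \<and> (\<exists>v\<in>verts G. perfect_graph (pre_digraph.del_vert G v))"

lemma degree_sequence_eq_iff:
  "degree_sequence G = degree_sequence H \<longleftrightarrow>
     image_mset (out_degree G) (mset_set (verts G)) = image_mset (out_degree H) (mset_set (verts H))"
  unfolding degree_sequence_def by (metis mset_sorted_list_of_multiset rev_rev_ident)

lemma card_arcs_eq_sum_out_degree:
  assumes "fin_digraph G"
  shows "card (arcs G) = (\<Sum>v\<in>verts G. out_degree G v)"
proof -
  interpret fin_digraph G by fact
  have "arcs G = (\<Union>v\<in>verts G. out_arcs G v)"
    by (auto simp: out_arcs_def)
  also have "card \<dots> = (\<Sum>v\<in>verts G. card (out_arcs G v))"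
    by (rule card_UN_disjoint) (auto simp: out_arcs_def)
  finally show ?thesis by (simp add: out_degree_def)
qed

lemma graph_copy:
  fixes K :: "('a,'b) pre_digraph" and V :: "'c set" and A :: "'d set"
  assumes "graph K" "finite V" "finite A" "card V = card (verts K)" "card A = card (arcs K)"
  obtains K' :: "('c,'d) pre_digraph"
  where "graph K'" "degree_sequence K' = degree_sequence K" "digraph_iso K K'"
proof -
  interpret graph K by fact
  obtain f where f: "bij_betw f (verts K) V"
    using assms(2,4) finite_verts by (metis finite_same_card_bij)
  obtain g where g: "bij_betw g (arcs K) A"
    using assms(3,5) finite_arcs by (metis finite_same_card_bij)
  define h where "h = the_inv_into (arcs K) g"
  have h: "h (g a) = a" if "a \<in> arcs K" for a
    using g that unfolding h_def bij_betw_def by (simp add: the_inv_into_f_f)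
  define i where "i = \<lparr>iso_verts = f, iso_arcs = g, iso_head = f \<circ> head K \<circ> h, iso_tail = f \<circ> tail K \<circ> h\<rparr>"
  have i: "digraph_isomorphism i"
    unfolding digraph_isomorphism_def i_def using f g h wf_digraph_axioms
    by (auto simp: bij_betw_def)
  let ?K = "app_iso i K"
  have iso: "digraph_iso K ?K" using i unfolding digraph_iso_def by blast
  have gr: "graph ?K"
  proof -
    interpret L: wf_digraph ?K using i by (rule wf_digraphI_app_iso)
    have f_eq: "f u = f v \<longleftrightarrow> u = v" if "u \<in> verts K" "v \<in> verts K" for u v
      using f that by (auto simp: bij_betw_def inj_on_def)
    have ends: "arcs_ends ?K = (\<lambda>(u,v). (f u, f v)) ` arcs_ends K"
      unfolding arcs_ends_def arc_to_ends_def image_image by (auto simp: i_def h image_iff)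
    show ?thesis
    proof
      show "finite (verts ?K)" "finite (arcs ?K)" by simp_all
      show "tail ?K e \<noteq> head ?K e" if "e \<in> arcs ?K" for e
        using that no_loops f_eq by (auto simp: i_def h)
      show "e1 = e2" if "e1 \<in> arcs ?K" "e2 \<in> arcs ?K" "arc_to_ends ?K e1 = arc_to_ends ?K e2" for e1 e2
        using that f_eq
        by (auto simp: i_def h arc_to_ends_def intro!: arg_cong[where f = g] no_multi_arcs)
      show "symmetric ?K"
        using sym_arcs unfolding symmetric_def ends sym_def by force
    qed
  qed
  have deg: "out_degree ?K (f v) = out_degree K v" if "v \<in> verts K" for v
  proof -
    have "out_arcs ?K (f v) = g ` out_arcs K v"
      using that f by (auto simp: out_arcs_def i_def h bij_betw_def inj_on_def)
    moreover have "inj_on g (out_arcs K v)"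
      using g by (auto simp: bij_betw_def out_arcs_def intro: inj_on_subset)
    ultimately show ?thesis by (simp add: out_degree_def card_image)
  qed
  have "mset_set (verts ?K) = image_mset f (mset_set (verts K))"
    using f by (simp add: i_def image_mset_mset_set bij_betw_def)
  then have "degree_sequence ?K = degree_sequence K"
    unfolding degree_sequence_eq_iff
    by (auto simp: multiset.map_comp deg intro!: image_mset_cong)
  with gr iso that show thesis by blast
qed

lemma unigraph_iso_any_type:
  fixes G :: "('a,'b) pre_digraph" and H :: "('c,'d) pre_digraph"
  assumes "unigraph G" "graph H" "degree_sequence H = degree_sequence G"
  shows "digraph_iso H G"
proof -
  interpret G: graph G using assms(1) by (simp add: unigraph_def)
  interpret H: graph H by fact
  have eq: "image_mset (out_degree H) (mset_set (verts H)) = image_mset (out_degree G) (mset_set (verts G))"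
    using assms(3) by (simp add: degree_sequence_eq_iff)
  have "card (verts G) = card (verts H)"
    using arg_cong[OF eq, of size] by simp
  moreover have "card (arcs G) = card (arcs H)"
    using arg_cong[OF eq, of sum_mset]
    by (simp add: card_arcs_eq_sum_out_degree G.fin_digraph_axioms H.fin_digraph_axioms sum_unfold_sum_mset)
  ultimately obtain K :: "('a,'b) pre_digraph"
    where "graph K" "degree_sequence K = degree_sequence H" "digraph_iso H K"
    using graph_copy[OF assms(2) G.finite_verts G.finite_arcs] by metis
  moreover from this have "digraph_iso K G"
    using assms(1,3) by (simp add: unigraph_def)
  ultimately show ?thesis by (blast intro: digraph_iso_trans)
qed

end

theory Submission
  imports Defs "HOL-Combinatorics.Transposition"
begin

text \<open>
  All realizations of the degree sequence of a unigraph U are isomorphic, so a 2-switch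
  preserves every isomorphism invariant. Comparing sums over adjacent vertices of functions of
  the degrees shows that each alternating 4-cycle has an opposite pair of equal degrees, and
  that two vertices of equal degree have almost the same number of neighbours of each degree.
  If no degree class contains both an edge and a non-edge, it follows that U has no induced
  2K2, C4 or C5 and hence is a split graph. If a class M is mixed in this sense, then M, or M
  together with a single further vertex, is a core C such that the remaining vertices form a clique
  complete to C and a stable set anticomplete to C.

  The core is itself a unigraph, and all of its vertices but at most one have the same degree.
  It is therefore isomorphic to any convenient realization of its degree sequence. One can take
  a bipartite graph with one more vertex, or a graph of a similar shape, or the complement of
  such a graph. Deleting one vertex leaves a perfect graph, and adding back the clique and the
  stable set preserves perfection.
\<close>

section \<open>Degrees, realizations and switches\<close>

text \<open>Most of the argument uses the hypothesis only through vertex sums built from degrees and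
  neighbour degrees, which agree on all realizations. Sums linear in the neighbour counts cannot
  compare two vertices of the same degree, so quadratic ones are needed. The obstacle is a mixed
  class, where equal degrees make many alternating 4-cycles harmless. Its flexibility becomes the
  tool: edges inside the class are moved until some alternating 4-cycle has its opposite pairs in
  different classes. The finer structure of the core is never determined, since its degrees alone
  allow it to be replaced by a model in which one vertex is responsible for all imperfection.
  Complementation keeps all hypotheses and halves many case distinctions. To use it for perfection
  as well, each model and its complement are both proved perfect directly, without the perfect graph
  theorem.\<close>

definition sgraph :: "'a set \<Rightarrow> ('a \<Rightarrow> 'a \<Rightarrow> bool) \<Rightarrow> bool" where
  "sgraph V E \<longleftrightarrow> finite V \<and> (\<forall>u v. E u v \<longrightarrow> u \<in> V \<and> v \<in> V \<and> u \<noteq> v \<and> E v u)"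

definition deg :: "('a \<Rightarrow> 'a \<Rightarrow> bool) \<Rightarrow> 'a \<Rightarrow> nat" where
  "deg E v = card {w. E v w}"

definition realizes :: "'a set \<Rightarrow> ('a \<Rightarrow> 'a \<Rightarrow> bool) \<Rightarrow> ('a \<Rightarrow> 'a \<Rightarrow> bool) \<Rightarrow> bool" where
  "realizes V E E' \<longleftrightarrow> sgraph V E' \<and> (\<forall>v. deg E' v = deg E v)"

text \<open>
  A competitor has the same vertex set and the same degree at each vertex, not just the same
  degree sequence.
\<close>

definition unigraph_on :: "'a set \<Rightarrow> ('a \<Rightarrow> 'a \<Rightarrow> bool) \<Rightarrow> bool" where
  "unigraph_on V E \<longleftrightarrow> sgraph V E \<and>
     (\<forall>E'. realizes V E E' \<longrightarrow> (\<exists>f. bij_betw f V V \<and> (\<forall>u\<in>V. \<forall>v\<in>V. E' u v \<longleftrightarrow> E (f u) (f v))))"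

text \<open>The weight \<open>h\<close> is the identity for the sum of the neighbour degrees, a
  constant to recover the degree, and an indicator to count the neighbours in one degree class.
  Integer values allow the increments of a switch to be subtracted.\<close>

definition nsum :: "('a \<Rightarrow> 'a \<Rightarrow> bool) \<Rightarrow> (nat \<Rightarrow> int) \<Rightarrow> 'a \<Rightarrow> int" where
  "nsum E h v = (\<Sum>w | E v w. h (deg E w))"

definition class_deg :: "('a \<Rightarrow> 'a \<Rightarrow> bool) \<Rightarrow> nat \<Rightarrow> 'a \<Rightarrow> int" where
  "class_deg E s v = int (card {w. E v w \<and> deg E w = s})"

definition compl_on :: "'a set \<Rightarrow> ('a \<Rightarrow> 'a \<Rightarrow> bool) \<Rightarrow> 'a \<Rightarrow> 'a \<Rightarrow> bool" where
  "compl_on V E u v \<longleftrightarrow> u \<in> V \<and> v \<in> V \<and> u \<noteq> v \<and> \<not> E u v"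

lemma sgraphD:
  assumes "sgraph V E"
  shows "finite V" "E u v \<Longrightarrow> u \<in> V" "E u v \<Longrightarrow> v \<in> V" "E u v \<Longrightarrow> E v u" "\<not> E u u"
    "E u v \<longleftrightarrow> E v u" "finite {w. E u w}" "finite {w. E u w \<and> P w}"
proof -
  show "finite V" "E u v \<Longrightarrow> u \<in> V" "E u v \<Longrightarrow> v \<in> V" "E u v \<Longrightarrow> E v u" "\<not> E u u" "E u v \<longleftrightarrow> E v u"
    using assms unfolding sgraph_def by blast+
  have "{w. E u w} \<subseteq> V" "{w. E u w \<and> P w} \<subseteq> V" using assms unfolding sgraph_def by blast+
  then show "finite {w. E u w}" "finite {w. E u w \<and> P w}"
    using \<open>finite V\<close> finite_subset by blast+
qed

lemma unigraph_onD: "unigraph_on V E \<Longrightarrow> sgraph V E" by (simp add: unigraph_on_def)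

lemma realizes_refl: "sgraph V E \<Longrightarrow> realizes V E E"
  by (simp add: realizes_def)

lemma realizes_trans: "realizes V E E' \<Longrightarrow> realizes V E' E'' \<Longrightarrow> realizes V E E''"
  by (simp add: realizes_def)

lemma unigraph_on_realizes:
  assumes "unigraph_on V E" "realizes V E E'"
  shows "unigraph_on V E'"
  unfolding unigraph_on_def
proof (intro conjI allI impI)
  show "sgraph V E'" using assms(2) by (simp add: realizes_def)
  fix E'' assume E'': "realizes V E' E''"
  obtain f where f: "bij_betw f V V" "\<forall>u\<in>V. \<forall>v\<in>V. E' u v \<longleftrightarrow> E (f u) (f v)"
    using assms unfolding unigraph_on_def by blast
  obtain g where g: "bij_betw g V V" "\<forall>u\<in>V. \<forall>v\<in>V. E'' u v \<longleftrightarrow> E (g u) (g v)"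
    using assms(1) realizes_trans[OF assms(2) E''] unfolding unigraph_on_def by blast
  define h where "h = the_inv_into V f \<circ> g"
  have inv: "bij_betw (the_inv_into V f) V V" using f(1) by (rule bij_betw_the_inv_into)
  have h: "bij_betw h V V" unfolding h_def using g(1) inv by (rule bij_betw_trans)
  have fh: "f (h u) = g u" if "u \<in> V" for u
    using f(1) g(1) that unfolding h_def
    by (auto simp: bij_betw_def intro!: f_the_inv_into_f)
  have "\<forall>u\<in>V. \<forall>v\<in>V. E'' u v \<longleftrightarrow> E' (h u) (h v)"
    using f(2) g(2) fh h by (metis bij_betwE)
  with h show "\<exists>f. bij_betw f V V \<and> (\<forall>u\<in>V. \<forall>v\<in>V. E'' u v \<longleftrightarrow> E' (f u) (f v))" by blast
qed

lemma iso_nbhd: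
  assumes "sgraph V E" "sgraph V' E'" "bij_betw f V' V" "\<forall>u\<in>V'. \<forall>v\<in>V'. E' u v \<longleftrightarrow> E (f u) (f v)" "v \<in> V'"
  shows "bij_betw f {w. E' v w} {w. E (f v) w}"
proof (rule bij_betw_subset[OF assms(3)])
  show "{w. E' v w} \<subseteq> V'" using sgraphD(3)[OF assms(2)] by blast
  show "f ` {w. E' v w} = {w. E (f v) w}"
  proof
    show "f ` {w. E' v w} \<subseteq> {w. E (f v) w}" using assms(4,5) sgraphD(3)[OF assms(2)] by blast
    show "{w. E (f v) w} \<subseteq> f ` {w. E' v w}"
    proof
      fix x assume x: "x \<in> {w. E (f v) w}"
      then have "x \<in> V" using sgraphD(3)[OF assms(1)] by blast
      then obtain w where "w \<in> V'" "x = f w" using assms(3) by (auto simp: bij_betw_def)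
      then show "x \<in> f ` {w. E' v w}" using x assms(4,5) by auto
    qed
  qed
qed

lemma iso_deg:
  assumes "sgraph V E" "sgraph V' E'" "bij_betw f V' V" "\<forall>u\<in>V'. \<forall>v\<in>V'. E' u v \<longleftrightarrow> E (f u) (f v)" "v \<in> V'"
  shows "deg E (f v) = deg E' v"
  unfolding deg_def using bij_betw_same_card[OF iso_nbhd[OF assms]] by simp

lemma iso_nsum:
  assumes "sgraph V E" "sgraph V' E'" "bij_betw f V' V" "\<forall>u\<in>V'. \<forall>v\<in>V'. E' u v \<longleftrightarrow> E (f u) (f v)" "v \<in> V'"
  shows "nsum E h (f v) = nsum E' h v"
proof -
  have "nsum E' h v = (\<Sum>w | E' v w. h (deg E (f w)))"
    unfolding nsum_def using iso_deg[OF assms(1-4)] sgraphD(3)[OF assms(2)] by (intro sum.cong) auto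
  also have "\<dots> = nsum E h (f v)"
    unfolding nsum_def by (rule sum.reindex_bij_betw[OF iso_nbhd[OF assms]])
  finally show ?thesis by simp
qed

text \<open>An isomorphism preserves degrees and thus the degrees around a vertex, so it only
  permutes the summands. A product of two neighbour sums is taken because a switch with
  \<open>deg E a = deg E d\<close> moves a neighbour of some degree from one vertex of the class to
  another and leaves first moments unchanged.\<close>

lemma nsum_invariant:
  assumes "unigraph_on V E" "realizes V E E'"
  shows "(\<Sum>v\<in>V. g (deg E v) * nsum E' h v * nsum E' k v) = (\<Sum>v\<in>V. g (deg E v) * nsum E h v * nsum E k v)"
proof -
  have E: "sgraph V E" and E': "sgraph V E'" and d: "\<And>v. deg E' v = deg E v"
    using assms by (auto simp: unigraph_on_def realizes_def)
  obtain f where f: "bij_betw f V V" "\<forall>u\<in>V. \<forall>v\<in>V. E' u v \<longleftrightarrow> E (f u) (f v)"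
    using assms unfolding unigraph_on_def by blast
  have "(\<Sum>v\<in>V. g (deg E v) * nsum E' h v * nsum E' k v)
     = (\<Sum>v\<in>V. g (deg E (f v)) * nsum E h (f v) * nsum E k (f v))"
    using iso_deg[OF E E' f] iso_nsum[OF E E' f] d by (intro sum.cong) auto
  also have "\<dots> = (\<Sum>v\<in>V. g (deg E v) * nsum E h v * nsum E k v)"
    by (rule sum.reindex_bij_betw[OF f(1)])
  finally show ?thesis .
qed

lemma nsum_of_bool: "sgraph V E \<Longrightarrow> nsum E (\<lambda>x. of_bool (x = s)) v = class_deg E s v"
  unfolding nsum_def class_deg_def using sgraphD(7)[of V E v]
  by (simp add: of_bool_def sum.If_cases Int_def)

lemma nsum_const: "nsum E (\<lambda>x. 1) v = int (deg E v)"
  by (simp add: nsum_def deg_def)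

text \<open>
  The 2-switch that replaces the edges ab, cd of an alternating 4-cycle by ac, bd. The
  opposite pairs are (a,d) and (b,c).
\<close>

definition switch :: "('a \<Rightarrow> 'a \<Rightarrow> bool) \<Rightarrow> 'a \<Rightarrow> 'a \<Rightarrow> 'a \<Rightarrow> 'a \<Rightarrow> 'a \<Rightarrow> 'a \<Rightarrow> bool" where
  "switch E a b c d u v \<longleftrightarrow>
     (u = a \<and> v = c) \<or> (u = c \<and> v = a) \<or> (u = b \<and> v = d) \<or> (u = d \<and> v = b) \<or>
     (E u v \<and> \<not> (u = a \<and> v = b) \<and> \<not> (u = b \<and> v = a) \<and> \<not> (u = c \<and> v = d) \<and> \<not> (u = d \<and> v = c))"

locale alternating =
  fixes V :: "'a set" and E :: "'a \<Rightarrow> 'a \<Rightarrow> bool" and a b c d :: 'a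
  assumes E: "sgraph V E" and ab: "E a b" and cd: "E c d" and ac: "\<not> E a c" and bd: "\<not> E b d"
    and a_c: "a \<noteq> c" and b_d: "b \<noteq> d"
begin

lemma distinct4: "a \<noteq> b" "c \<noteq> d" "a \<noteq> c" "b \<noteq> d" "a \<noteq> d" "b \<noteq> c"
  using ab cd ac bd a_c b_d sgraphD[OF E] by metis+

lemma in_V: "a \<in> V" "b \<in> V" "c \<in> V" "d \<in> V"
  using ab cd sgraphD[OF E] by blast+

abbreviation "E' \<equiv> switch E a b c d"

lemma nbhds:
  "{w. E' a w} = insert c ({w. E a w} - {b})"
  "{w. E' b w} = insert d ({w. E b w} - {a})"
  "{w. E' c w} = insert a ({w. E c w} - {d})"
  "{w. E' d w} = insert b ({w. E d w} - {c})"
  "v \<notin> {a,b,c,d} \<Longrightarrow> {w. E' v w} = {w. E v w}"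
  using distinct4 unfolding switch_def by (fastforce simp: set_eq_iff)+

lemma sgraph_switch: "sgraph V E'"
proof -
  have "E' u v \<Longrightarrow> u \<in> V \<and> v \<in> V \<and> u \<noteq> v" for u v
    using sgraphD(2,3,5)[OF E] in_V distinct4 unfolding switch_def by metis
  moreover have "E' u v \<Longrightarrow> E' v u" for u v
    using sgraphD(4)[OF E] unfolding switch_def by blast
  ultimately show ?thesis using sgraphD(1)[OF E] unfolding sgraph_def by blast
qed

lemma deg_switch: "deg E' v = deg E v"
proof -
  have *: "card (insert x (S - {y})) = card S" if "finite S" "y \<in> S" "x \<notin> S" for x y :: 'a and S
    using that by (metis DiffD1 card_Suc_Diff1 card_insert_disjoint finite_Diff)
  have n: "\<not> E c a" "\<not> E d b" "E b a" "E d c" using ab cd ac bd sgraphD[OF E] by blast+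
  have fin: "finite {w. E u w}" for u by (rule sgraphD(7)[OF E])
  have "deg E' a = deg E a" unfolding deg_def nbhds by (rule *) (use ab ac fin in auto)
  moreover have "deg E' b = deg E b" unfolding deg_def nbhds by (rule *) (use n bd fin in auto)
  moreover have "deg E' c = deg E c" unfolding deg_def nbhds by (rule *) (use n cd fin in auto)
  moreover have "deg E' d = deg E d" unfolding deg_def nbhds by (rule *) (use n fin in auto)
  ultimately show ?thesis
    using nbhds(5)[of v] unfolding deg_def by (cases "v \<in> {a,b,c,d}") auto
qed

lemma realizes_switch: "realizes V E E'"
  using sgraph_switch deg_switch by (simp add: realizes_def)

lemma nsum_switch:
  "nsum E' h a = nsum E h a - h (deg E b) + h (deg E c)"
  "nsum E' h b = nsum E h b - h (deg E a) + h (deg E d)"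
  "nsum E' h c = nsum E h c - h (deg E d) + h (deg E a)"
  "nsum E' h d = nsum E h d - h (deg E c) + h (deg E b)"
  "v \<notin> {a,b,c,d} \<Longrightarrow> nsum E' h v = nsum E h v"
proof -
  have *: "(\<Sum>w\<in>insert x (S - {y}). h (deg E w)) = (\<Sum>w\<in>S. h (deg E w)) - h (deg E y) + h (deg E x)"
    if "finite S" "y \<in> S" "x \<notin> S" for x y :: 'a and S
    using that by (simp add: sum_diff1)
  have n: "\<not> E c a" "\<not> E d b" "E b a" "E d c" using ab cd ac bd sgraphD[OF E] by blast+
  have fin: "finite {w. E u w}" for u by (rule sgraphD(7)[OF E])
  show "nsum E' h a = nsum E h a - h (deg E b) + h (deg E c)"
    unfolding nsum_def deg_switch nbhds by (rule *) (use ab ac fin in auto)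
  show "nsum E' h b = nsum E h b - h (deg E a) + h (deg E d)"
    unfolding nsum_def deg_switch nbhds by (rule *) (use n bd fin in auto)
  show "nsum E' h c = nsum E h c - h (deg E d) + h (deg E a)"
    unfolding nsum_def deg_switch nbhds by (rule *) (use n cd fin in auto)
  show "nsum E' h d = nsum E h d - h (deg E c) + h (deg E b)"
    unfolding nsum_def deg_switch nbhds by (rule *) (use n fin in auto)
  show "v \<notin> {a,b,c,d} \<Longrightarrow> nsum E' h v = nsum E h v"
    unfolding nsum_def deg_switch using nbhds(5)[of v] by simp
qed

lemma sum_four:
  fixes f f' :: "'a \<Rightarrow> int"
  assumes "\<And>v. v \<in> V \<Longrightarrow> v \<notin> {a,b,c,d} \<Longrightarrow> f' v = f v"
  shows "sum f' V - sum f V = (f' a - f a) + (f' b - f b) + (f' c - f c) + (f' d - f d)"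
proof -
  have "sum f' V - sum f V = (\<Sum>v\<in>V. f' v - f v)" by (simp add: sum_subtractf)
  also have "\<dots> = (\<Sum>v\<in>{a,b,c,d}. f' v - f v)"
    using in_V assms sgraphD(1)[OF E] by (intro sum.mono_neutral_right) auto
  finally show ?thesis using distinct4 by simp
qed

lemma opposite_deg_eq:
  assumes "unigraph_on V E"
  shows "deg E a = deg E d \<or> deg E b = deg E c"
proof -
  \<comment> \<open>With these weights the total is the product of the two end degrees, summed over
    all ordered adjacent pairs. Replacing ab, cd by ac, bd changes it by twice (deg c - deg b)(deg a
    - deg d).\<close>
  let ?f = "\<lambda>E v. 1 * nsum E int v * nsum E (\<lambda>x. 1) v"
  have "sum (?f E') V = sum (?f E) V"
    using nsum_invariant[OF assms realizes_switch, of "\<lambda>_. 1" int "\<lambda>_. 1"] by simp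
  moreover have "sum (?f E') V - sum (?f E) V =
     (?f E' a - ?f E a) + (?f E' b - ?f E b) + (?f E' c - ?f E c) + (?f E' d - ?f E d)"
    by (rule sum_four) (simp add: nsum_switch(5))
  ultimately have "0 = (?f E' a - ?f E a) + (?f E' b - ?f E b) + (?f E' c - ?f E c) + (?f E' d - ?f E d)"
    by linarith
  also have "\<dots> = 2 * (int (deg E c) - int (deg E b)) * (int (deg E a) - int (deg E d))"
    unfolding nsum_switch nsum_const deg_switch by algebra
  finally have "0 = 2 * (int (deg E c) - int (deg E b)) * (int (deg E a) - int (deg E d))" .
  then have "int (deg E c) - int (deg E b) = 0 \<or> int (deg E a) - int (deg E d) = 0"
    by (metis mult_eq_0_iff zero_neq_numeral)
  then show ?thesis by linarith
qed

text \<open>At a the switch trades a neighbour of degree \<open>deg E b\<close> for one of degree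
  \<open>deg E c\<close>, at d it does the reverse, and at b and c no count changes. Invariance of
  the second moments over the class of a and d then forces the switch to interchange their two
  profiles.\<close>

lemma class_deg_opposite:
  assumes "unigraph_on V E" "deg E a = deg E d" "deg E b \<noteq> deg E c"
  shows "class_deg E s d = class_deg E s a + of_bool (s = deg E c) - of_bool (s = deg E b)"
proof -
  define r where "r = deg E c"
  define q where "q = deg E b"
  have eq: "of_bool (s = r) * (class_deg E r a - class_deg E r d + 2) - of_bool (s = q) * (class_deg E r a - class_deg E r d + 2)
      + class_deg E s a - class_deg E s d = 0" for s
  proof -
    let ?h = "\<lambda>s x. of_bool (x = s) :: int"
    let ?f = "\<lambda>E' v. ?h (deg E a) (deg E v) * nsum E' (?h r) v * nsum E' (?h s) v"
    have "sum (?f E') V = sum (?f E) V"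
      by (rule nsum_invariant[OF assms(1) realizes_switch])
    moreover have "sum (?f E') V - sum (?f E) V =
       (?f E' a - ?f E a) + (?f E' b - ?f E b) + (?f E' c - ?f E c) + (?f E' d - ?f E d)"
      by (rule sum_four) (simp add: nsum_switch(5))
    moreover have "?f E' b - ?f E b = 0" "?f E' c - ?f E c = 0"
      using assms(2) by (simp_all add: nsum_switch)
    ultimately have "?f E' a - ?f E a + (?f E' d - ?f E d) = 0" by linarith
    then show ?thesis
      using assms(2,3) unfolding nsum_switch nsum_of_bool[OF E] r_def[symmetric] q_def[symmetric]
      by (auto simp: algebra_simps)
  qed
  have "r \<noteq> q" using assms(3) by (simp add: r_def q_def)
  \<comment> \<open>For \<open>s = r\<close> the identity says (x + 1)^2 - x^2 + (y - 1)^2 - y^2 =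
    0, with x and y the counts at a and d, so y = x + 1. Substituting this makes the identity linear
    for every other \<open>s\<close>.\<close>
  then have K: "class_deg E r a - class_deg E r d + 2 = 1" using eq[of r] by simp
  show ?thesis using eq[of s] unfolding K r_def[symmetric] q_def[symmetric] by simp
qed

lemma class_deg_switch:
  assumes "deg E a = deg E d" "deg E b = deg E c"
  shows "class_deg E' s v = class_deg E s v"
  using nsum_switch[where h = "\<lambda>x. of_bool (x = s)"] assms
  unfolding nsum_of_bool[OF E] nsum_of_bool[OF sgraph_switch]
  by (cases "v \<in> {a,b,c,d}") auto

end

lemma opposite:
  assumes "unigraph_on V E" "E a b" "E c d" "\<not> E a c" "\<not> E b d" "a \<noteq> c" "b \<noteq> d"
  shows "deg E a = deg E d \<or> deg E b = deg E c"
proof -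
  interpret alternating V E a b c d
    using assms unigraph_onD[OF assms(1)] by unfold_locales
  show ?thesis by (rule opposite_deg_eq[OF assms(1)])
qed

text \<open>
  Realizations that also keep, for every vertex, the numbers of neighbours in each degree
  class. Arguments about such realizations may freely rearrange the edges inside one class
  or between two classes.
\<close>

definition class_equiv :: "'a set \<Rightarrow> ('a \<Rightarrow> 'a \<Rightarrow> bool) \<Rightarrow> ('a \<Rightarrow> 'a \<Rightarrow> bool) \<Rightarrow> bool" where
  "class_equiv V E E' \<longleftrightarrow> realizes V E E' \<and> (\<forall>s v. class_deg E' s v = class_deg E s v)"

lemma class_equivD:
  assumes "unigraph_on V E" "class_equiv V E E'"
  shows "unigraph_on V E'" "deg E' v = deg E v" "class_deg E' s v = class_deg E s v"
  using assms unigraph_on_realizes[of V E E'] by (auto simp: class_equiv_def realizes_def)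

lemma class_equiv_switch:
  assumes "unigraph_on V E" "E a b" "E c d" "\<not> E a c" "\<not> E b d" "a \<noteq> c" "b \<noteq> d"
    "deg E a = deg E d" "deg E b = deg E c"
  shows "class_equiv V E (switch E a b c d)"
proof -
  interpret alternating V E a b c d
    using assms unigraph_onD[OF assms(1)] by unfold_locales
  show ?thesis using realizes_switch class_deg_switch[OF assms(8,9)] by (simp add: class_equiv_def)
qed

section \<open>Comparing the neighbourhoods of two vertices of equal degree\<close>

definition deg_class :: "'a set \<Rightarrow> ('a \<Rightarrow> 'a \<Rightarrow> bool) \<Rightarrow> nat \<Rightarrow> 'a set" where
  "deg_class V E t = {v \<in> V. deg E v = t}"

lemma class_deg_cl: "sgraph V E \<Longrightarrow> class_deg E t v = int (card {w \<in> deg_class V E t. E v w})"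
  unfolding class_deg_def deg_class_def using sgraphD(3)[of V E v] by (intro arg_cong[where f = "\<lambda>X. int (card X)"]) blast

lemma class_deg_pos_iff: "sgraph V E \<Longrightarrow> class_deg E t v > 0 \<longleftrightarrow> (\<exists>w. E v w \<and> deg E w = t)"
  unfolding class_deg_def using sgraphD(8)[of V E v "\<lambda>w. deg E w = t"] by (auto simp: card_gt_0_iff)

lemma class_deg_nonneg: "class_deg E t v \<ge> 0"
  by (simp add: class_deg_def)

text \<open>Common neighbours cancel, and an edge between a and d counts on both sides or on neither
  because \<open>Q\<close> treats a and d alike. Only private neighbours remain.\<close>

lemma card_private:
  assumes "sgraph V E" "Q a \<longleftrightarrow> Q d"
  shows "int (card {w. E a w \<and> Q w}) - int (card {w. E d w \<and> Q w}) =
    int (card {w. E a w \<and> \<not> E d w \<and> w \<noteq> d \<and> Q w}) - int (card {w. E d w \<and> \<not> E a w \<and> w \<noteq> a \<and> Q w})"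
proof -
  have *: "card {w. E a w \<and> Q w} = card {w. E a w \<and> \<not> E d w \<and> w \<noteq> d \<and> Q w}
      + card {w. E a w \<and> E d w \<and> Q w} + (if E a d \<and> Q d then 1 else 0)" for a d
  proof -
    have "{w. E a w \<and> Q w} = ({w. E a w \<and> \<not> E d w \<and> w \<noteq> d \<and> Q w} \<union> {w. E a w \<and> E d w \<and> Q w})
        \<union> (if E a d \<and> Q d then {d} else {})"
      using sgraphD(5)[OF assms(1)] by auto
    moreover have "card \<dots> = card ({w. E a w \<and> \<not> E d w \<and> w \<noteq> d \<and> Q w} \<union> {w. E a w \<and> E d w \<and> Q w})
        + card (if E a d \<and> Q d then {d} else {})"
      using sgraphD(5)[OF assms(1)] sgraphD(8)[OF assms(1)] by (intro card_Un_disjoint) auto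
    moreover have "card ({w. E a w \<and> \<not> E d w \<and> w \<noteq> d \<and> Q w} \<union> {w. E a w \<and> E d w \<and> Q w}) =
        card {w. E a w \<and> \<not> E d w \<and> w \<noteq> d \<and> Q w} + card {w. E a w \<and> E d w \<and> Q w}"
      using sgraphD(8)[OF assms(1)] by (intro card_Un_disjoint) auto
    ultimately show ?thesis by auto
  qed
  have "{w. E d w \<and> E a w \<and> Q w} = {w. E a w \<and> E d w \<and> Q w}" by blast
  then show ?thesis
    using *[of a d] *[of d a] assms(2) sgraphD(6)[OF assms(1), of a d] by auto
qed

lemma class_deg_less_private:
  assumes "sgraph V E" "deg E a = deg E d" "class_deg E s d < class_deg E s a"
  obtains b where "E a b" "\<not> E d b" "b \<noteq> d" "deg E b = s"
proof -
  have "card {w. E a w \<and> \<not> E d w \<and> w \<noteq> d \<and> deg E w = s} > 0"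
    using card_private[OF assms(1), of "\<lambda>w. deg E w = s" a d] assms(2,3) unfolding class_deg_def by auto
  then show thesis using that by (auto simp: card_gt_0_iff)
qed

text \<open>Equal degrees give a and d equally many private neighbours. Since a has more private
  ones of degree \<open>s\<close>, those of d cannot all have that degree.\<close>

lemma class_deg_less_private_other:
  assumes E: "sgraph V E" and "deg E a = deg E d" "class_deg E s d < class_deg E s a"
  obtains c where "E d c" "\<not> E a c" "c \<noteq> a" "deg E c \<noteq> s"
proof (rule ccontr)
  let ?P = "\<lambda>a d. {w. E a w \<and> \<not> E d w \<and> w \<noteq> d}"
  let ?Q = "\<lambda>a d. {w. E a w \<and> \<not> E d w \<and> w \<noteq> d \<and> deg E w = s}"
  assume "\<not> thesis"
  then have "?Q d a = ?P d a" using that by blast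
  moreover have "card (?P a d) = card (?P d a)"
    using card_private[OF E, of "\<lambda>_. True" a d] assms(2) unfolding deg_def by auto
  moreover have "card (?Q a d) > card (?Q d a)"
    using card_private[OF E, of "\<lambda>w. deg E w = s" a d] assms(2,3) unfolding class_deg_def by auto
  moreover have "card (?Q a d) \<le> card (?P a d)"
    using sgraphD(8)[OF E] by (intro card_mono) auto
  ultimately show False by simp
qed

text \<open>Different profiles produce an alternating 4-cycle through a and d whose other opposite
  pair has different degrees, so the profiles differ by exactly one trade. If a vertex of a third
  degree separated a from d, it could replace b or c in that cycle, and the same profiles would
  differ by another trade.\<close>

lemma class_deg_diff:
  assumes u: "unigraph_on V E" and dd: "deg E a = deg E d" and ne: "class_deg E s0 a \<noteq> class_deg E s0 d"
  obtains b c where "deg E b \<noteq> deg E c"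
    "E a b" "\<not> E d b" "b \<noteq> d" "E d c" "\<not> E a c" "c \<noteq> a"
    "\<And>s. class_deg E s d = class_deg E s a + of_bool (s = deg E c) - of_bool (s = deg E b)"
    "\<And>x. deg E x \<noteq> deg E b \<Longrightarrow> deg E x \<noteq> deg E c \<Longrightarrow> x \<noteq> a \<Longrightarrow> x \<noteq> d \<Longrightarrow> E a x \<longleftrightarrow> E d x"
proof -
  have E: "sgraph V E" using u by (rule unigraph_onD)
  obtain b c where bc: "deg E b \<noteq> deg E c" "E a b" "\<not> E d b" "b \<noteq> d" "E d c" "\<not> E a c" "c \<noteq> a"
  proof (cases "class_deg E s0 d < class_deg E s0 a")
    case True
    from class_deg_less_private[OF E dd True] class_deg_less_private_other[OF E dd True] that show thesis by metis
  next
    case False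
    then have *: "class_deg E s0 a < class_deg E s0 d" using ne by simp
    from class_deg_less_private[OF E dd[symmetric] *] class_deg_less_private_other[OF E dd[symmetric] *] that
    show thesis by metis
  qed
  have nbd: "class_deg E s d = class_deg E s a + of_bool (s = deg E c') - of_bool (s = deg E b')"
    if "deg E b' \<noteq> deg E c'" "E a b'" "\<not> E d b'" "b' \<noteq> d" "E d c'" "\<not> E a c'" "c' \<noteq> a" for b' c' s
  proof -
    interpret alternating V E a b' c' d
      by unfold_locales (use that E sgraphD(4)[OF E] in blast)+
    show ?thesis using class_deg_opposite[OF u dd that(1)] .
  qed
  have "E a x \<longleftrightarrow> E d x" if x: "deg E x \<noteq> deg E b" "deg E x \<noteq> deg E c" "x \<noteq> a" "x \<noteq> d" for x
  proof (rule ccontr)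
    assume "\<not> (E a x \<longleftrightarrow> E d x)"
    then consider "E a x" "\<not> E d x" | "\<not> E a x" "E d x" by blast
    then show False
    proof cases
      case 1
      with nbd[OF bc, of "deg E x"] nbd[of x c "deg E x"] x bc show False by auto
    next
      case 2
      with nbd[OF bc, of "deg E x"] nbd[of b x "deg E x"] x bc show False by auto
    qed
  qed
  with that[OF bc] nbd[OF bc] show thesis by blast
qed

lemma class_deg_near:
  assumes "unigraph_on V E" "deg E a = deg E d"
  shows "class_deg E s a \<le> class_deg E s d + 1"
proof (cases "class_deg E s a = class_deg E s d")
  case False
  then obtain b c where "deg E b \<noteq> deg E c"
    "\<And>s. class_deg E s d = class_deg E s a + of_bool (s = deg E c) - of_bool (s = deg E b)"
    by (rule class_deg_diff[OF assms]) blast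
  then show ?thesis by auto
qed simp

text \<open>The trade between a and d touches exactly the two classes in which their counts differ;
  a vertex of any other class cannot separate them.\<close>

lemma twins:
  assumes "unigraph_on V E" "deg E a = deg E d" "class_deg E s0 a \<noteq> class_deg E s0 d"
    "class_deg E (deg E x) a = class_deg E (deg E x) d" "x \<noteq> a" "x \<noteq> d"
  shows "E a x \<longleftrightarrow> E d x"
proof -
  obtain b c where "deg E b \<noteq> deg E c"
    "\<And>s. class_deg E s d = class_deg E s a + of_bool (s = deg E c) - of_bool (s = deg E b)"
    "\<And>x. deg E x \<noteq> deg E b \<Longrightarrow> deg E x \<noteq> deg E c \<Longrightarrow> x \<noteq> a \<Longrightarrow> x \<noteq> d \<Longrightarrow> E a x \<longleftrightarrow> E d x"
    by (rule class_deg_diff[OF assms(1-3)]) blast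
  then show ?thesis using assms(4-6) by (auto simp: of_bool_def split: if_splits)
qed

text \<open>Inside the class the graph is replaced by its copy under a permutation that respects
  inner degrees, so no count changes at any vertex. Unlike a switch, this asks for no alternating
  4-cycle at a prescribed place.\<close>

lemma flex_perm:
  assumes E: "sgraph V E" and pi: "bij_betw \<pi> (deg_class V E t) (deg_class V E t)"
    "\<And>v. v \<in> deg_class V E t \<Longrightarrow> class_deg E t (\<pi> v) = class_deg E t v"
  defines "E' \<equiv> \<lambda>u v. if u \<in> deg_class V E t \<and> v \<in> deg_class V E t then E (\<pi> u) (\<pi> v) else E u v"
  shows "class_equiv V E E'"
proof -
  let ?M = "deg_class V E t"
  have piM: "\<pi> v \<in> ?M" if "v \<in> ?M" for v using pi(1) that bij_betwE by blast
  have inj: "\<pi> u = \<pi> v \<longleftrightarrow> u = v" if "u \<in> ?M" "v \<in> ?M" for u v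
    using pi(1) that by (auto simp: bij_betw_def inj_on_def)
  have sg: "sgraph V E'"
  proof -
    have "E' u v \<Longrightarrow> u \<in> V \<and> v \<in> V \<and> u \<noteq> v" for u v
      using sgraphD(2,3,5)[OF E] piM unfolding E'_def by (auto simp: deg_class_def split: if_splits)
    moreover have "E' u v \<Longrightarrow> E' v u" for u v
      using sgraphD(4)[OF E] unfolding E'_def by (auto split: if_splits)
    ultimately show ?thesis using sgraphD(1)[OF E] unfolding sgraph_def by blast
  qed
  have out: "{w. E' v w \<and> w \<notin> ?M} = {w. E v w \<and> w \<notin> ?M}" for v by (auto simp: E'_def)
  have "card {w. E' v w \<and> w \<in> ?M} = card {w. E v w \<and> w \<in> ?M}" for v
  proof (cases "v \<in> ?M")
    case True
    have "bij_betw \<pi> {w. E' v w \<and> w \<in> ?M} {w. E (\<pi> v) w \<and> w \<in> ?M}"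
    proof (rule bij_betw_subset[OF pi(1)])
      show "\<pi> ` {w. E' v w \<and> w \<in> ?M} = {w. E (\<pi> v) w \<and> w \<in> ?M}"
      proof
        show "\<pi> ` {w. E' v w \<and> w \<in> ?M} \<subseteq> {w. E (\<pi> v) w \<and> w \<in> ?M}"
          using True piM by (auto simp: E'_def)
        show "{w. E (\<pi> v) w \<and> w \<in> ?M} \<subseteq> \<pi> ` {w. E' v w \<and> w \<in> ?M}"
        proof
          fix x assume x: "x \<in> {w. E (\<pi> v) w \<and> w \<in> ?M}"
          then obtain w where "w \<in> ?M" "x = \<pi> w" using pi(1) by (auto simp: bij_betw_def)
          then show "x \<in> \<pi> ` {w. E' v w \<and> w \<in> ?M}" using x True by (auto simp: E'_def)
        qed
      qed
    qed blast
    then have "card {w. E' v w \<and> w \<in> ?M} = card {w. E (\<pi> v) w \<and> w \<in> ?M}" by (rule bij_betw_same_card)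
    also have "\<dots> = card {w. E v w \<and> w \<in> ?M}"
      using pi(2)[OF True] unfolding class_deg_cl[OF E] by (simp add: conj_commute)
    finally show ?thesis .
  qed (simp add: E'_def)
  note inn = this
  have dg: "deg E' v = deg E v" for v
  proof -
    have *: "deg F v = card {w. F v w \<and> w \<in> ?M} + card {w. F v w \<and> w \<notin> ?M}" if "sgraph V F" for F
    proof -
      have "{w. F v w} = {w. F v w \<and> w \<in> ?M} \<union> {w. F v w \<and> w \<notin> ?M}" by blast
      then show ?thesis unfolding deg_def
        using sgraphD(8)[OF that] by (simp add: card_Un_disjoint disjoint_iff)
    qed
    show ?thesis using *[OF E] *[OF sg] inn out by simp
  qed
  have "class_deg E' s v = class_deg E s v" for s v
  proof (cases "s = t")
    case True
    have "deg_class V E' t = ?M" unfolding deg_class_def using dg by auto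
    then show ?thesis using class_deg_cl[OF sg, of t v] class_deg_cl[OF E, of t v] inn[of v] True
      by (simp add: conj_commute)
  next
    case False
    then have "{w. E' v w \<and> deg E' w = s} = {w. E v w \<and> deg E w = s}"
      unfolding dg by (auto simp: E'_def deg_class_def)
    then show ?thesis by (simp add: class_deg_def)
  qed
  with sg dg show ?thesis by (simp add: class_equiv_def realizes_def)
qed

lemma flex:
  assumes "sgraph V E" "a \<in> deg_class V E t" "b \<in> deg_class V E t" "x \<in> deg_class V E t" "y \<in> deg_class V E t" "a \<noteq> b" "x \<noteq> y"
    "class_deg E t a = class_deg E t x" "class_deg E t b = class_deg E t y"
  obtains E' where "class_equiv V E E'" "E' a b \<longleftrightarrow> E x y"
    "\<And>u v. deg E u \<noteq> t \<or> deg E v \<noteq> t \<Longrightarrow> E' u v \<longleftrightarrow> E u v"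
proof -
  let ?M = "deg_class V E t"
  \<comment> \<open>Swapping a and x may already move b, so the second transposition has to start
    from the place where b has been sent.\<close>
  define b' where "b' = transpose a x b"
  define \<pi> where "\<pi> = transpose b' y \<circ> transpose a x"
  have b': "b' \<in> ?M" "b' \<noteq> x" "class_deg E t b' = class_deg E t y"
    using assms unfolding b'_def by (auto simp: transpose_def)
  have pa: "\<pi> a = x" and pb: "\<pi> b = y"
    using assms b' unfolding \<pi>_def by (auto simp: transpose_def b'_def)
  have "bij_betw (transpose p q) ?M ?M" if "p \<in> ?M" "q \<in> ?M" for p q
    by (rule bij_betw_byWitness[where f' = "transpose p q"]) (use that in \<open>auto simp: transpose_def\<close>)
  note tr = this
  have "bij_betw \<pi> ?M ?M" unfolding \<pi>_def
    by (rule bij_betw_trans[OF tr[OF assms(2,4)] tr[OF b'(1) assms(5)]])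
  moreover have "class_deg E t (transpose p q v) = class_deg E t v" if "class_deg E t p = class_deg E t q" for p q v
    using that by (simp add: transpose_def)
  then have "class_deg E t (\<pi> v) = class_deg E t v" for v
    unfolding \<pi>_def using assms(8) b'(3) by simp
  ultimately have "class_equiv V E (\<lambda>u v. if u \<in> ?M \<and> v \<in> ?M then E (\<pi> u) (\<pi> v) else E u v)"
    by (intro flex_perm[OF assms(1)])
  then show thesis
    by (rule that) (use assms(2-5) pa pb in \<open>auto simp: deg_class_def\<close>)
qed

section \<open>Complementation\<close>

lemma sgraph_co: "finite V \<Longrightarrow> sgraph V E \<Longrightarrow> sgraph V (compl_on V E)"
  using sgraphD(6)[of V E] unfolding sgraph_def[of V "compl_on V E"] compl_on_def by blast

lemma co_co: "sgraph V E \<Longrightarrow> compl_on V (compl_on V E) = E"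
  using sgraphD(2,3,5)[of V E] unfolding compl_on_def fun_eq_iff by blast

lemma deg_co:
  assumes "sgraph V E" "v \<in> V"
  shows "deg E v + deg (compl_on V E) v + 1 = card V"
proof -
  let ?N = "{w. E v w}" and ?C = "{w. compl_on V E v w}"
  have fin: "finite ?N" "finite ?C"
    using sgraphD(7)[OF assms(1)] sgraphD(7)[OF sgraph_co[OF sgraphD(1)[OF assms(1)] assms(1)]] by auto
  have "?N \<union> ?C = V - {v}"
    using assms sgraphD(3,5)[OF assms(1)] unfolding compl_on_def by blast
  moreover have "card (?N \<union> ?C) = card ?N + card ?C"
    using fin by (intro card_Un_disjoint) (auto simp: compl_on_def)
  moreover have "card (V - {v}) + 1 = card V"
    using card_Suc_Diff1[OF sgraphD(1)[OF assms(1)] assms(2)] by simp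
  ultimately show ?thesis unfolding deg_def by simp
qed

lemma deg_outside: "sgraph V E \<Longrightarrow> v \<notin> V \<Longrightarrow> deg E v = 0"
  unfolding deg_def using sgraphD(2)[of V E v] by (metis card.empty Collect_empty_eq)

lemma deg_co_eq:
  assumes "sgraph V E" "u \<in> V" "v \<in> V"
  shows "deg (compl_on V E) u = deg (compl_on V E) v \<longleftrightarrow> deg E u = deg E v"
  using deg_co[OF assms(1,2)] deg_co[OF assms(1,3)] by linarith

lemma unigraph_on_co:
  assumes "unigraph_on V E"
  shows "unigraph_on V (compl_on V E)"
  unfolding unigraph_on_def
proof (intro conjI allI impI)
  have E: "sgraph V E" using assms by (rule unigraph_onD)
  note cE = sgraph_co[OF sgraphD(1)[OF E] E]
  show "sgraph V (compl_on V E)" by (rule cE)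
  fix E' assume E': "realizes V (compl_on V E) E'"
  then have sE': "sgraph V E'" by (simp add: realizes_def)
  note cE' = sgraph_co[OF sgraphD(1)[OF sE'] sE']
  have "deg (compl_on V E') v = deg E v" for v
  proof (cases "v \<in> V")
    case True
    then show ?thesis using deg_co[OF sE' True] deg_co[OF E True] E' by (simp add: realizes_def)
  qed (simp add: deg_outside[OF cE'] deg_outside[OF E])
  with cE' have "realizes V E (compl_on V E')" by (simp add: realizes_def)
  then obtain f where f: "bij_betw f V V" "\<forall>u\<in>V. \<forall>v\<in>V. compl_on V E' u v \<longleftrightarrow> E (f u) (f v)"
    using assms unfolding unigraph_on_def by blast
  have "E' u v \<longleftrightarrow> compl_on V E (f u) (f v)" if "u \<in> V" "v \<in> V" for u v
  proof -
    have "f u \<in> V" "f v \<in> V" "f u = f v \<longleftrightarrow> u = v"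
      using f(1) that by (auto simp: bij_betw_def inj_on_def)
    then show ?thesis using f(2) that sgraphD(5)[OF sE'] unfolding compl_on_def by metis
  qed
  with f(1) show "\<exists>f. bij_betw f V V \<and> (\<forall>u\<in>V. \<forall>v\<in>V. E' u v \<longleftrightarrow> compl_on V E (f u) (f v))" by blast
qed

lemma cl_co:
  assumes "sgraph V E" "u \<in> V"
  shows "deg_class V (compl_on V E) (deg (compl_on V E) u) = deg_class V E (deg E u)"
  unfolding deg_class_def using deg_co_eq[OF assms(1) _ assms(2)] by blast

text \<open>A vertex of the class is a neighbour of itself neither in the graph nor in its
  complement; this accounts for the last term.\<close>

lemma class_deg_co:
  assumes E: "sgraph V E" and "u \<in> V" "v \<in> V"
  shows "class_deg (compl_on V E) (deg (compl_on V E) u) v =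
    int (card (deg_class V E (deg E u))) - class_deg E (deg E u) v - of_bool (deg E v = deg E u)"
proof -
  let ?M = "deg_class V E (deg E u)"
  have fin: "finite ?M" using sgraphD(1)[OF E] by (simp add: deg_class_def)
  have "class_deg (compl_on V E) (deg (compl_on V E) u) v = int (card {w \<in> ?M. compl_on V E v w})"
    unfolding class_deg_cl[OF sgraph_co[OF sgraphD(1)[OF E] E]] cl_co[OF E assms(2)] ..
  also have "{w \<in> ?M. compl_on V E v w} = (?M - {w \<in> ?M. E v w}) - (if v \<in> ?M then {v} else {})"
    using assms by (auto simp: compl_on_def deg_class_def)
  also have "int (card \<dots>) = int (card ?M) - class_deg E (deg E u) v - of_bool (v \<in> ?M)"
  proof -
    have "card (?M - {w \<in> ?M. E v w}) + card {w \<in> ?M. E v w} = card ?M"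
      using fin by (metis (no_types, lifting) card_Diff_subset card_mono finite_subset le_add_diff_inverse2 mem_Collect_eq subsetI)
    moreover have "card (?M - {w \<in> ?M. E v w} - {v}) + 1 = card (?M - {w \<in> ?M. E v w})" if "v \<in> ?M"
      using that fin sgraphD(5)[OF E] by (metis (mono_tags, lifting) Diff_iff One_nat_def Suc_eq_plus1 card_Suc_Diff1 finite_Diff mem_Collect_eq)
    ultimately show ?thesis unfolding class_deg_cl[OF E] by auto
  qed
  finally show ?thesis using assms(3) by (simp add: deg_class_def)
qed

section \<open>Mixed degree classes and split graphs\<close>

definition mixed :: "'a set \<Rightarrow> ('a \<Rightarrow> 'a \<Rightarrow> bool) \<Rightarrow> nat \<Rightarrow> bool" where
  "mixed V E t \<longleftrightarrow> (\<exists>a\<in>deg_class V E t. \<exists>b\<in>deg_class V E t. E a b) \<and>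
     (\<exists>a\<in>deg_class V E t. \<exists>b\<in>deg_class V E t. a \<noteq> b \<and> \<not> E a b)"

lemma mixedI:
  assumes "sgraph V E" "E a b" "x \<in> V" "y \<in> V" "x \<noteq> y" "\<not> E x y" "deg E a = t" "deg E b = t" "deg E x = t" "deg E y = t"
  shows "mixed V E t"
  using assms sgraphD(2,3)[OF assms(1)] unfolding mixed_def deg_class_def by blast

definition is_clique :: "('a \<Rightarrow> 'a \<Rightarrow> bool) \<Rightarrow> 'a set \<Rightarrow> bool" where
  "is_clique E A \<longleftrightarrow> (\<forall>u\<in>A. \<forall>v\<in>A. u \<noteq> v \<longrightarrow> E u v)"

definition is_stable :: "('a \<Rightarrow> 'a \<Rightarrow> bool) \<Rightarrow> 'a set \<Rightarrow> bool" where
  "is_stable E A \<longleftrightarrow> (\<forall>u\<in>A. \<forall>v\<in>A. \<not> E u v)"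

text \<open>The two alternating cycles through ab and cd pair the four vertices in two different
  ways, so the resulting equalities share a vertex and three vertices have equal degree. Any three
  of the four span an edge and a non-edge, which makes their class mixed. The same argument gives
  \<open>no_C4\<close>.\<close>

lemma no_2K2:
  assumes "unigraph_on V E" "\<nexists>t. mixed V E t" "E a b" "E c d" "\<not> E a c" "\<not> E a d" "\<not> E b c" "\<not> E b d"
  shows False
proof -
  note E = unigraph_onD[OF assms(1)] note S = sgraphD(2-5)[OF E]
  have V: "a \<in> V" "b \<in> V" "c \<in> V" "d \<in> V" "a \<noteq> c" "a \<noteq> d" "b \<noteq> c" "b \<noteq> d"
    using assms(3-8) S by metis+
  have "deg E a = deg E d \<or> deg E b = deg E c"
    using opposite[OF assms(1), of a b c d] assms(3-8) V by blast
  moreover have "deg E a = deg E c \<or> deg E b = deg E d"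
    using opposite[OF assms(1), of a b d c] assms(3-8) V S by blast
  ultimately show False
    using mixedI[OF E assms(3)] mixedI[OF E assms(4)] assms V S by metis
qed

lemma no_C4:
  assumes "unigraph_on V E" "\<nexists>t. mixed V E t" "E a b" "E b c" "E c d" "E d a" "\<not> E a c" "\<not> E b d" "a \<noteq> c" "b \<noteq> d"
  shows False
proof -
  note E = unigraph_onD[OF assms(1)] note S = sgraphD(2-5)[OF E]
  have V: "a \<in> V" "b \<in> V" "c \<in> V" "d \<in> V"
    using assms(3-8) S by metis+
  have "deg E a = deg E d \<or> deg E b = deg E c"
    using opposite[OF assms(1), of a b c d] assms(3-10) by blast
  moreover have "deg E a = deg E b \<or> deg E d = deg E c"
    using opposite[OF assms(1), of a d c b] assms(3-10) S by metis
  ultimately show False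
    using mixedI[OF E assms(3)] mixedI[OF E assms(4)] mixedI[OF E assms(5)] mixedI[OF E assms(6)] assms V S by metis
qed

text \<open>Each of the five induced paths on four vertices is an alternating cycle, and the five
  conditions involve ten distinct pairs, so at least five pairs have equal degrees. Any three
  vertices of a 5-cycle span an edge and a non-edge, so without mixed classes at most two vertices
  share a degree, leaving at most two such pairs.\<close>

lemma no_C5:
  assumes "unigraph_on V E" "\<nexists>t. mixed V E t" "E a b" "E b c" "E c d" "E d e" "E e a"
    "\<not> E a c" "\<not> E b d" "\<not> E c e" "\<not> E d a" "\<not> E e b"
  shows False
proof -
  note E = unigraph_onD[OF assms(1)] note S = sgraphD(2-5)[OF E]
  have V: "a \<in> V" "b \<in> V" "c \<in> V" "d \<in> V" "e \<in> V"
    using assms(3-7) S(1) by blast+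
  have ne: "a \<noteq> c" "b \<noteq> d" "c \<noteq> e" "d \<noteq> a" "e \<noteq> b"
    using assms(3-) S(3) by blast+
  have o: "deg E p = deg E s \<or> deg E q = deg E r"
    if "E p q" "E q r" "E r s" "\<not> E p r" "\<not> E q s" "p \<noteq> r" "q \<noteq> s" for p q r s
    using opposite[OF assms(1), of p q r s] that by blast
  have x: "deg E a = deg E d \<or> deg E b = deg E c" "deg E b = deg E e \<or> deg E c = deg E d"
    "deg E c = deg E a \<or> deg E d = deg E e" "deg E d = deg E b \<or> deg E e = deg E a"
    "deg E e = deg E c \<or> deg E a = deg E b"
    using o[of a b c d] o[of b c d e] o[of c d e a] o[of d e a b] o[of e a b c] assms(3-) ne by blast+
  have m: "\<not> (deg E p = deg E q \<and> deg E p = deg E r)" if "E p q" "\<not> E p r" "p \<noteq> r" "r \<in> V" for p q r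
    using mixedI[OF E that(1) S(1)[OF that(1)] that(4,3,2)] assms(2) by metis
  have m': "\<not> (deg E p = deg E q \<and> deg E q = deg E r)" if "E p q" "\<not> E q r" "q \<noteq> r" "r \<in> V" for p q r
    using mixedI[OF E that(1) S(2)[OF that(1)] that(4,3,2)] assms(2) by metis
  show False
    using x m[OF assms(3) assms(8) ne(1) V(3)] m[OF assms(4) assms(9) ne(2) V(4)]
      m[OF assms(5) assms(10) ne(3) V(5)] m[OF assms(6) assms(11) ne(4) V(1)] m[OF assms(7) assms(12) ne(5) V(2)]
      m'[OF assms(3) assms(9) ne(2) V(4)] m'[OF assms(4) assms(10) ne(3) V(5)]
      m'[OF assms(5) assms(11) ne(4) V(1)] m'[OF assms(6) assms(12) ne(5) V(2)] m'[OF assms(7) assms(8) ne(1) V(3)]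
    by argo
qed

text \<open>
  Foldes and Hammer: choose a maximum clique that leaves as few edges as possible outside.
\<close>
lemma split_if_forbidden:
  assumes E: "sgraph V E"
    and n2K2: "\<And>a b c d. E a b \<Longrightarrow> E c d \<Longrightarrow> \<not> E a c \<Longrightarrow> \<not> E a d \<Longrightarrow> \<not> E b c \<Longrightarrow> \<not> E b d \<Longrightarrow> False"
    and nC4: "\<And>a b c d. E a b \<Longrightarrow> E b c \<Longrightarrow> E c d \<Longrightarrow> E d a \<Longrightarrow> \<not> E a c \<Longrightarrow> \<not> E b d \<Longrightarrow> a \<noteq> c \<Longrightarrow> b \<noteq> d \<Longrightarrow> False"
    and nC5: "\<And>a b c d e. E a b \<Longrightarrow> E b c \<Longrightarrow> E c d \<Longrightarrow> E d e \<Longrightarrow> E e a \<Longrightarrow>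
      \<not> E a c \<Longrightarrow> \<not> E b d \<Longrightarrow> \<not> E c e \<Longrightarrow> \<not> E d a \<Longrightarrow> \<not> E e b \<Longrightarrow> False"
  obtains A where "A \<subseteq> V" "is_clique E A" "is_stable E (V - A)"
proof -
  note S = sgraphD(2-5)[OF E] and fV = sgraphD(1)[OF E]
  define CL where "CL = {A. A \<subseteq> V \<and> is_clique E A}"
  define out where "out A = card {(u,v). u \<in> V - A \<and> v \<in> V - A \<and> E u v}" for A
  have finCL: "finite CL" using fV by (auto simp: CL_def)
  have "{} \<in> CL" by (auto simp: CL_def is_clique_def)
  then obtain A0 where A0: "A0 \<in> CL" "\<And>A. A \<in> CL \<Longrightarrow> card A \<le> card A0"
  proof -
    have "Max (card ` CL) \<in> card ` CL" using finCL \<open>{} \<in> CL\<close> by (intro Max_in) auto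
    then obtain A0 where "A0 \<in> CL" "card A0 = Max (card ` CL)" by force
    then show ?thesis using that finCL by (metis Max_ge finite_imageI imageI)
  qed
  define MC where "MC = {A \<in> CL. card A = card A0}"
  have "finite MC" "A0 \<in> MC" using finCL A0 by (auto simp: MC_def)
  then obtain A where A: "A \<in> MC" "\<And>B. B \<in> MC \<Longrightarrow> out A \<le> out B"
    by (metis (mono_tags, lifting) arg_min_if_finite(1) arg_min_if_finite(2) empty_iff leI)
  have AV: "A \<subseteq> V" and Acl: "is_clique E A" and cA: "card A = card A0"
    using A(1) by (auto simp: MC_def CL_def)
  have fA: "finite A" using AV fV by (rule finite_subset)
  have maxA: "card B \<le> card A" if "B \<subseteq> V" "is_clique E B" for B
    using A0(2)[of B] that cA by (simp add: CL_def)
  have "\<not> E x y" if xy: "x \<in> V - A" "y \<in> V - A" for x y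
  proof
    assume Exy: "E x y"
    have nonnb: "\<exists>u\<in>A. \<not> E x u" if "x \<in> V - A" for x
    proof (rule ccontr)
      assume "\<not> ?thesis"
      then have "is_clique E (insert x A)" using Acl S(3) unfolding is_clique_def by blast
      from maxA[OF _ this] that AV fA show False by auto
    qed
    \<comment> \<open>Suppose every vertex of \<open>A\<close> missed by x is missed by y. By
      2K2-freeness x misses a single vertex u of \<open>A\<close>, and exchanging u for x gives a
      maximum clique again. The choice of \<open>A\<close> and the other forbidden graphs then allow
      x and y together to replace u, giving a larger clique.\<close>
    have key: False
      if xy: "x \<in> V - A" "y \<in> V - A" "E x y" and sub: "\<And>w. w \<in> A \<Longrightarrow> \<not> E x w \<Longrightarrow> \<not> E y w" for x y
    proof -
      have one: "u = v" if "u \<in> A" "v \<in> A" "\<not> E x u" "\<not> E x v" for u v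
        using n2K2[of x y u v] that sub xy Acl unfolding is_clique_def by blast
      obtain u where u: "u \<in> A" "\<not> E x u" using nonnb xy by blast
      have uy: "\<not> E y u" using sub u by blast
      have xA: "E x w" if "w \<in> A" "w \<noteq> u" for w using one u that by blast
      define A' where "A' = insert x (A - {u})"
      have "A' \<subseteq> V" using AV xy by (auto simp: A'_def)
      moreover have "is_clique E A'"
        using Acl xA S(3) unfolding is_clique_def A'_def by blast
      moreover have "card A' = card A"
        using u xy fA unfolding A'_def by (metis DiffD1 DiffD2 card_Suc_Diff1 card_insert_disjoint finite_Diff)
      ultimately have "A' \<in> MC" using cA by (simp add: MC_def CL_def)
      then have le: "out A \<le> out A'" by (rule A(2))
      have "\<exists>z\<in>V - A. E u z \<and> \<not> E x z \<and> z \<noteq> x"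
      proof (rule ccontr)
        assume no: "\<not> ?thesis"
        \<comment> \<open>Without such a z, renaming u to x injects the edges left outside by
          \<open>A'\<close> into those left outside by \<open>A\<close>. The image misses xy because
          u and y are not adjacent, so \<open>A'\<close> would leave fewer edges.\<close>
        define \<phi> where "\<phi> p = (case p of (p, q) \<Rightarrow> (if p = u then x else p, if q = u then x else q))" for p :: "'a \<times> 'a"
        let ?X = "{(p,q). p \<in> V - A \<and> q \<in> V - A \<and> E p q}"
        let ?X' = "{(p,q). p \<in> V - A' \<and> q \<in> V - A' \<and> E p q}"
        have fX: "finite ?X" by (rule finite_subset[of _ "V \<times> V"]) (use fV in auto)
        have inV: "p \<in> V - A' \<longleftrightarrow> p = u \<or> (p \<in> V - A \<and> p \<noteq> x)" for p
          using u AV xy by (auto simp: A'_def)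
        have "inj_on \<phi> ?X'"
          using xy inV by (auto simp: inj_on_def \<phi>_def)
        moreover have "\<phi> ` ?X' \<subseteq> ?X - {(x,y)}"
        proof -
          have *: "\<phi> (p,q) \<in> ?X - {(x,y)}" if pq: "p \<in> V - A'" "q \<in> V - A'" "E p q" for p q
          proof (cases "p = u")
            case True
            then have "q \<noteq> u" using pq(3) S(4) by blast
            then have "q \<in> V - A" "q \<noteq> x" using pq(2) inV[of q] by blast+
            then have "E x q" using no True pq by blast
            moreover have "q \<noteq> y" using uy True pq S by blast
            ultimately show ?thesis using True \<open>q \<noteq> u\<close> \<open>q \<in> V - A\<close> xy(1) by (auto simp: \<phi>_def)
          next
            case False
            then have p: "p \<in> V - A" "p \<noteq> x" using pq inV by auto
            show ?thesis
            proof (cases "q = u")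
              case True
              then have "E x p" using no pq p S by blast
              then show ?thesis using True False p xy S by (auto simp: \<phi>_def)
            next
              case False
              then have "q \<in> V - A" using pq inV by auto
              then show ?thesis using False \<open>p \<noteq> u\<close> p pq by (auto simp: \<phi>_def)
            qed
          qed
          show ?thesis
          proof
            fix r assume "r \<in> \<phi> ` ?X'"
            then obtain p q where pq: "r = \<phi> (p,q)" "p \<in> V - A'" "q \<in> V - A'" "E p q" by auto
            show "r \<in> ?X - {(x,y)}" unfolding pq(1) by (rule *[OF pq(2-4)])
          qed
        qed
        ultimately have "out A' \<le> card (?X - {(x,y)})"
          unfolding out_def using fX by (intro card_inj_on_le) auto
        also have "\<dots> < card ?X" using fX xy by (intro card_Diff1_less) auto
        finally show False using le by (simp add: out_def)
      qed
      then obtain z where z: "z \<in> V - A" "E u z" "\<not> E x z" "z \<noteq> x" by blast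
      have zy: "E z y" using n2K2[of x y u z] xy u uy z S by blast
      \<comment> \<open>If w misses y, then x, w, z, y form a C4 or x, w, u, z, y form a C5,
        according to whether w sees z.\<close>
      have all: "E w y" if w: "w \<in> A" "w \<noteq> u" for w
      proof (rule ccontr)
        assume nwy: "\<not> E w y"
        have xw: "E x w" using xA w by blast
        have wu: "E w u" using Acl w u unfolding is_clique_def by blast
        have "w \<noteq> y" "x \<noteq> u" using w xy u by auto
        show False
        proof (cases "E w z")
          case True
          then show False using nC4[of x w z y] xw zy xy z nwy S \<open>w \<noteq> y\<close> by blast
        next
          case False
          then show False using nC5[of x w u z y] xw wu u(2) z zy xy nwy uy S by blast
        qed
      qed
      have "is_clique E (insert x (insert y (A - {u})))"
        using Acl xA all xy(3) S(3)[OF xA] S(3)[OF all] S(3)[OF xy(3)] by (auto simp: is_clique_def)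
      moreover have "insert x (insert y (A - {u})) \<subseteq> V" using AV xy by blast
      moreover have "card (insert x (insert y (A - {u}))) = card A + 1"
      proof -
        have "x \<notin> insert y (A - {u})" "y \<notin> A - {u}" using xy S by auto
        then have "card (insert x (insert y (A - {u}))) = Suc (Suc (card (A - {u})))"
          using fA by simp
        then show ?thesis using card_Suc_Diff1[OF fA u(1)] by linarith
      qed
      ultimately show False using maxA[of "insert x (insert y (A - {u}))"] by linarith
    qed
    show False
    proof (cases "\<forall>w\<in>A. \<not> E x w \<longrightarrow> \<not> E y w")
      case True
      then show False using key[OF xy Exy] by blast
    next
      case False
      then obtain u where u: "u \<in> A" "\<not> E x u" "E y u" by blast
      \<comment> \<open>The vertices missed by x and by y are nested one way or the other: crossing
        ones would complete the edge xy to a C4. So \<open>key\<close> applies with x and y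
        exchanged.\<close>
      have "\<not> E x w" if w: "w \<in> A" "\<not> E y w" for w
      proof
        assume "E x w"
        moreover have "E w u" using Acl u w unfolding is_clique_def by metis
        moreover have "x \<noteq> u" "w \<noteq> y" using u w xy by auto
        ultimately show False using nC4[of x w u y] u w Exy S by blast
      qed
      then show False using key[of y x] xy Exy S by blast
    qed
  qed
  then have "is_stable E (V - A)" by (auto simp: is_stable_def)
  with AV Acl that show thesis by blast
qed

lemma no_mixed_split:
  assumes "unigraph_on V E" "\<nexists>t. mixed V E t"
  obtains A where "A \<subseteq> V" "is_clique E A" "is_stable E (V - A)"
proof (rule split_if_forbidden[OF unigraph_onD[OF assms(1)] _ _ _ that])
qed (rule no_2K2[OF assms] no_C4[OF assms] no_C5[OF assms]; assumption)+

section \<open>Variation inside a mixed class\<close>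

lemma exchange:
  assumes "sgraph V E" "deg E a = deg E b" "class_deg E s b \<le> class_deg E s a" "E b y" "\<not> E a y" "y \<noteq> a" "deg E y = s"
  obtains u where "E a u" "\<not> E b u" "u \<noteq> b" "deg E u = s"
proof -
  have "card {w. E b w \<and> \<not> E a w \<and> w \<noteq> a \<and> deg E w = s} > 0"
    using assms(4-7) sgraphD(8)[OF assms(1), of b "\<lambda>w. \<not> E a w \<and> w \<noteq> a \<and> deg E w = s"]
    by (auto simp: card_gt_0_iff)
  then have "card {w. E a w \<and> \<not> E b w \<and> w \<noteq> b \<and> deg E w = s} > 0"
    using card_private[OF assms(1), of "\<lambda>w. deg E w = s" a b] assms(2,3) unfolding class_deg_def by auto
  then show thesis using that by (auto simp: card_gt_0_iff)
qed

text \<open>As a and d have equal inner degree, their trade is between two outside classes, those of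
  b and c. A vertex of larger inner degree gives up one neighbour in one of these classes when
  compared with a, and in the other when compared with d. These trades conflict, by different
  arguments according to whether a and d are adjacent.\<close>

lemma inner_variation_aux:
  assumes u: "unigraph_on V E" and deg: "deg E a = t" "deg E d = t" "deg E z = t"
    and ne: "class_deg E s0 a \<noteq> class_deg E s0 d" and ad: "class_deg E t a = class_deg E t d" and az: "class_deg E t z = class_deg E t a + 1"
  shows False
proof -
  note E = unigraph_onD[OF u] note S = sgraphD(2-5)[OF E]
  have dd: "deg E a = deg E d" using deg by simp
  obtain b c where bc: "deg E b \<noteq> deg E c" "E a b" "\<not> E d b" "b \<noteq> d" "E d c" "\<not> E a c" "c \<noteq> a"
    and nbd: "\<And>s. class_deg E s d = class_deg E s a + of_bool (s = deg E c) - of_bool (s = deg E b)"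
    and agree: "\<And>x. deg E x \<noteq> deg E b \<Longrightarrow> deg E x \<noteq> deg E c \<Longrightarrow> x \<noteq> a \<Longrightarrow> x \<noteq> d \<Longrightarrow> E a x \<longleftrightarrow> E d x"
    by (rule class_deg_diff[OF u dd ne]) blast
  have qt: "deg E b \<noteq> t" "deg E c \<noteq> t"
    using nbd[of t] bc(1) ad by (auto simp: of_bool_def split: if_splits)
  have tw: "E a x \<longleftrightarrow> E d x" if "deg E x = t" "x \<noteq> a" "x \<noteq> d" for x
    using agree[of x] that qt by auto
  \<comment> \<open>The count in class \<open>s0\<close> separates a from d, so y differs there from
    at least one of them and is its twin inside the class.\<close>
  have tw2: "\<exists>e\<in>{a,d}. \<forall>x. deg E x = t \<longrightarrow> x \<noteq> y \<longrightarrow> x \<noteq> e \<longrightarrow> (E y x \<longleftrightarrow> E e x)"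
    if "deg E y = t" "class_deg E t y = class_deg E t a" for y
  proof (cases "class_deg E s0 y = class_deg E s0 a")
    case True
    then have "class_deg E s0 y \<noteq> class_deg E s0 d" using ne by simp
    from twins[OF u _ this] show ?thesis using that deg ad by auto
  next
    case False
    from twins[OF u _ this] show ?thesis using that deg by auto
  qed
  have val: "class_deg E t y = class_deg E t a \<or> class_deg E t y = class_deg E t a + 1" if "deg E y = t" for y
    using class_deg_near[OF u, of y a t] class_deg_near[OF u, of z y t] that deg az by linarith
  \<comment> \<open>Composing the trades shows that y differs from a only in the classes of b and of
    a itself, and from d only in the classes of c and of a. Hence y treats c like a and b like
    d.\<close>
  have top: "\<not> E y b \<and> \<not> E y c" if y: "deg E y = t" "class_deg E t y = class_deg E t a + 1" for y
  proof -
    have n: "class_deg E t a \<noteq> class_deg E t y" "class_deg E t d \<noteq> class_deg E t y" using y ad by auto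
    have dg: "deg E a = deg E y" "deg E d = deg E y" using y deg by auto
    obtain b1 c1 where 1: "deg E b1 \<noteq> deg E c1"
      "\<And>s. class_deg E s y = class_deg E s a + of_bool (s = deg E c1) - of_bool (s = deg E b1)"
      "\<And>x. deg E x \<noteq> deg E b1 \<Longrightarrow> deg E x \<noteq> deg E c1 \<Longrightarrow> x \<noteq> a \<Longrightarrow> x \<noteq> y \<Longrightarrow> E a x \<longleftrightarrow> E y x"
      by (rule class_deg_diff[OF u dg(1) n(1)]) blast
    obtain b2 c2 where 2: "deg E b2 \<noteq> deg E c2"
      "\<And>s. class_deg E s y = class_deg E s d + of_bool (s = deg E c2) - of_bool (s = deg E b2)"
      "\<And>x. deg E x \<noteq> deg E b2 \<Longrightarrow> deg E x \<noteq> deg E c2 \<Longrightarrow> x \<noteq> d \<Longrightarrow> x \<noteq> y \<Longrightarrow> E d x \<longleftrightarrow> E y x"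
      by (rule class_deg_diff[OF u dg(2) n(2)]) blast
    have c1: "deg E c1 = t" using 1(2)[of t] y by (auto simp: of_bool_def split: if_splits)
    have c2: "deg E c2 = t" using 2(2)[of t] y ad by (auto simp: of_bool_def split: if_splits)
    have b1: "deg E b1 = deg E b"
      using 1(2)[of "deg E b"] 2(2)[of "deg E b"] nbd[of "deg E b"] bc(1) qt c1 c2
      by (auto simp: of_bool_def split: if_splits)
    have b2: "deg E b2 = deg E c"
      using 1(2)[of "deg E c"] 2(2)[of "deg E c"] nbd[of "deg E c"] bc(1) qt c1 c2
      by (auto simp: of_bool_def split: if_splits)
    have "c \<noteq> y" "b \<noteq> y" using qt y by auto
    then show ?thesis using 1(3)[of c] 2(3)[of b] b1 b2 c1 c2 bc qt by auto
  qed
  show False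
  proof (cases "E a d")
    case False
    have Ebc: "E b c"
      using opposite[OF u, of a b d c] bc False deg qt S by auto
    \<comment> \<open>An inner neighbour x of z missing b or c would put zx and bc on an alternating
      4-cycle with unequal opposite degrees. So x is not of the larger inner degree and is an inner
      twin of a or d, which then inherits the adjacency to z and would see both b and c.\<close>
    have both: "E x b \<and> E x c" if "E z x" "deg E x = t" for x
    proof -
      have z: "\<not> E z b" "\<not> E z c" "z \<noteq> b" "z \<noteq> c" "x \<noteq> b" "x \<noteq> c" using top deg az qt that by auto
      show ?thesis
        using opposite[OF u that(1) Ebc z(1)] opposite[OF u that(1) S(3)[OF Ebc] z(2)] z deg that qt by auto
    qed
    have "class_deg E t z > 0" using az class_deg_nonneg[of E t a] by simp
    then obtain x where x: "E z x" "deg E x = t" using class_deg_pos_iff[OF E] by blast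
    have "class_deg E t x = class_deg E t a" using val[OF x(2)] top[OF x(2)] both[OF x] by blast
    then obtain e where e: "e \<in> {a,d}" "\<forall>v. deg E v = t \<longrightarrow> v \<noteq> x \<longrightarrow> v \<noteq> e \<longrightarrow> (E x v \<longleftrightarrow> E e v)"
      using tw2[OF x(2)] by blast
    have "z \<noteq> x" "z \<noteq> e" "deg E e = t" using x e az ad deg S by auto
    then have "E z e" using e(2) x deg S by blast
    then show False using both[OF _ \<open>deg E e = t\<close>] e(1) bc by blast
  next
    case True
    obtain y where y: "deg E y = t" "class_deg E t y = class_deg E t a + 1" "\<not> E a y"
    proof (cases "E a z")
      case False
      then show thesis using that[OF deg(3) az] by blast
    next
      case True
      obtain y where y: "E z y" "\<not> E a y" "y \<noteq> a" "deg E y = t"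
        using class_deg_less_private[OF E, of z a t] deg az by auto
      have "class_deg E t y = class_deg E t a + 1"
      proof (rule ccontr)
        assume "class_deg E t y \<noteq> class_deg E t a + 1"
        then have "class_deg E t y = class_deg E t a" using val y by blast
        then obtain e where e: "e \<in> {a,d}" "\<forall>v. deg E v = t \<longrightarrow> v \<noteq> y \<longrightarrow> v \<noteq> e \<longrightarrow> (E y v \<longleftrightarrow> E e v)"
          using tw2[OF y(4)] by blast
        have "y \<noteq> d" using y \<open>E a d\<close> by blast
        show False
        proof (cases "e = a")
          case True
          have "E y d" using e(2) True \<open>E a d\<close> \<open>y \<noteq> d\<close> deg S by blast
          then show False using tw[OF y(4,3) \<open>y \<noteq> d\<close>] y S by blast
        next
          case False
          then have "E y a" using e \<open>E a d\<close> y deg S by blast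
          then show False using y S by blast
        qed
      qed
      with y that show thesis by blast
    qed
    have y': "y \<noteq> a" "y \<noteq> d" using y az ad by auto
    have ndy: "\<not> E d y" using tw[OF y(1) y'] y by blast
    \<comment> \<open>Otherwise a switch would join y to a but not to d, although a and d stay twins
      inside the class. So the inner neighbours of y lie properly among those of d (a is missing),
      against the larger inner degree of y.\<close>
    have dw: "E d w" if w: "E y w" "deg E w = t" for w
    proof (rule ccontr)
      assume ndw: "\<not> E d w"
      have wd: "d \<noteq> w" using w ndy S by blast
      let ?F = "switch E a d y w"
      have eq: "class_equiv V E ?F"
        by (rule class_equiv_switch[OF u True w(1) y(3) ndw]) (use y' wd deg y w in auto)
      have "?F a y \<longleftrightarrow> ?F d y"
        by (rule twins[OF class_equivD(1)[OF u eq]]) (use class_equivD(2,3)[OF u eq] deg ne ad y y' in auto)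
      moreover have "w \<noteq> y" using w S by blast
      ultimately show False
        using ndy wd y' True S(4) unfolding switch_def by auto
    qed
    have "card {w. E y w \<and> deg E w = t} < card {w. E d w \<and> deg E w = t}"
    proof (rule psubset_card_mono)
      show "finite {w. E d w \<and> deg E w = t}" by (rule sgraphD(8)[OF E])
      have "a \<in> {w. E d w \<and> deg E w = t}" "a \<notin> {w. E y w \<and> deg E w = t}"
        using True deg y S by auto
      then show "{w. E y w \<and> deg E w = t} \<subset> {w. E d w \<and> deg E w = t}" using dw by blast
    qed
    then show False using y ad unfolding class_deg_def by auto
  qed
qed

text \<open>Two vertices contradicting this need a third whose inner degree is one off, and
  \<open>inner_variation_aux\<close> excludes that vertex. Mixedness supplies it.\<close>

lemma inner_variation:
  assumes u: "unigraph_on V E" and m: "mixed V E t" and a: "a \<in> deg_class V E t" and d: "d \<in> deg_class V E t"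
    and ad: "class_deg E t a = class_deg E t d"
  shows "class_deg E s a = class_deg E s d"
proof (rule ccontr)
  assume ne: "class_deg E s a \<noteq> class_deg E s d"
  note E = unigraph_onD[OF u] note S = sgraphD(2-5)[OF E]
  have deg: "deg E a = t" "deg E d = t" "a \<in> V" "d \<in> V" using a d by (auto simp: deg_class_def)
  \<comment> \<open>If all inner degrees agree, vertices of different profiles are twins inside the
    class. Every vertex differs in profile from a or from d, so all pairs of the class are adjacent
    or none is.\<close>
  have "\<exists>z\<in>deg_class V E t. class_deg E t z \<noteq> class_deg E t a"
  proof (rule ccontr)
    assume "\<not> ?thesis"
    then have all: "class_deg E t x = class_deg E t y" if "x \<in> deg_class V E t" "y \<in> deg_class V E t" for x y using that by metis
    have dg: "deg E x = t" if "x \<in> deg_class V E t" for x using that by (simp add: deg_class_def)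
    have tw: "E x v \<longleftrightarrow> E y v" if "x \<in> deg_class V E t" "y \<in> deg_class V E t" "class_deg E s x \<noteq> class_deg E s y" "v \<in> deg_class V E t" "v \<noteq> x" "v \<noteq> y" for x y v
      by (rule twins[OF u _ that(3)]) (use that dg all[OF that(1,2)] in auto)
    have ad': "a \<noteq> d" using ne by auto
    have sym: "E x y \<longleftrightarrow> E y x" for x y using S by blast
    have one: "E x a \<longleftrightarrow> E a d" "E x d \<longleftrightarrow> E a d" if x: "x \<in> deg_class V E t" "x \<noteq> a" "x \<noteq> d" for x
    proof -
      have 1: "E a x \<longleftrightarrow> E d x" using tw[OF a d ne] x by blast
      have "(E x a \<longleftrightarrow> E a d) \<or> (E x d \<longleftrightarrow> E a d)"
      proof (cases "class_deg E s x = class_deg E s a")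
        case True
        then have "E x a \<longleftrightarrow> E d a" using tw[OF x(1) d _ a] x ne ad' by auto
        then show ?thesis using sym by metis
      next
        case False
        then show ?thesis using tw[OF x(1) a False d] x ad' by auto
      qed
      then show "E x a \<longleftrightarrow> E a d" "E x d \<longleftrightarrow> E a d" using 1 sym[of a x] sym[of d x] by auto
    qed
    have two: "E x y \<longleftrightarrow> E a d"
      if x: "x \<in> deg_class V E t" "x \<noteq> a" "x \<noteq> d" and y: "y \<in> deg_class V E t" "y \<noteq> a" "y \<noteq> d" and xy: "x \<noteq> y" for x y
    proof (cases "class_deg E s x = class_deg E s a")
      case True
      then have "E x y \<longleftrightarrow> E d y" using tw[OF x(1) d _ y(1)] y ne xy by auto
      then show ?thesis using one[OF y] sym[of d y] by simp
    next
      case False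
      then have "E x y \<longleftrightarrow> E a y" using tw[OF x(1) a False y(1)] y xy by auto
      then show ?thesis using one[OF y] sym[of a y] by simp
    qed
    have "E x y \<longleftrightarrow> E a d" if xy: "x \<in> deg_class V E t" "y \<in> deg_class V E t" "x \<noteq> y" for x y
    proof -
      consider "x = a" "y = d" | "x = d" "y = a" | "x \<in> {a,d}" "y \<notin> {a,d}" | "x \<notin> {a,d}" "y \<in> {a,d}" | "x \<notin> {a,d}" "y \<notin> {a,d}"
        using xy(3) by auto
      then show ?thesis
      proof cases
        case 3 then show ?thesis using one[OF xy(2)] sym[of x y] by auto
      next
        case 4 then show ?thesis using one[OF xy(1)] by auto
      next
        case 5 then show ?thesis using two[OF xy(1) _ _ xy(2)] xy(3) by auto
      qed (use sym in auto)
    qed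
    then show False using m S unfolding mixed_def by metis
  qed
  then obtain z where z: "z \<in> deg_class V E t" "class_deg E t z \<noteq> class_deg E t a" by blast
  then have degz: "deg E z = t" "z \<in> V" by (auto simp: deg_class_def)
  \<comment> \<open>The separating class must be named by an actual vertex to be followed into the
    complement.\<close>
  obtain b where b: "E a b" "class_deg E (deg E b) a \<noteq> class_deg E (deg E b) d"
  proof -
    obtain b c where "deg E b \<noteq> deg E c" "E a b"
      "\<And>s. class_deg E s d = class_deg E s a + of_bool (s = deg E c) - of_bool (s = deg E b)"
      by (rule class_deg_diff[OF u _ ne]) (use deg in auto)
    then show thesis by (intro that) auto
  qed
  have bV: "b \<in> V" using b S by blast
  show False
  proof (cases "class_deg E t z = class_deg E t a + 1")
    case True
    show False by (rule inner_variation_aux[OF u deg(1,2) degz(1) ne ad True])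
  next
    case False
    then have z': "class_deg E t z = class_deg E t a - 1"
      using class_deg_near[OF u, of z a t] class_deg_near[OF u, of a z t] deg degz z by auto
    \<comment> \<open>Complementation turns the deficit of z in inner degree into an excess.\<close>
    let ?F = "compl_on V E"
    have compl_on: "class_deg ?F (deg ?F a) v = int (card (deg_class V E t)) - class_deg E t v - 1" if "v \<in> V" "deg E v = t" for v
      using class_deg_co[OF E deg(3) that(1)] that deg by simp
    show False
    proof (rule inner_variation_aux[OF unigraph_on_co[OF u], of a "deg ?F a" d z "deg ?F b"])
      show "deg ?F a = deg ?F a" "deg ?F d = deg ?F a" "deg ?F z = deg ?F a"
        using deg_co_eq[OF E] deg degz by auto
      show "class_deg ?F (deg ?F b) a \<noteq> class_deg ?F (deg ?F b) d"
        using class_deg_co[OF E bV deg(3)] class_deg_co[OF E bV deg(4)] b deg by auto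
      show "class_deg ?F (deg ?F a) a = class_deg ?F (deg ?F a) d" using compl_on deg ad by auto
      show "class_deg ?F (deg ?F a) z = class_deg ?F (deg ?F a) a + 1" using compl_on deg degz z' by auto
    qed
  qed
qed

text \<open>If y separates a from b, equality of profiles yields y' of the degree of y that
  separates them the other way.\<close>

lemma regular_class_uniform:
  assumes u: "unigraph_on V E" and m: "mixed V E t"
    and reg: "\<And>a d s. a \<in> deg_class V E t \<Longrightarrow> d \<in> deg_class V E t \<Longrightarrow> class_deg E s a = class_deg E s d"
    and y: "deg E y \<noteq> t" and a: "a \<in> deg_class V E t" "E y a" and b: "b \<in> deg_class V E t"
  shows "E y b"
proof (rule ccontr)
  assume class_deg: "\<not> E y b"
  note E = unigraph_onD[OF u] note S = sgraphD(2-5)[OF E]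
  have deg: "deg E a = t" "deg E b = t" using a b by (auto simp: deg_class_def)
  obtain y' where y': "E b y'" "\<not> E a y'" "y' \<noteq> a" "deg E y' = deg E y"
    by (rule exchange[OF E, of b a "deg E y" y]) (use deg a(2) class_deg reg[OF a(1) b] y S(3)[OF a(2)] S(3)[of b y] in auto)
  have ne: "a \<noteq> b" "y \<noteq> y'" using a y' class_deg S by blast+
  \<comment> \<open>The class is mixed and inner regular, so the pair a, b can be given the same
    adjacency as y, y'. In both cases an alternating 4-cycle arises whose opposite pairs each join
    the class to a vertex outside it.\<close>
  define q where "q = E y y'"
  obtain x1 x2 where x: "x1 \<in> deg_class V E t" "x2 \<in> deg_class V E t" "x1 \<noteq> x2" "E x1 x2 \<longleftrightarrow> q"
    using m S(4) unfolding mixed_def by metis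
  obtain F where F: "class_equiv V E F" "F a b \<longleftrightarrow> E x1 x2"
    "\<And>u v. deg E u \<noteq> t \<or> deg E v \<noteq> t \<Longrightarrow> F u v \<longleftrightarrow> E u v"
    by (rule flex[OF E a(1) b x(1,2) ne(1) x(3)]) (use reg[OF a(1) x(1)] reg[OF b x(2)] in auto)
  note uF = class_equivD(1)[OF u F(1)] and dF = class_equivD(2)[OF u F(1)]
  have SF: "F u v \<Longrightarrow> F v u" for u v using unigraph_onD[OF uF] sgraphD(4) by metis
  have F': "F a y" "F b y'" "\<not> F a y'" "\<not> F b y" "F y y' \<longleftrightarrow> q"
    using F(3) y y' a class_deg S by (auto simp: q_def)
  show False
  proof (cases q)
    case True
    then have "F a b" "F y' y" "b \<noteq> y" using F(2) x(4) F'(5) SF y deg by auto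
    then have "deg F a = deg F y \<or> deg F b = deg F y'"
      using opposite[OF uF, of a b y' y] F'(3,4) y'(3) by blast
    then show False using dF deg y y' by auto
  next
    case False
    then have "\<not> F a b" "\<not> F y y'" using F(2) x(4) F'(5) by auto
    then have "deg F a = deg F y' \<or> deg F y = deg F b"
      using opposite[OF uF, of a y b y'] F'(1,2) ne by blast
    then show False using dF deg y y' by auto
  qed
qed

text \<open>
  The remaining possibility for a mixed class: its vertices have one of two neighbourhood
  profiles, which differ by trading one neighbour in the class for one in another class, of
  degree s.
\<close>

locale varied =
  fixes V :: "'a set" and E :: "'a \<Rightarrow> 'a \<Rightarrow> bool" and t s :: nat and D w :: int
  assumes u: "unigraph_on V E" and ts: "t \<noteq> s"
    and types: "\<And>v. v \<in> deg_class V E t \<Longrightarrow> class_deg E t v = D + 1 \<and> class_deg E s v = w \<or> class_deg E t v = D \<and> class_deg E s v = w + 1"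
    and ex_high: "\<exists>v\<in>deg_class V E t. class_deg E t v = D + 1" and ex_low: "\<exists>v\<in>deg_class V E t. class_deg E t v = D"
begin

text \<open>\<open>Mt\<close> and \<open>Ms\<close> collect the vertices whose extra neighbour lies
  in the class of degree \<open>t\<close> and \<open>s\<close>, respectively.\<close>

definition "Mt = {v \<in> deg_class V E t. class_deg E t v = D + 1}"
definition "Ms = {v \<in> deg_class V E t. class_deg E t v = D}"

lemma E: "sgraph V E" using u by (rule unigraph_onD)

lemmas S = sgraphD(2-5)[OF E]

lemma sym: "E x y \<longleftrightarrow> E y x" using S(3) by blast

lemma MtD: "a \<in> Mt \<Longrightarrow> deg E a = t" "a \<in> Mt \<Longrightarrow> a \<in> V" "a \<in> Mt \<Longrightarrow> class_deg E t a = D + 1" "a \<in> Mt \<Longrightarrow> class_deg E s a = w"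
  "a \<in> Mt \<Longrightarrow> a \<in> deg_class V E t"
  using types[of a] unfolding Mt_def deg_class_def by auto

lemma MsD: "a \<in> Ms \<Longrightarrow> deg E a = t" "a \<in> Ms \<Longrightarrow> a \<in> V" "a \<in> Ms \<Longrightarrow> class_deg E t a = D" "a \<in> Ms \<Longrightarrow> class_deg E s a = w + 1"
  "a \<in> Ms \<Longrightarrow> a \<in> deg_class V E t"
  using types[of a] unfolding Ms_def deg_class_def by auto

lemma MtMs: "a \<in> deg_class V E t \<longleftrightarrow> a \<in> Mt \<or> a \<in> Ms"
  using types[of a] unfolding Mt_def Ms_def by auto

lemma disj: "a \<in> Mt \<Longrightarrow> a \<notin> Ms" unfolding Mt_def Ms_def by auto

lemma D_nonneg: "D \<ge> 0" and w_nonneg: "w \<ge> 0"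
  using ex_low ex_high class_deg_nonneg types by force+

lemma varied_eqv:
  assumes "class_equiv V E F"
  shows "varied V F t s D w" "varied.Mt V F t D = Mt" "varied.Ms V F t D = Ms"
proof -
  note F = class_equivD[OF u assms]
  have c: "deg_class V F x = deg_class V E x" for x using F(2) by (simp add: deg_class_def)
  interpret F: varied V F t s D w
    by unfold_locales (use F ts types ex_high ex_low in \<open>auto simp: c\<close>)
  show "varied V F t s D w" by (rule F.varied_axioms)
  show "F.Mt = Mt" "F.Ms = Ms" unfolding F.Mt_def F.Ms_def Mt_def Ms_def c F(3) by auto
qed

text \<open>Complementation exchanges the two profiles. The 2 in the new inner degree is the vertex
  itself plus the excess of \<open>Mt\<close> over \<open>Ms\<close>; the 1 in the new outer count
  is that excess alone.\<close>

lemma varied_co: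
  assumes y: "y \<in> deg_class V E s"
  obtains t' s' where "varied V (compl_on V E) t' s' (int (card (deg_class V E t)) - D - 2) (int (card (deg_class V E s)) - w - 1)"
    "varied.Mt V (compl_on V E) t' (int (card (deg_class V E t)) - D - 2) = Ms"
    "varied.Ms V (compl_on V E) t' (int (card (deg_class V E t)) - D - 2) = Mt"
    "deg_class V (compl_on V E) s' = deg_class V E s" "deg_class V (compl_on V E) t' = deg_class V E t"
proof -
  let ?F = "compl_on V E" and ?D = "int (card (deg_class V E t)) - D - 2" and ?w = "int (card (deg_class V E s)) - w - 1"
  obtain a where a: "a \<in> deg_class V E t" using ex_low by blast
  have yV: "y \<in> V" "deg E y = s" and aV: "a \<in> V" "deg E a = t" using y a by (auto simp: deg_class_def)
  define t' where "t' = deg ?F a"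
  define s' where "s' = deg ?F y"
  have ct: "deg_class V ?F t' = deg_class V E t" and cs: "deg_class V ?F s' = deg_class V E s"
    using cl_co[OF E aV(1)] cl_co[OF E yV(1)] aV yV by (simp_all add: t'_def s'_def)
  have nt: "class_deg ?F t' v = int (card (deg_class V E t)) - class_deg E t v - 1" if "v \<in> deg_class V E t" for v
    using class_deg_co[OF E aV(1), of v] that aV by (auto simp: t'_def deg_class_def)
  have ns: "class_deg ?F s' v = int (card (deg_class V E s)) - class_deg E s v" if "v \<in> deg_class V E t" for v
    using class_deg_co[OF E yV(1), of v] that yV ts by (auto simp: s'_def deg_class_def)
  interpret F: varied V ?F t' s' ?D ?w
  proof
    show "unigraph_on V ?F" using u by (rule unigraph_on_co)
    show "t' \<noteq> s'" using deg_co_eq[OF E aV(1) yV(1)] ts aV yV by (simp add: t'_def s'_def)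
    show "class_deg ?F t' v = ?D + 1 \<and> class_deg ?F s' v = ?w \<or> class_deg ?F t' v = ?D \<and> class_deg ?F s' v = ?w + 1"
      if "v \<in> deg_class V ?F t'" for v
      using that types[of v] nt[of v] ns[of v] unfolding ct by auto
    show "\<exists>v\<in>deg_class V ?F t'. class_deg ?F t' v = ?D + 1" "\<exists>v\<in>deg_class V ?F t'. class_deg ?F t' v = ?D"
      using ex_low ex_high nt unfolding ct by force+
  qed
  have "F.Mt = Ms" "F.Ms = Mt" unfolding F.Mt_def F.Ms_def Mt_def Ms_def ct using nt by auto
  then show thesis using that[OF F.varied_axioms _ _ cs ct] by blast
qed

text \<open>If ad and yy' were both edges or both non-edges, the four vertices would carry an
  alternating cycle whose opposite pairs have degrees t and s.\<close>

lemma crossed_adj: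
  assumes "a \<in> Mt" "d \<in> Ms" "deg E y = s" "deg E y' = s" "E a y" "\<not> E d y" "E d y'" "\<not> E a y'"
  shows "E a d \<longleftrightarrow> \<not> E y y'"
proof -
  have ne: "a \<noteq> d" "y \<noteq> y'" "a \<noteq> y'" "d \<noteq> y" and dg: "deg E a = t" "deg E d = t"
    using assms disj MtD MsD ts by auto
  show ?thesis
    using opposite[OF u, of a d y' y] opposite[OF u, of a y d y'] assms ne dg ts sym[of y y'] by auto
qed

text \<open>d has one more neighbour of degree s than a, so a private one at a forces two at
  d.\<close>

lemma crossed_two:
  assumes "a \<in> Mt" "d \<in> Ms" "deg E y = s" "E a y" "\<not> E d y"
  obtains y1 y2 where "y1 \<noteq> y2" "deg E y1 = s" "deg E y2 = s" "E d y1" "\<not> E a y1" "E d y2" "\<not> E a y2"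
proof -
  let ?P = "{w. E d w \<and> \<not> E a w \<and> w \<noteq> a \<and> deg E w = s}" and ?Q = "{w. E a w \<and> \<not> E d w \<and> w \<noteq> d \<and> deg E w = s}"
  have dg: "deg E a = t" "deg E d = t" "class_deg E s d = class_deg E s a + 1" using assms MtD MsD by auto
  have "y \<in> ?Q" using assms dg ts by auto
  then have "card ?Q > 0"
    using sgraphD(8)[OF E, of a "\<lambda>w. \<not> E d w \<and> w \<noteq> d \<and> deg E w = s"] by (auto simp: card_gt_0_iff)
  moreover have "int (card ?P) = int (card ?Q) + 1"
    using card_private[OF E, of "\<lambda>w. deg E w = s" d a] dg unfolding class_deg_def by auto
  ultimately have "card ?P \<ge> 2" by linarith
  then obtain y1 y2 where "y1 \<in> ?P" "y2 \<in> ?P" "y1 \<noteq> y2"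
    by (metis (no_types, lifting) One_nat_def Suc_1 card_le_Suc0_iff_eq card.infinite not_less_eq_eq zero_le)
  then show thesis using that by blast
qed

text \<open>Rearranging the class can give ad the adjacency of any other pair of these two types,
  while yy' and all edges leaving the class stay fixed. By \<open>crossed_adj\<close> the adjacency
  of ad is already determined by yy'.\<close>

lemma crossed_uniform:
  assumes a: "a \<in> Mt" "d \<in> Ms" and y: "deg E y = s" "E a y" "\<not> E d y" and a': "a' \<in> Mt" "d' \<in> Ms"
  shows "E a' d' \<longleftrightarrow> E a d"
proof -
  obtain y' where y': "deg E y' = s" "E d y'" "\<not> E a y'" using crossed_two[OF a y] by metis
  have ne: "a \<noteq> d" "a' \<noteq> d'" using a a' disj by auto
  obtain F where F: "class_equiv V E F" "F a d \<longleftrightarrow> E a' d'"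
    "\<And>u v. deg E u \<noteq> t \<or> deg E v \<noteq> t \<Longrightarrow> F u v \<longleftrightarrow> E u v"
    by (rule flex[OF E _ _ _ _ ne]) (use a a' MtD MsD in auto)
  interpret F: varied V F t s D w by (rule varied_eqv[OF F(1)])
  have "F a d \<longleftrightarrow> \<not> F y y'"
    by (rule F.crossed_adj) (use a y y' F(3) ts MtD MsD varied_eqv[OF F(1)] class_equivD(2)[OF u F(1)] in auto)
  moreover have "E a d \<longleftrightarrow> \<not> E y y'" using crossed_adj[OF a y(1) y'(1) y(2,3) y'(2,3)] .
  moreover have "F y y' \<longleftrightarrow> E y y'" using F(3) y ts by auto
  ultimately show ?thesis using F(2) by blast
qed

lemma crossed_nonadj:
  assumes a: "a \<in> Mt" "d \<in> Ms" and y: "deg E y = s" "E a y" "\<not> E d y" and nad: "\<not> E a d"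
  shows False
proof -
  obtain y1 y2 where y12: "y1 \<noteq> y2" "deg E y1 = s" "deg E y2 = s" "E d y1" "\<not> E a y1" "E d y2" "\<not> E a y2"
    using crossed_two[OF a y] .
  have dg: "deg E a = t" "deg E d = t" using a MtD MsD by auto
  have ne: "a \<noteq> d" "y \<noteq> y1" "y \<noteq> y2" "a \<noteq> y" "a \<noteq> y1" "a \<noteq> y2" "d \<noteq> y" "d \<noteq> y1" "d \<noteq> y2"
    using dg y y12 ts a disj by auto
  \<comment> \<open>After this switch y1 is private to a while y2 is still private to d. Since ad
    remains a non-edge, y1 and y2 must be adjacent.\<close>
  let ?F = "switch E a y y1 d"
  have eF: "class_equiv V E ?F"
    by (rule class_equiv_switch[OF u y(2) S(3)[OF y12(4)] y12(5)]) (use y y12 dg ne S(3)[of y d] in auto)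
  interpret F: varied V ?F t s D w by (rule varied_eqv[OF eF])
  have "?F a d \<longleftrightarrow> \<not> ?F y1 y2"
    by (rule F.crossed_adj)
      (use a y y12 ne varied_eqv[OF eF] class_equivD(2)[OF u eF] in \<open>auto simp: switch_def\<close>)
  moreover have "\<not> ?F a d" "?F y1 y2 \<longleftrightarrow> E y1 y2" using nad ne y12 by (auto simp: switch_def)
  ultimately have E12: "E y1 y2" by blast
  have "class_deg E t a > 0" using MtD(3)[OF a(1)] D_nonneg by simp
  then obtain z where z: "E a z" "deg E z = t" using class_deg_pos_iff[OF E] by blast
  have "z \<in> deg_class V E t" using z S(2) by (auto simp: deg_class_def)
  then have zMt: "z \<in> Mt" using MtMs crossed_uniform[OF a y a(1)] nad z by blast
  have nez: "z \<noteq> y1" "z \<noteq> y2" "z \<noteq> a" using z y12 ts S by auto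
  have zy1: "E z y1"
    using opposite[OF u z(1) S(3)[OF E12] y12(7)] ne nez dg z y12 ts by auto
  have zy2: "E z y2"
    using opposite[OF u z(1) E12 y12(5)] ne nez dg z y12 ts by auto
  obtain x where x: "E a x" "\<not> E z x" "x \<noteq> z" "deg E x = s"
    by (rule exchange[OF E, of a z s y1]) (use MtD a zMt zy1 y12 ne in auto)
  have nx: "x \<noteq> y1" "x \<noteq> y2" "x \<noteq> a" using x y12 ts dg by auto
  have nxz: "\<not> E x z" using x(2) S(3) by blast
  \<comment> \<open>The inner neighbour z of a sees both y1 and y2. Detaching z from y1 makes az and
    y2y1 the edges of an alternating 4-cycle whose opposite pairs have degrees t and s.\<close>
  let ?G = "switch E a x y1 z"
  have eG: "class_equiv V E ?G"
    by (rule class_equiv_switch[OF u x(1) S(3)[OF zy1] y12(5) nxz]) (use x y12 dg ne z in auto)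
  have dG: "deg ?G v = deg E v" for v by (rule class_equivD(2)[OF u eG])
  have "?G a z" "?G y2 y1" "\<not> ?G a y2" "\<not> ?G z y1"
    using z S(3)[OF E12] y12 nx nez ne x by (auto simp: switch_def)
  then show False
    using opposite[OF class_equivD(1)[OF u eG], of a z y2 y1] dG ne nez dg z y12 ts by auto
qed

text \<open>The case of adjacent a and d passes to the complement, where \<open>Mt\<close> and
  \<open>Ms\<close> change places and ad becomes a non-edge.\<close>

lemma not_crossed:
  assumes a: "a \<in> Mt" "d \<in> Ms" and y: "deg E y = s" "E a y"
  shows "E d y"
proof (rule ccontr)
  assume nd: "\<not> E d y"
  show False
  proof (cases "E a d")
    case False
    then show False using crossed_nonadj[OF a y nd] by blast
  next
    case True
    have ycl: "y \<in> deg_class V E s" using y S by (auto simp: deg_class_def)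
    obtain t' s' where F: "varied V (compl_on V E) t' s' (int (card (deg_class V E t)) - D - 2) (int (card (deg_class V E s)) - w - 1)"
      "varied.Mt V (compl_on V E) t' (int (card (deg_class V E t)) - D - 2) = Ms"
      "varied.Ms V (compl_on V E) t' (int (card (deg_class V E t)) - D - 2) = Mt"
      "deg_class V (compl_on V E) s' = deg_class V E s" using varied_co[OF ycl] by metis
    have "deg (compl_on V E) y = s'" using ycl F(4) by (auto simp: deg_class_def)
    moreover have "d \<noteq> y" using y MsD a ts by auto
    then have "compl_on V E d y" "\<not> compl_on V E a y" "\<not> compl_on V E d a"
      using nd y(2) S(3)[OF True] MsD(2)[OF a(2)] S(2)[OF y(2)] by (auto simp: compl_on_def)
    ultimately show False
      using varied.crossed_nonadj[OF F(1), of d a y] F(2,3) a by auto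
  qed
qed

end

section \<open>The second class is a single vertex\<close>

context varied begin

lemma fin_cl: "finite (deg_class V E x)" using sgraphD(1)[OF E] by (simp add: deg_class_def)

text \<open>A vertex adjacent to the rest of its class has the largest possible inner degree, but
  \<open>Mt\<close> exceeds \<open>Ms\<close>.\<close>

lemma low_nonadj:
  assumes "d \<in> Ms"
  obtains b where "b \<in> deg_class V E t" "b \<noteq> d" "\<not> E d b"
proof (rule ccontr)
  assume no: "\<not> thesis"
  obtain a where a: "a \<in> Mt" using ex_high by (auto simp: Mt_def)
  have "{w \<in> deg_class V E t. E d w} = deg_class V E t - {d}" using no that S(4) by blast
  then have "class_deg E t d = int (card (deg_class V E t)) - 1"
    using class_deg_cl[OF E, of t d] MsD(5)[OF assms] fin_cl[of t] by (simp add: of_nat_diff card_gt_0_iff Suc_leI)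
       (metis One_nat_def Suc_leI card_gt_0_iff empty_iff of_nat_1 of_nat_diff)
  moreover have "class_deg E t a \<le> int (card (deg_class V E t)) - 1"
  proof -
    have "card {w \<in> deg_class V E t. E a w} < card (deg_class V E t)"
      using fin_cl MtD(5)[OF a] S(4) by (intro psubset_card_mono) auto
    then show ?thesis using class_deg_cl[OF E, of t a] by simp
  qed
  ultimately show False using MtD(3)[OF a] MsD(3)[OF assms] by simp
qed

lemma high_adj:
  assumes "a \<in> Mt"
  obtains x where "x \<in> deg_class V E t" "E a x"
proof -
  have "class_deg E t a > 0" using MtD(3)[OF assms] D_nonneg by simp
  then show thesis using class_deg_pos_iff[OF E] that S(2) by (auto simp: deg_class_def)
qed

text \<open>For positive \<open>w\<close> some y of degree s sees a vertex of \<open>Mt\<close> and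
  therefore all of \<open>Ms\<close>, at least |Ms| + 1 vertices of the class. If z missed some d in
  \<open>Ms\<close>, it would see no vertex of \<open>Mt\<close> and at most |Ms| - 1 of the class.
  Counts of two vertices of degree s differ by at most one.\<close>

lemma low_complete:
  assumes "w \<noteq> 0" "d \<in> Ms" "z \<in> deg_class V E s"
  shows "E d z"
proof (rule ccontr)
  assume ndz: "\<not> E d z"
  obtain a where a: "a \<in> Mt" using ex_high by (auto simp: Mt_def)
  have dz: "deg E z = s" using assms(3) by (simp add: deg_class_def)
  have "class_deg E s a > 0" using MtD(4)[OF a] assms(1) w_nonneg by simp
  then obtain y where y: "E a y" "deg E y = s" using class_deg_pos_iff[OF E] by blast
  have fMs: "finite Ms" using fin_cl[of t] by (simp add: Ms_def)
  have "insert a Ms \<subseteq> {v \<in> deg_class V E t. E y v}"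
    using not_crossed[OF a _ y(2,1)] MtD(5)[OF a] MsD(5) S(3) y(1) by blast
  then have "card (insert a Ms) \<le> card {v \<in> deg_class V E t. E y v}"
    using fin_cl by (intro card_mono) auto
  then have "int (card Ms) + 1 \<le> class_deg E t y"
    using class_deg_cl[OF E, of t y] fMs disj[OF a] by simp
  moreover have "{v \<in> deg_class V E t. E z v} \<subseteq> Ms - {d}"
    using not_crossed[OF _ assms(2) dz] MtMs ndz S(3) by blast
  then have "card {v \<in> deg_class V E t. E z v} \<le> card (Ms - {d})"
    using fMs by (intro card_mono) auto
  then have "class_deg E t z + 1 \<le> int (card Ms)"
    using class_deg_cl[OF E, of t z] card_Suc_Diff1[OF fMs assms(2)] by linarith
  ultimately show False using class_deg_near[OF u, of y z t] y dz by simp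
qed

lemma other_uniform:
  assumes "a \<in> deg_class V E t" "d \<in> deg_class V E t" "deg E x \<noteq> t" "deg E x \<noteq> s"
  shows "E a x \<longleftrightarrow> E d x"
proof -
  have *: "E a x \<longleftrightarrow> E d x" if "a \<in> Mt" "d \<in> Ms" for a d
  proof -
    have ad: "deg E a = deg E d" "class_deg E t a \<noteq> class_deg E t d" using that MtD MsD by auto
    obtain b c where bc: "deg E b \<noteq> deg E c"
      "\<And>s. class_deg E s d = class_deg E s a + of_bool (s = deg E c) - of_bool (s = deg E b)"
      "\<And>x. deg E x \<noteq> deg E b \<Longrightarrow> deg E x \<noteq> deg E c \<Longrightarrow> x \<noteq> a \<Longrightarrow> x \<noteq> d \<Longrightarrow> E a x \<longleftrightarrow> E d x"
      by (rule class_deg_diff[OF u ad]) blast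
    have "deg E b = t" "deg E c = s"
      using bc(2)[of t] bc(2)[of s] MtD[OF that(1)] MsD[OF that(2)] by (auto simp: of_bool_def split: if_splits)
    then show ?thesis using bc(3)[of x] assms(3,4) MtD(1)[OF that(1)] MsD(1)[OF that(2)] by auto
  qed
  obtain a0 d0 where "a0 \<in> Mt" "d0 \<in> Ms" using ex_high ex_low by (auto simp: Mt_def Ms_def)
  then show ?thesis using * assms(1,2) MtMs by metis
qed

end

text \<open>Here \<open>Mt\<close> has no neighbours of degree s and each vertex of
  \<open>Ms\<close> has exactly one. Positive \<open>w\<close> is reduced to this case by
  complementation.\<close>

locale varied0 = varied V E t s D 0 for V :: "'a set" and E t s D
begin

lemma anti: "a \<in> Mt \<Longrightarrow> deg E y = s \<Longrightarrow> \<not> E a y"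
  using MtD(4)[of a] class_deg_pos_iff[OF E, of s a] by auto

lemma le1:
  assumes "x \<in> deg_class V E t" "E x y" "E x y'" "deg E y = s" "deg E y' = s"
  shows "y = y'"
proof -
  have "x \<in> Ms" using assms anti MtMs by blast
  then have "card {w. E x w \<and> deg E w = s} = 1" using MsD(4)[of x] by (simp add: class_deg_def)
  then obtain v where v: "{w. E x w \<and> deg E w = s} = {v}" by (rule card_1_singletonE)
  have "y \<in> {w. E x w \<and> deg E w = s}" "y' \<in> {w. E x w \<and> deg E w = s}" using assms by auto
  then show ?thesis unfolding v by simp
qed

text \<open>An edge ce would alternate with an inner edge ax, a in \<open>Mt\<close>: a sees neither
  end, and x misses at least one.\<close>

lemma stable_s:
  assumes "deg E c = s" "deg E e = s"
  shows "\<not> E c e"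
proof
  assume ce: "E c e"
  obtain a where a: "a \<in> Mt" using ex_high by (auto simp: Mt_def)
  obtain x where x: "x \<in> deg_class V E t" "E a x" using high_adj[OF a] .
  have n: "\<not> E a c" "\<not> E a e" using anti a assms by auto
  have dg: "deg E a = t" "deg E x = t" using a x MtD by (auto simp: deg_class_def)
  then have ne: "a \<noteq> c" "a \<noteq> e" "x \<noteq> c" "x \<noteq> e" using assms ts by auto
  have "c \<noteq> e" using ce S(4) by blast
  then have "\<not> E x c \<or> \<not> E x e" using le1[OF x(1) _ _ assms] by blast
  then show False
    using opposite[OF u x(2) ce n(1)] opposite[OF u x(2) S(3)[OF ce] n(2)] ne dg assms ts by auto
qed

lemma at_most_one_attached:
  assumes ce: "c \<noteq> e" "deg E c = s" "deg E e = s" and a: "a \<in> deg_class V E t" "E a c" and b: "b \<in> deg_class V E t" "E b e"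
  shows False
proof -
  have Ms: "a \<in> Ms" "b \<in> Ms" using a b anti[OF _ ce(2)] anti[OF _ ce(3)] MtMs by blast+
  have ab: "a \<noteq> b" using le1[OF a _ ce(2,3)] b(2) ce(1) by blast
  have nce: "\<not> E c e" by (rule stable_s[OF ce(2,3)])
  \<comment> \<open>A non-edge inside \<open>Ms\<close> could be moved onto the pair a, b. Then ac
    and be would be the edges of an alternating 4-cycle with opposite degrees t and s. This holds in
    every rearrangement \<open>F\<close> inside the class, which \<open>star\<close>
    exploits.\<close>
  have clq: "F x y" if F: "class_equiv V E F" "\<And>u v. deg E u \<noteq> t \<or> deg E v \<noteq> t \<Longrightarrow> F u v \<longleftrightarrow> E u v"
    and xy: "x \<in> Ms" "y \<in> Ms" "x \<noteq> y" for F x y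
  proof (rule ccontr)
    assume nF: "\<not> F x y"
    note uF = class_equivD(1)[OF u F(1)] and dF = class_equivD(2)[OF u F(1)] and nF' = class_equivD(3)[OF u F(1)]
    have c: "deg_class V F t = deg_class V E t" using dF by (simp add: deg_class_def)
    have m: "a \<in> deg_class V F t" "b \<in> deg_class V F t" "x \<in> deg_class V F t" "y \<in> deg_class V F t"
      unfolding c using MsD(5) Ms xy by auto
    obtain G where G: "class_equiv V F G" "G a b \<longleftrightarrow> F x y"
      "\<And>u v. deg F u \<noteq> t \<or> deg F v \<noteq> t \<Longrightarrow> G u v \<longleftrightarrow> F u v"
      by (rule flex[OF unigraph_onD[OF uF] m ab xy(3)]) (simp_all add: nF' MsD(3) Ms xy)
    note uG = class_equivD(1)[OF uF G(1)] and dG = class_equivD(2)[OF uF G(1)]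
    have "G a c" "G b e" "\<not> G c e" "\<not> G a b"
      using G(2,3) F(2) dF ce ts a(2) b(2) nce nF by auto
    then show False
      using opposite[OF uG, of a c b e] ab ce dG dF MsD(1)[OF Ms(1)] MsD(1)[OF Ms(2)] ts by auto
  qed
  have E': "class_equiv V E E" using realizes_refl[OF E] by (simp add: class_equiv_def)
  have Mscl: "E x y" if "x \<in> Ms" "y \<in> Ms" "x \<noteq> y" for x y using clq[OF E' _ that] by blast
  \<comment> \<open>Otherwise a switch with zx would remove the edge a'b' from the clique
    \<open>Ms\<close>.\<close>
  have star: "E a' z \<or> E b' x" if ab': "a' \<in> Ms" "b' \<in> Ms" "a' \<noteq> b'"
    and zx: "E z x" "z \<in> deg_class V E t" "x \<in> deg_class V E t" "z \<noteq> a'" "x \<noteq> b'" for a' b' z x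
  proof (rule ccontr)
    assume n: "\<not> (E a' z \<or> E b' x)"
    have Eab: "E a' b'" "E b' a'" using Mscl ab' by auto
    have dg: "deg E a' = t" "deg E b' = t" "deg E z = t" "deg E x = t"
      using ab' zx MsD by (auto simp: deg_class_def)
    let ?F = "switch E a' b' z x"
    have eF: "class_equiv V E ?F" by (rule class_equiv_switch[OF u Eab(1) zx(1)]) (use n zx dg in auto)
    have "?F a' b'" by (rule clq[OF eF _ ab']) (use dg in \<open>auto simp: switch_def\<close>)
    moreover have "z \<noteq> b'" "x \<noteq> a'" using n Eab by auto
    ultimately show False using zx ab' by (auto simp: switch_def)
  qed
  have anb: "\<exists>z. z \<in> deg_class V E t \<and> z \<noteq> x \<and> \<not> E x z \<and> z \<in> Mt" if xM: "x \<in> Ms" for x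
  proof -
    obtain z where "z \<in> deg_class V E t" "z \<noteq> x" "\<not> E x z" using low_nonadj[OF xM] .
    then show ?thesis using Mscl[OF xM, of z] MtMs by blast
  qed
  obtain z where z: "z \<in> deg_class V E t" "z \<noteq> a" "\<not> E a z" "z \<in> Mt" using anb Ms by blast
  have dg: "deg E a = t" "deg E b = t" "deg E z = t" using Ms z MsD MtD by auto
  have zb: "z \<noteq> b" using z Ms disj by blast
  obtain x where x: "E z x" "\<not> E a x" "x \<noteq> a" "deg E x = t"
    by (rule class_deg_less_private[OF E, of z a t]) (use z Ms MtD MsD in auto)
  have xcl: "x \<in> deg_class V E t" using x S(2) by (auto simp: deg_class_def)
  have Ebz: "E b z"
    using star[OF Ms(1,2) ab S(3)[OF x(1)] xcl z(1) x(3) zb] x by blast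
  \<comment> \<open>So z has at most 1 + (inner degree of b) - 2 inner neighbours, although z in
    \<open>Mt\<close> should have one more than b.\<close>
  have sub: "{v \<in> deg_class V E t. E z v} \<subseteq> insert b ({v \<in> deg_class V E t. E b v} - {a,z})"
  proof
    fix v assume v: "v \<in> {v \<in> deg_class V E t. E z v}"
    then have "v \<noteq> z" "v \<noteq> a" using z S(3,4) by auto
    moreover have "E b v" if "v \<noteq> b"
      using star[OF Ms(1,2) ab, of z v] v z that by blast
    ultimately show "v \<in> insert b ({v \<in> deg_class V E t. E b v} - {a,z})" using v by blast
  qed
  have "card {v \<in> deg_class V E t. E z v} \<le> Suc (card ({v \<in> deg_class V E t. E b v} - {a,z}))"
  proof -
    have fin: "finite ({v \<in> deg_class V E t. E b v} - {a,z})" using fin_cl[of t] by simp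
    then have "card {v \<in> deg_class V E t. E z v} \<le> card (insert b ({v \<in> deg_class V E t. E b v} - {a,z}))"
      by (intro card_mono[OF _ sub]) simp
    also have "\<dots> \<le> Suc (card ({v \<in> deg_class V E t. E b v} - {a,z}))"
      using card_insert_if[OF fin, of b] by simp
    finally show ?thesis .
  qed
  moreover have "card ({v \<in> deg_class V E t. E b v} - {a,z}) + 2 = card {v \<in> deg_class V E t. E b v}"
  proof -
    have *: "{a,z} \<subseteq> {v \<in> deg_class V E t. E b v}" using a z Ebz Mscl[OF Ms(2,1)] ab by auto
    have "card {a,z} = 2" using z by simp
    then show ?thesis using card_Diff_subset[OF _ *] card_mono[OF _ *] fin_cl[of t] by auto
  qed
  ultimately have "class_deg E t z + 1 \<le> class_deg E t b" using class_deg_cl[OF E] by simp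
  then show False using MtD(3)[OF z(4)] MsD(3)[OF Ms(2)] by simp
qed

lemma single_class:
  assumes "y1 \<in> deg_class V E s" "y2 \<in> deg_class V E s"
  shows "y1 = y2"
proof (rule ccontr)
  assume "y1 \<noteq> y2"
  obtain d0 where d0: "d0 \<in> Ms" using ex_low by (auto simp: Ms_def)
  have "class_deg E s d0 > 0" using MsD(4)[OF d0] by simp
  then obtain y where y: "E d0 y" "deg E y = s" using class_deg_pos_iff[OF E] by blast
  obtain z where z: "z \<in> deg_class V E s" "z \<noteq> y" using assms \<open>y1 \<noteq> y2\<close> by metis
  then have dz: "deg E z = s" by (simp add: deg_class_def)
  have nz: "\<not> E v z" if "v \<in> deg_class V E t" for v
    using at_most_one_attached[OF z(2)[symmetric] y(2) dz MsD(5)[OF d0] y(1) that] by blast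
  have d0t: "deg E d0 = t" using MsD d0 by auto
  have "class_deg E t z = 0"
  proof (rule ccontr)
    assume "class_deg E t z \<noteq> 0"
    then have "class_deg E t z > 0" using class_deg_nonneg[of E t z] by simp
    then obtain v where "E z v" "deg E v = t" using class_deg_pos_iff[OF E] by blast
    then show False using nz[of v] S by (auto simp: deg_class_def)
  qed
  moreover have "class_deg E t y > 0" using class_deg_pos_iff[OF E] S(3)[OF y(1)] d0t by blast
  ultimately have ne: "class_deg E t z \<noteq> class_deg E t y" by simp
  have dzy: "deg E z = deg E y" using dz y by simp
  \<comment> \<open>Only y has neighbours in the class, so z must make up for them by a neighbour x
    outside both classes. Such an x sees all of the class or none of it, and either way it completes
    an alternating 4-cycle without equal opposite degrees.\<close>
  obtain x c where x: "deg E x \<noteq> deg E c" "E z x" "\<not> E y x"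
    "\<And>s. class_deg E s y = class_deg E s z + of_bool (s = deg E c) - of_bool (s = deg E x)"
    by (rule class_deg_diff[OF u dzy ne]) blast
  have "deg E c = t" using x(4)[of t] \<open>class_deg E t z = 0\<close> \<open>class_deg E t y > 0\<close> by (auto simp: of_bool_def split: if_splits)
  then have xt: "deg E x \<noteq> t" using x(1) by simp
  have xs: "deg E x \<noteq> s" using stable_s[OF dz] x(2) by blast
  show False
  proof (cases "E d0 x")
    case True
    obtain b where b: "b \<in> deg_class V E t" "b \<noteq> d0" "\<not> E d0 b" using low_nonadj[OF d0] .
    have "E b x" using other_uniform[OF b(1) MsD(5)[OF d0] xt xs] True by simp
    then have "deg E y = deg E b \<or> deg E d0 = deg E x"
      using opposite[OF u S(3)[OF y(1)] S(3)[OF \<open>E b x\<close>] x(3) b(3)] xs y b by auto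
    then show False using y b d0t xt ts by (auto simp: deg_class_def)
  next
    case False
    obtain a where a: "a \<in> Mt" using ex_high by (auto simp: Mt_def)
    obtain v where v: "v \<in> deg_class V E t" "E a v" using high_adj[OF a] .
    have nvx: "\<not> E v x" using other_uniform[OF v(1) MsD(5)[OF d0] xt xs] False by simp
    have naz: "\<not> E a z" using nz MtD(5)[OF a] by blast
    have dg: "deg E a = t" "deg E v = t" using MtD a v by (auto simp: deg_class_def)
    then have "a \<noteq> z" "v \<noteq> x" using dz xt ts by auto
    then have "deg E a = deg E x \<or> deg E v = deg E z"
      using opposite[OF u v(2) x(2) naz nvx] by blast
    then show False using dg xt dz ts by auto
  qed
qed

end

context varied begin

lemma class_s_singleton:
  assumes y: "y1 \<in> deg_class V E s" "y2 \<in> deg_class V E s"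
  shows "y1 = y2"
proof (cases "w = 0")
  case True
  interpret Z: varied0 V E t s D using varied_axioms True by (simp add: varied0_def)
  show ?thesis by (rule Z.single_class[OF y])
next
  case False
  obtain d where d: "d \<in> Ms" using ex_low by (auto simp: Ms_def)
  have "{v \<in> deg_class V E s. E d v} = deg_class V E s" using low_complete[OF False d] by blast
  \<comment> \<open>By completeness the second class has exactly \<open>w + 1\<close> vertices, so
    the parameter of the complement is 0.\<close>
  then have w: "int (card (deg_class V E s)) - w - 1 = 0" using class_deg_cl[OF E, of s d] MsD(4)[OF d] by simp
  obtain t' s' where F: "varied V (compl_on V E) t' s' (int (card (deg_class V E t)) - D - 2) 0"
    "deg_class V (compl_on V E) s' = deg_class V E s" using varied_co[OF y(1)] unfolding w by metis
  interpret F: varied0 V "compl_on V E" t' s' "int (card (deg_class V E t)) - D - 2"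
    using F(1) by (simp add: varied0_def)
  show ?thesis using F.single_class F(2) y by blast
qed

end

section \<open>The core of a unigraph\<close>

text \<open>A missing edge between two complete outer vertices alternates with a non-edge of the
  class, an edge between two anticomplete ones with an edge of the class. Mixedness provides
  both.\<close>

lemma uniform_outside:
  assumes u: "unigraph_on V E" and m: "mixed V E t" and MC: "deg_class V E t \<subseteq> C"
  shows "is_clique E {x \<in> V - C. \<forall>v\<in>C. E x v}" "is_stable E {x \<in> V - C. \<forall>v\<in>C. \<not> E x v}"
proof -
  note E = unigraph_onD[OF u] note S = sgraphD(2-5)[OF E]
  obtain a b c d where m: "a \<in> deg_class V E t" "b \<in> deg_class V E t" "E a b" "c \<in> deg_class V E t" "d \<in> deg_class V E t" "c \<noteq> d" "\<not> E c d"
    using m unfolding mixed_def by blast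
  have dg: "deg E a = t" "deg E b = t" "deg E c = t" "deg E d = t" using m by (auto simp: deg_class_def)
  have out: "deg E x \<noteq> t" if "x \<in> V - C" for x using that MC by (auto simp: deg_class_def)
  have "E x y" if x: "x \<in> V - C" "\<forall>v\<in>C. E x v" and y: "y \<in> V - C" "\<forall>v\<in>C. E y v" and "x \<noteq> y" for x y
  proof (rule ccontr)
    assume n: "\<not> E x y"
    have "E c x" "E d y" using x y m MC S(3) by blast+
    then show False
      using opposite[OF u, of c x d y] m(6,7) n \<open>x \<noteq> y\<close> dg out[OF x(1)] out[OF y(1)] by auto
  qed
  then show "is_clique E {x \<in> V - C. \<forall>v\<in>C. E x v}" unfolding is_clique_def by blast
  have "\<not> E x y" if x: "x \<in> V - C" "\<forall>v\<in>C. \<not> E x v" and y: "y \<in> V - C" "\<forall>v\<in>C. \<not> E y v" for x y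
  proof
    assume xy: "E x y"
    have "\<not> E a x" "\<not> E b y" "a \<noteq> x" "b \<noteq> y" using x y m MC S(3) by blast+
    then show False
      using opposite[OF u m(3) xy] dg out[OF x(1)] out[OF y(1)] by auto
  qed
  then show "is_stable E {x \<in> V - C. \<forall>v\<in>C. \<not> E x v}" unfolding is_stable_def by blast
qed

lemma mixed_core:
  assumes u: "unigraph_on V E" and m: "mixed V E t"
  obtains C y k where "C \<subseteq> V" "y \<in> C" "\<And>v x. v \<in> C \<Longrightarrow> x \<in> V \<Longrightarrow> deg E x = deg E v \<Longrightarrow> x \<in> C"
    "\<And>v. v \<in> C \<Longrightarrow> v \<noteq> y \<Longrightarrow> card {x \<in> C. E v x} = k"
    "\<And>x. x \<in> V - C \<Longrightarrow> (\<forall>v\<in>C. E x v) \<or> (\<forall>v\<in>C. \<not> E x v)"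
    "is_clique E {x \<in> V - C. \<forall>v\<in>C. E x v}" "is_stable E {x \<in> V - C. \<forall>v\<in>C. \<not> E x v}"
proof (cases "\<forall>a\<in>deg_class V E t. \<forall>d\<in>deg_class V E t. \<forall>s. class_deg E s a = class_deg E s d")
  case True
  note E = unigraph_onD[OF u] note S = sgraphD(2-5)[OF E]
  obtain y where y: "y \<in> deg_class V E t" using m unfolding mixed_def by blast
  show thesis
  proof (rule that[OF _ y])
    show "deg_class V E t \<subseteq> V" by (auto simp: deg_class_def)
    show "x \<in> deg_class V E t" if "v \<in> deg_class V E t" "x \<in> V" "deg E x = deg E v" for v x using that by (auto simp: deg_class_def)
    show "card {x \<in> deg_class V E t. E v x} = nat (class_deg E t y)" if "v \<in> deg_class V E t" for v
      using True y that class_deg_cl[OF E, of t v] by (metis nat_int)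
    show "(\<forall>v\<in>deg_class V E t. E x v) \<or> (\<forall>v\<in>deg_class V E t. \<not> E x v)" if "x \<in> V - deg_class V E t" for x
    proof -
      have "deg E x \<noteq> t" using that by (auto simp: deg_class_def)
      then show ?thesis using regular_class_uniform[OF u m] True by blast
    qed
  qed (use uniform_outside[OF u m] in auto)
next
  case False
  note E = unigraph_onD[OF u] note S = sgraphD(2-5)[OF E]
  obtain a d where ad: "a \<in> deg_class V E t" "d \<in> deg_class V E t" "class_deg E t d < class_deg E t a"
  proof -
    obtain a d s where "a \<in> deg_class V E t" "d \<in> deg_class V E t" "class_deg E s a \<noteq> class_deg E s d" using False by blast
    then have "class_deg E t a \<noteq> class_deg E t d" using inner_variation[OF u m] by blast
    then show thesis using that \<open>a \<in> _\<close> \<open>d \<in> _\<close> by (metis linorder_neqE_linordered_idom)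
  qed
  have dg: "deg E a = t" "deg E d = t" using ad by (auto simp: deg_class_def)
  then have dd: "deg E a = deg E d" and ne: "class_deg E t a \<noteq> class_deg E t d" using ad by auto
  have step: "class_deg E t a = class_deg E t d + 1" using class_deg_near[OF u dd, of t] ad by simp
  obtain b c where bc: "deg E b \<noteq> deg E c" "E d c"
    "\<And>s. class_deg E s d = class_deg E s a + of_bool (s = deg E c) - of_bool (s = deg E b)"
    by (rule class_deg_diff[OF u dd ne]) blast
  have bt: "deg E b = t" using bc(3)[of t] step by (auto simp: of_bool_def split: if_splits)
  define s where "s = deg E c"
  define D where "D = class_deg E t d"
  define w where "w = class_deg E s a"
  interpret varied V E t s D w
  proof
    show "unigraph_on V E" by (rule u)
    show "t \<noteq> s" using bc(1) bt by (simp add: s_def)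
    fix v assume v: "v \<in> deg_class V E t"
    then have dv: "deg E v = t" by (simp add: deg_class_def)
    have "class_deg E t v = class_deg E t d \<or> class_deg E t v = class_deg E t a"
      using class_deg_near[OF u, of v d t] class_deg_near[OF u, of a v t] dv dg step by linarith
    then show "class_deg E t v = D + 1 \<and> class_deg E s v = w \<or> class_deg E t v = D \<and> class_deg E s v = w + 1"
      using inner_variation[OF u m v ad(1), of s] inner_variation[OF u m v ad(2), of s] bc(1) bc(3)[of s] step
      by (auto simp: D_def w_def s_def)
  qed (use ad step in \<open>auto simp: D_def\<close>)
  have aMt: "a \<in> Mt" and dMs: "d \<in> Ms" using ad step unfolding Mt_def Ms_def by (simp_all add: D_def)
  have cV: "c \<in> V" "c \<in> deg_class V E s" using bc(2) S(2) by (auto simp: deg_class_def s_def)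
  have cls: "deg_class V E s = {c}" using class_s_singleton cV by blast
  let ?C = "insert c (deg_class V E t)"
  have nbs: "class_deg E s v = of_bool (E v c)" for v
    using class_deg_cl[OF E, of s v] unfolding cls by (auto simp: Collect_conv_if)
  \<comment> \<open>The class of c is a singleton, so c is adjacent to all of \<open>Ms\<close> and
    to none of \<open>Mt\<close>. Adding c to the class makes up the missing inner neighbour of
    \<open>Ms\<close>, and every vertex other than c has degree \<open>D + 1\<close> in the
    core.\<close>
  have w0: "w = 0" using MsD(4)[OF dMs] nbs[of d] w_nonneg by (auto simp: of_bool_def split: if_splits)
  have nac: "\<not> E a c" using MtD(4)[OF aMt] nbs[of a] w0 by auto
  have sts: "deg E c = s" "c \<notin> deg_class V E t" using ts by (auto simp: s_def deg_class_def)
  show thesis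
  proof (rule that[of ?C c])
    show "?C \<subseteq> V" using cV by (auto simp: deg_class_def)
    show "c \<in> ?C" by simp
    show "x \<in> ?C" if "v \<in> ?C" "x \<in> V" "deg E x = deg E v" for v x
      using that cls sts by (auto simp: deg_class_def)
    show "card {x \<in> ?C. E v x} = nat (D + 1)" if v: "v \<in> ?C" "v \<noteq> c" for v
    proof -
      have vM: "v \<in> deg_class V E t" using v by blast
      have "{x \<in> ?C. E v x} = {x \<in> deg_class V E t. E v x} \<union> (if E v c then {c} else {})" by auto
      then have "int (card {x \<in> ?C. E v x}) = class_deg E t v + of_bool (E v c)"
        using class_deg_cl[OF E, of t v] sts fin_cl[of t] by auto
      also have "\<dots> = D + 1" using types[OF vM] nbs[of v] w0 by auto
      finally show ?thesis by simp
    qed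
    show "(\<forall>v\<in>?C. E x v) \<or> (\<forall>v\<in>?C. \<not> E x v)" if x: "x \<in> V - ?C" for x
    proof -
      have dx: "deg E x \<noteq> t" "deg E x \<noteq> s" using x cls by (auto simp: deg_class_def)
      have xc: "x \<noteq> c" using x by blast
      show ?thesis
      proof (cases "E x d")
        case True
        then have all: "E x v" if "v \<in> deg_class V E t" for v
          using other_uniform[OF that ad(2) dx] S(3) by blast
        obtain b where b: "b \<in> deg_class V E t" "b \<noteq> d" "\<not> E d b" using low_nonadj[OF dMs] .
        have "E c x"
        proof (rule ccontr)
          assume n: "\<not> E c x"
          have "deg E c = deg E b \<or> deg E d = deg E x"
            using opposite[OF u S(3)[OF bc(2)] all[OF b(1)] n b(3)] xc b(2) by auto
          then show False using b sts ts dg dx by (auto simp: deg_class_def)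
        qed
        then show ?thesis using all S(3) by blast
      next
        case False
        then have none: "\<not> E x v" if "v \<in> deg_class V E t" for v
          using other_uniform[OF that ad(2) dx] S(3) by blast
        obtain b where b: "b \<in> deg_class V E t" "E a b" using high_adj[OF aMt] .
        have "\<not> E c x"
        proof
          assume cx: "E c x"
          have "\<not> E b x" using none[OF b(1)] S(3) by blast
          moreover have "a \<noteq> c" "b \<noteq> x" using sts ad b dx by (auto simp: deg_class_def)
          ultimately have "deg E a = deg E x \<or> deg E b = deg E c"
            using opposite[OF u b(2) cx nac] by blast
          then show False using b sts ts dg dx by (auto simp: deg_class_def)
        qed
        then show ?thesis using none S(3) by blast
      qed
    qed
  qed (rule uniform_outside[OF u m]; blast)+
qed

text \<open>A realization on \<open>C\<close>, completed by the old edges elsewhere, realizes the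
  whole degree sequence. The resulting isomorphism preserves degrees and so maps \<open>C\<close>, a
  union of degree classes, onto itself.\<close>

lemma unigraph_on_restrict:
  assumes u: "unigraph_on V E" and CV: "C \<subseteq> V" and closed: "\<And>v x. v \<in> C \<Longrightarrow> x \<in> V \<Longrightarrow> deg E x = deg E v \<Longrightarrow> x \<in> C"
  shows "unigraph_on C (\<lambda>x v. x \<in> C \<and> v \<in> C \<and> E x v)"
  unfolding unigraph_on_def
proof (intro conjI allI impI)
  let ?G = "\<lambda>x v. x \<in> C \<and> v \<in> C \<and> E x v"
  note E = unigraph_onD[OF u] note S = sgraphD(2-5)[OF E]
  show sG: "sgraph C ?G"
    using S(3,4) finite_subset[OF CV sgraphD(1)[OF E]] unfolding sgraph_def by blast
  fix G' assume G': "realizes C ?G G'"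
  then have sG': "sgraph C G'" and dG': "\<And>v. deg G' v = deg ?G v" by (auto simp: realizes_def)
  define F where "F x v \<longleftrightarrow> (if x \<in> C \<and> v \<in> C then G' x v else E x v)" for x v
  have sF: "sgraph V F"
  proof -
    have "F x v \<Longrightarrow> x \<in> V \<and> v \<in> V \<and> x \<noteq> v" for x v
      using S(1)[of x v] S(2)[of x v] S(4)[of v] CV sgraphD(5)[OF sG', of v] unfolding F_def
      by (auto split: if_splits)
    moreover have "F x v \<Longrightarrow> F v x" for x v
      using S(3)[of x v] sgraphD(4)[OF sG', of x v] unfolding F_def by (auto split: if_splits)
    ultimately show ?thesis using sgraphD(1)[OF E] unfolding sgraph_def by blast
  qed
  have dF: "deg F v = deg E v" for v
  proof (cases "v \<in> C")
    case True
    have *: "card {x. H v x} = card {x. x \<in> C \<and> H v x} + card {x. H v x \<and> x \<notin> C}" if "sgraph V H" for H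
    proof -
      have "{x. H v x} = {x. x \<in> C \<and> H v x} \<union> {x. H v x \<and> x \<notin> C}" by blast
      moreover have "finite {x. x \<in> C \<and> H v x}" using sgraphD(8)[OF that, of v "\<lambda>x. x \<in> C"] by (simp add: conj_commute)
      moreover have "finite {x. H v x \<and> x \<notin> C}" by (rule sgraphD(8)[OF that])
      moreover have "{x. x \<in> C \<and> H v x} \<inter> {x. H v x \<and> x \<notin> C} = {}" by blast
      ultimately show ?thesis using card_Un_disjoint by metis
    qed
    have "{x. x \<in> C \<and> F v x} = {x. G' v x}" using True sgraphD(3)[OF sG'] by (auto simp: F_def)
    moreover have "{x. x \<in> C \<and> E v x} = {x. ?G v x}" using True by auto
    moreover have "{x. F v x \<and> x \<notin> C} = {x. E v x \<and> x \<notin> C}" by (auto simp: F_def)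
    moreover have "card {x. G' v x} = card {x. ?G v x}" using dG'[of v] unfolding deg_def .
    ultimately have "card {x. F v x} = card {x. E v x}" unfolding *[OF sF] *[OF E] by (simp only:)
    then show ?thesis unfolding deg_def .
  qed (simp add: deg_def F_def)
  obtain f where f: "bij_betw f V V" "\<forall>x\<in>V. \<forall>v\<in>V. F x v \<longleftrightarrow> E (f x) (f v)"
    using u sF dF unfolding unigraph_on_def realizes_def by metis
  have df: "deg E (f v) = deg E v" if "v \<in> V" for v using iso_deg[OF E sF f that] dF by simp
  have "f ` C \<subseteq> C" using closed df CV bij_betwE[OF f(1)] by blast
  moreover have inj: "inj_on f C" using f(1) CV by (auto simp: bij_betw_def intro: inj_on_subset)
  ultimately have "f ` C = C"
    using finite_subset[OF CV sgraphD(1)[OF E]] by (simp add: endo_inj_surj)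
  then have bij: "bij_betw f C C" using inj by (simp add: bij_betw_def)
  moreover have "G' x v \<longleftrightarrow> ?G (f x) (f v)" if "x \<in> C" "v \<in> C" for x v
  proof -
    have "F x v \<longleftrightarrow> E (f x) (f v)" using f(2) CV that by blast
    then show ?thesis using that \<open>f ` C = C\<close> by (auto simp: F_def)
  qed
  ultimately show "\<exists>f. bij_betw f C C \<and> (\<forall>x\<in>C. \<forall>v\<in>C. G' x v \<longleftrightarrow> ?G (f x) (f v))" by blast
qed

text \<open>A clique together with a colouring by as many colours certifies that clique number and
  chromatic number coincide.\<close>

definition perfect_on :: "'a set \<Rightarrow> ('a \<Rightarrow> 'a \<Rightarrow> bool) \<Rightarrow> bool" where
  "perfect_on V E \<longleftrightarrow> (\<forall>W\<subseteq>V. \<exists>K (f :: 'a \<Rightarrow> nat). K \<subseteq> W \<and> is_clique E K \<and> (\<forall>v\<in>W. f v < card K) \<and>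
     (\<forall>x\<in>W. \<forall>y\<in>W. E x y \<longrightarrow> f x \<noteq> f y))"

lemma perfect_onE:
  assumes "perfect_on V E" "W \<subseteq> V"
  obtains K and f :: "'a \<Rightarrow> nat" where "K \<subseteq> W" "is_clique E K" "\<forall>v\<in>W. f v < card K"
    "\<forall>x\<in>W. \<forall>y\<in>W. E x y \<longrightarrow> f x \<noteq> f y"
proof -
  from assms(1)[unfolded perfect_on_def, rule_format, OF assms(2)]
  obtain K and f :: "'a \<Rightarrow> nat" where "K \<subseteq> W \<and> is_clique E K \<and> (\<forall>v\<in>W. f v < card K) \<and>
     (\<forall>x\<in>W. \<forall>y\<in>W. E x y \<longrightarrow> f x \<noteq> f y)" by (elim exE)
  then show thesis by (elim conjE) (rule that)
qed

lemma perfect_onI: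
  assumes "\<And>W. W \<subseteq> V \<Longrightarrow> \<exists>K (f :: 'a \<Rightarrow> nat). K \<subseteq> W \<and> is_clique E K \<and> (\<forall>v\<in>W. f v < card K) \<and>
     (\<forall>x\<in>W. \<forall>y\<in>W. E x y \<longrightarrow> f x \<noteq> f y)"
  shows "perfect_on V E"
  using assms unfolding perfect_on_def by simp

lemma perfect_on_subset:
  assumes "perfect_on V E" "U \<subseteq> V"
  shows "perfect_on U E"
  by (rule perfect_onI) (rule assms(1)[unfolded perfect_on_def, rule_format, OF subset_trans[OF _ assms(2)]])

lemma perfect_on_iso:
  assumes "perfect_on V E" "bij_betw f U V" "\<And>x y. x \<in> U \<Longrightarrow> y \<in> U \<Longrightarrow> F x y \<longleftrightarrow> E (f x) (f y)"
  shows "perfect_on U F"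
proof (rule perfect_onI)
  fix W assume W: "W \<subseteq> U"
  have inj: "inj_on f U" and im: "f ` U = V" using assms(2) by (auto simp: bij_betw_def)
  then have "f ` W \<subseteq> V" using W by blast
  then obtain K g where K: "K \<subseteq> f ` W" "is_clique E K" "\<forall>v\<in>f ` W. g v < card K"
    "\<forall>x\<in>f ` W. \<forall>y\<in>f ` W. E x y \<longrightarrow> g x \<noteq> (g y :: nat)"
    by (rule perfect_onE[OF assms(1)])
  define K' where "K' = {x \<in> W. f x \<in> K}"
  have fK: "f ` K' = K" using K(1) by (auto simp: K'_def)
  have injK: "inj_on f K'" using inj W by (auto simp: K'_def intro: inj_on_subset)
  have "card K' = card K" using card_image[OF injK] fK by simp
  moreover have "is_clique F K'"
  proof -
    have "F x y" if "x \<in> K'" "y \<in> K'" "x \<noteq> y" for x y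
    proof -
      have "f x \<noteq> f y" using injK that by (auto simp: inj_on_def)
      then have "E (f x) (f y)" using K(2) that unfolding is_clique_def K'_def by blast
      then show ?thesis using assms(3) that W by (auto simp: K'_def)
    qed
    then show ?thesis by (simp add: is_clique_def)
  qed
  moreover have "\<forall>x\<in>W. \<forall>y\<in>W. F x y \<longrightarrow> (g \<circ> f) x \<noteq> (g \<circ> f) y"
    using K(4) assms(3) W by (metis comp_apply image_eqI subsetD)
  ultimately show "\<exists>K g. K \<subseteq> W \<and> is_clique F K \<and> (\<forall>v\<in>W. g v < card K) \<and>
     (\<forall>x\<in>W. \<forall>y\<in>W. F x y \<longrightarrow> g x \<noteq> (g y :: nat))"
    using K(3) by (intro exI[of _ K'] exI[of _ "g \<circ> f"]) (auto simp: K'_def)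
qed

section \<open>Perfect graphs\<close>

lemma perfect_on_bip:
  assumes fin: "finite V" and V: "V = A \<union> B" and A: "is_stable E A" and B: "is_stable E B"
    and E: "\<And>x. \<not> E x x" "\<And>x y. E x y \<Longrightarrow> E y x"
  shows "perfect_on V E"
proof (rule perfect_onI)
  fix W assume W: "W \<subseteq> V"
  show "\<exists>K (f :: 'a \<Rightarrow> nat). K \<subseteq> W \<and> is_clique E K \<and> (\<forall>v\<in>W. f v < card K) \<and> (\<forall>x\<in>W. \<forall>y\<in>W. E x y \<longrightarrow> f x \<noteq> f y)"
  proof (cases "\<exists>x\<in>W. \<exists>y\<in>W. E x y")
    case True
    then obtain x y where xy: "x \<in> W" "y \<in> W" "E x y" by blast
    then have "x \<noteq> y" using E by auto
    then have c: "card {x,y} = 2" by simp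
    have col: "(if u \<in> A then 0 else 1 :: nat) \<noteq> (if v \<in> A then 0 else 1)" if "u \<in> W" "v \<in> W" "E u v" for u v
    proof -
      have "u \<in> A \<or> u \<in> B" "v \<in> A \<or> v \<in> B" using that W V by auto
      then show ?thesis using that(3) A B unfolding is_stable_def by auto
    qed
    show ?thesis
      by (rule exI[of _ "{x,y}"], rule exI[of _ "\<lambda>v. if v \<in> A then 0 else 1"])
        (use xy E(2)[OF xy(3)] c col in \<open>auto simp: is_clique_def\<close>)
  next
    case False
    show ?thesis
    proof (cases "W = {}")
      case True
      then show ?thesis by (intro exI[of _ "{}"]) (auto simp: is_clique_def)
    next
      case ne: False
      then obtain x where "x \<in> W" by blast
      then show ?thesis using False
        by (intro exI[of _ "{x}"] exI[of _ "\<lambda>_. 0"]) (auto simp: is_clique_def)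
    qed
  qed
qed

text \<open>
  Two maximum cliques avoiding p can be crossed over: the union of the traces on A together
  with the intersection of the traces on B is again a maximum clique. Hence those cliques
  have a least trace on B, which contains a non-neighbour q of p; then {p, q} meets every
  maximum clique.
\<close>

lemma cobip_hitting:
  assumes fin: "finite W" and W: "W \<subseteq> A \<union> B" and dis: "A \<inter> B = {}"
    and A: "is_clique E A" and B: "is_clique E B" and sym: "\<And>x y. E x y \<Longrightarrow> E y x"
    and p: "p \<in> W" "p \<in> A"
    and max: "\<And>K. K \<subseteq> W \<Longrightarrow> is_clique E K \<Longrightarrow> card K \<le> m"
  obtains I where "p \<in> I" "I \<subseteq> W"
    "\<And>K. K \<subseteq> W \<Longrightarrow> is_clique E K \<Longrightarrow> card K = m \<Longrightarrow> K \<inter> I \<noteq> {}" "\<And>x y. x \<in> I \<Longrightarrow> y \<in> I \<Longrightarrow> x \<noteq> y \<Longrightarrow> \<not> E x y"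
proof (cases "\<exists>K. K \<subseteq> W \<and> is_clique E K \<and> card K = m \<and> p \<notin> K")
  case False
  then show thesis using that[of "{p}"] p by blast
next
  case True
  let ?F = "{K. K \<subseteq> W \<and> is_clique E K \<and> card K = m \<and> p \<notin> K}"
  have finF: "finite ?F" using fin by (auto intro: finite_subset[of _ "Pow W"])
  obtain K0 where K0: "K0 \<in> ?F" "\<And>K. K \<in> ?F \<Longrightarrow> card (K0 \<inter> B) \<le> card (K \<inter> B)"
  proof -
    have "?F \<noteq> {}" using True by blast
    then have "Min ((\<lambda>K. card (K \<inter> B)) ` ?F) \<in> (\<lambda>K. card (K \<inter> B)) ` ?F" using finF by (intro Min_in) auto
    then obtain K0 where "K0 \<in> ?F" "card (K0 \<inter> B) = Min ((\<lambda>K. card (K \<inter> B)) ` ?F)" by force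
    moreover have "Min ((\<lambda>K. card (K \<inter> B)) ` ?F) \<le> card (K \<inter> B)" if "K \<in> ?F" for K
      using that finF by (intro Min_le) auto
    ultimately show thesis using that by simp
  qed
  have fK: "finite K" if "K \<subseteq> W" for K using fin that by (rule rev_finite_subset)
  have split: "card K = card (K \<inter> A) + card (K \<inter> B)" if "K \<subseteq> W" for K
  proof -
    have "K = (K \<inter> A) \<union> (K \<inter> B)" using that W by blast
    moreover have "card ((K \<inter> A) \<union> (K \<inter> B)) = card (K \<inter> A) + card (K \<inter> B)"
      using fK[OF that] dis by (intro card_Un_disjoint) auto
    ultimately show ?thesis by simp
  qed
  have sub: "K0 \<inter> B \<subseteq> K" if K: "K \<in> ?F" for K
  proof -
    define X where "X = ((K0 \<union> K) \<inter> A) \<union> ((K0 \<inter> K) \<inter> B)"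
    define Y where "Y = ((K0 \<inter> K) \<inter> A) \<union> ((K0 \<union> K) \<inter> B)"
    have XW: "X \<subseteq> W" "Y \<subseteq> W" "p \<notin> X" using K K0(1) by (auto simp: X_def Y_def)
    have XAB: "X \<inter> A = (K0 \<union> K) \<inter> A" "X \<inter> B = (K0 \<inter> K) \<inter> B" "Y \<inter> A = (K0 \<inter> K) \<inter> A" "Y \<inter> B = (K0 \<union> K) \<inter> B"
      using dis by (auto simp: X_def Y_def)
    have deg_class: "is_clique E X" "is_clique E Y"
      using K K0(1) A B unfolding is_clique_def X_def Y_def by blast+
    have UI: "card (S \<union> T) + card (S \<inter> T) = card S + card T" if "finite S" "finite T" for S T :: "'a set"
      using card_Un_Int[OF that] by simp
    have f0: "finite K0" "finite K" using K K0(1) fK by auto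
    have dist: "(K0 \<union> K) \<inter> S = (K0 \<inter> S) \<union> (K \<inter> S)" "(K0 \<inter> K) \<inter> S = (K0 \<inter> S) \<inter> (K \<inter> S)" for S
      by blast+
    have "card ((K0 \<union> K) \<inter> A) + card ((K0 \<inter> K) \<inter> A) = card (K0 \<inter> A) + card (K \<inter> A)"
      unfolding dist(1)[of A] dist(2)[of A] by (rule UI) (use f0 in auto)
    moreover have "card ((K0 \<union> K) \<inter> B) + card ((K0 \<inter> K) \<inter> B) = card (K0 \<inter> B) + card (K \<inter> B)"
      unfolding dist(1)[of B] dist(2)[of B] by (rule UI) (use f0 in auto)
    \<comment> \<open>Both cliques have at most \<open>m\<close> vertices and their sizes add up to
      \<open>2 * m\<close>, so both are maximum.\<close>
    ultimately have "card X + card Y = card K0 + card K"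
      using split[OF XW(1)] split[OF XW(2)] split[of K0] split[of K] K K0(1) unfolding XAB by auto
    then have "card X = m" using max[OF XW(1) deg_class(1)] max[OF XW(2) deg_class(2)] K K0(1) by auto
    then have "X \<in> ?F" using XW deg_class by blast
    then have "card (K0 \<inter> B) \<le> card (X \<inter> B)" by (rule K0(2))
    moreover have "X \<inter> B \<subseteq> K0 \<inter> B" unfolding XAB by blast
    ultimately have "X \<inter> B = K0 \<inter> B" using f0 by (intro card_seteq) auto
    then show ?thesis unfolding XAB by blast
  qed
  have "\<exists>q\<in>K0 \<inter> B. \<not> E p q"
  proof (rule ccontr)
    assume "\<not> ?thesis"
    then have "is_clique E (insert p K0)"
      using K0(1) A p W sym unfolding is_clique_def by blast
    then have "card (insert p K0) \<le> m" using K0(1) p by (intro max) auto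
    then show False using K0(1) fK[of K0] by auto
  qed
  then obtain q where q: "q \<in> K0" "q \<in> B" "\<not> E p q" by blast
  show thesis
  proof (cases "E q p")
    case True
    then show thesis using sym q by blast
  next
    case False
    have qW: "q \<in> W" using q K0(1) by blast
    have hit: "K \<inter> {p,q} \<noteq> {}" if "K \<subseteq> W" "is_clique E K" "card K = m" for K
      using sub[of K] that q by blast
    have ind: "x \<in> {p,q} \<Longrightarrow> y \<in> {p,q} \<Longrightarrow> x \<noteq> y \<Longrightarrow> \<not> E x y" for x y
      using q False by blast
    show thesis by (rule that[of "{p,q}"]) (use p qW hit ind in auto)
  qed
qed

text \<open>Removing a stable set that meets every maximum clique lowers the clique number. By
  induction the rest needs at most one colour fewer, and the stable set takes the last
  colour.\<close>

lemma perfect_on_cobip: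
  assumes fin: "finite V" and V: "V = A \<union> B" and dis: "A \<inter> B = {}"
    and A: "is_clique E A" and B: "is_clique E B" and irr: "\<And>x. \<not> E x x" and sym: "\<And>x y. E x y \<Longrightarrow> E y x"
  shows "perfect_on V E"
proof (rule perfect_onI)
  fix W assume "W \<subseteq> V"
  then show "\<exists>K (f :: 'a \<Rightarrow> nat). K \<subseteq> W \<and> is_clique E K \<and> (\<forall>v\<in>W. f v < card K) \<and> (\<forall>x\<in>W. \<forall>y\<in>W. E x y \<longrightarrow> f x \<noteq> f y)"
  proof (induction "card W" arbitrary: W rule: less_induct)
    case less
    have finW: "finite W" using fin less.prems by (rule rev_finite_subset)
    show ?case
    proof (cases "W = {}")
      case True
      then show ?thesis by (intro exI[of _ "{}"]) (auto simp: is_clique_def)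
    next
      case False
      then obtain p where p: "p \<in> W" by blast
      let ?C = "{K. K \<subseteq> W \<and> is_clique E K}"
      have finC: "finite ?C" using finW by (auto intro: finite_subset[of _ "Pow W"])
      have "{} \<in> ?C" by (auto simp: is_clique_def)
      then have "Max (card ` ?C) \<in> card ` ?C" using finC by (intro Max_in) auto
      then obtain K where K: "K \<subseteq> W" "is_clique E K" "card K = Max (card ` ?C)" by force
      have max: "card L \<le> card K" if "L \<subseteq> W" "is_clique E L" for L
        unfolding K(3) using that finC by (intro Max_ge) auto
      obtain I where I: "p \<in> I" "I \<subseteq> W" "\<And>L. L \<subseteq> W \<Longrightarrow> is_clique E L \<Longrightarrow> card L = card K \<Longrightarrow> L \<inter> I \<noteq> {}"
        "\<And>x y. x \<in> I \<Longrightarrow> y \<in> I \<Longrightarrow> x \<noteq> y \<Longrightarrow> \<not> E x y"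
      proof (cases "p \<in> A")
        case True
        show thesis
          by (rule cobip_hitting[OF finW _ dis A B sym p True max]) (use less.prems V that in blast)+
      next
        case False
        then have pB: "p \<in> B" using p less.prems V by blast
        have dis': "B \<inter> A = {}" and W': "W \<subseteq> B \<union> A" using dis less.prems V by auto
        show thesis
          by (rule cobip_hitting[OF finW W' dis' B A sym p pB max]) (use that in blast)+
      qed
      have "card (W - I) < card W" using I(1,2) p finW by (intro psubset_card_mono) auto
      moreover have "W - I \<subseteq> V" using less.prems by blast
      ultimately obtain L and f :: "'a \<Rightarrow> nat" where L: "L \<subseteq> W - I" "is_clique E L" "\<forall>v\<in>W - I. f v < card L"
        "\<forall>x\<in>W - I. \<forall>y\<in>W - I. E x y \<longrightarrow> f x \<noteq> f y"
        using less.hyps[of "W - I"] by blast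
      have "card L \<le> card K" using max[of L] L by blast
      moreover have "card L \<noteq> card K" using I(3)[of L] L by blast
      ultimately have LK: "card L < card K" by simp
      define g where "g v = (if v \<in> I then card K - 1 else f v)" for v
      have g: "g v < card L" if "v \<in> W" "v \<notin> I" for v using L(3) that by (auto simp: g_def)
      have "g v < card K" if "v \<in> W" for v
        using g[OF that] LK by (cases "v \<in> I") (auto simp: g_def)
      moreover have "g x \<noteq> g y" if "x \<in> W" "y \<in> W" "E x y" for x y
      proof (cases "x \<in> I")
        case True
        then have "y \<notin> I" using I(4)[of x y] that irr by blast
        then have "g y < card K - 1" using g[OF that(2)] LK by simp
        then show ?thesis using True by (simp add: g_def)
      next
        case False
        show ?thesis
        proof (cases "y \<in> I")
          case True
          have "g x < card K - 1" using g[OF that(1) False] LK by simp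
          then show ?thesis using True by (simp add: g_def)
        next
          case yI: False
          then show ?thesis using L(4) False that by (auto simp: g_def)
        qed
      qed
      ultimately show ?thesis using K(1,2) by blast
    qed
  qed
qed

text \<open>A triangle through y matches the obvious three colours. Without one, the neighbours of y
  are stable and its non-neighbours lie in \<open>insert y A\<close>, so the graph is
  bipartite.\<close>

lemma perfect_on_bip_plus:
  assumes fin: "finite V" and V: "V = insert y (A \<union> B)" and y: "y \<notin> A \<union> B"
    and A: "is_stable E A" and B: "is_stable E B" and yB: "\<And>b. b \<in> B \<Longrightarrow> E y b"
    and E: "\<And>x. \<not> E x x" "\<And>x y. E x y \<Longrightarrow> E y x"
  shows "perfect_on V E"
proof (rule perfect_onI)
  fix W assume W: "W \<subseteq> V"
  have finW: "finite W" using fin W by (rule rev_finite_subset)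
  show "\<exists>K (f :: 'a \<Rightarrow> nat). K \<subseteq> W \<and> is_clique E K \<and> (\<forall>v\<in>W. f v < card K) \<and> (\<forall>x\<in>W. \<forall>y\<in>W. E x y \<longrightarrow> f x \<noteq> f y)"
  proof (cases "\<exists>u\<in>W. \<exists>v\<in>W. y \<in> W \<and> E y u \<and> E y v \<and> E u v")
    case True
    then obtain u v where uv: "u \<in> W" "v \<in> W" "y \<in> W" "E y u" "E y v" "E u v" by blast
    have ne: "y \<noteq> u" "y \<noteq> v" "u \<noteq> v" using uv E by auto
    then have c: "card {y,u,v} = 3" by simp
    define g where "g x = (if x = y then 2 else if x \<in> A then 0 else 1 :: nat)" for x
    have "g a \<noteq> g b" if "a \<in> W" "b \<in> W" "E a b" for a b
    proof -
      have "a = y \<or> a \<in> A \<or> a \<in> B" "b = y \<or> b \<in> A \<or> b \<in> B" "a \<noteq> b" using that W V E by auto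
      then show ?thesis using that(3) A B y unfolding is_stable_def g_def by auto
    qed
    moreover have "g a < 3" for a by (simp add: g_def)
    moreover have "is_clique E {y,u,v}"
      using uv E(2)[OF uv(4)] E(2)[OF uv(5)] E(2)[OF uv(6)] by (auto simp: is_clique_def)
    ultimately show ?thesis using c uv by (intro exI[of _ "{y,u,v}"] exI[of _ g]) auto
  next
    case False
    obtain A' B' where AB: "W = A' \<union> B'" "is_stable E A'" "is_stable E B'"
    proof (cases "y \<in> W")
      case True
      let ?N = "{v \<in> W. E y v}" and ?Z = "{v \<in> W. \<not> E y v}"
      have "W = ?N \<union> ?Z" by blast
      moreover have "is_stable E ?N" using False True unfolding is_stable_def by blast
      moreover have "?Z \<subseteq> insert y A" using W V yB by blast
      then have "is_stable E ?Z" using A E unfolding is_stable_def by blast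
      ultimately show thesis by (rule that)
    next
      case yW: False
      have "W = (W \<inter> A) \<union> (W \<inter> B)" using yW W V by blast
      moreover have "is_stable E (W \<inter> A)" "is_stable E (W \<inter> B)" using A B unfolding is_stable_def by auto
      ultimately show thesis by (rule that)
    qed
    have "perfect_on W E" by (rule perfect_on_bip[OF finW AB E])
    then show ?thesis unfolding perfect_on_def by blast
  qed
qed

text \<open>Either the neighbours of y leave one of the old colours free, or y and its neighbours
  form a clique large enough to pay for a new colour.\<close>

lemma perfect_on_simplicial:
  assumes fin: "finite V" and V: "perfect_on V E" and y: "y \<notin> V" and N: "is_clique E {v \<in> V. E y v}"
    and E: "\<And>x. \<not> E x x" "\<And>x y. E x y \<Longrightarrow> E y x"
  shows "perfect_on (insert y V) E"
proof (rule perfect_onI)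
  fix W assume W: "W \<subseteq> insert y V"
  show "\<exists>K (f :: 'a \<Rightarrow> nat). K \<subseteq> W \<and> is_clique E K \<and> (\<forall>v\<in>W. f v < card K) \<and> (\<forall>x\<in>W. \<forall>y\<in>W. E x y \<longrightarrow> f x \<noteq> f y)"
  proof (cases "y \<in> W")
    case False
    then have "W \<subseteq> V" using W by blast
    then show ?thesis using V unfolding perfect_on_def by simp
  next
    case True
    have W': "W - {y} \<subseteq> V" using W by blast
    obtain K and f :: "'a \<Rightarrow> nat" where K: "K \<subseteq> W - {y}" "is_clique E K" "\<forall>v\<in>W - {y}. f v < card K"
      "\<forall>x\<in>W - {y}. \<forall>y\<in>W - {y}. E x y \<longrightarrow> f x \<noteq> f y" by (rule perfect_onE[OF V W'])
    let ?N = "{v \<in> W - {y}. E y v}"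
    have finN: "finite ?N" using fin W' by (auto intro: finite_subset[of _ V])
    have Ncl: "is_clique E ?N" using N W' unfolding is_clique_def by blast
    have ext: "(f(y := c)) x \<noteq> (f(y := c)) z" if "c \<notin> f ` ?N" "x \<in> W" "z \<in> W" "E x z" for c x z
    proof -
      have xz: "x \<noteq> z" "E z x" using that(4) E by blast+
      consider "x = y" | "z = y" | "x \<noteq> y" "z \<noteq> y" by blast
      then show ?thesis
      proof cases
        case 1
        then have "z \<in> ?N" using that xz by auto
        then show ?thesis using 1 xz that(1) by auto
      next
        case 2
        then have "x \<in> ?N" using that xz by auto
        then show ?thesis using 2 xz that(1) by auto
      next
        case 3
        then show ?thesis using K(4) that by auto
      qed
    qed
    show ?thesis
    proof (cases "card ?N < card K")
      case True
      have "card (f ` ?N) < card {..<card K}" using True card_image_le[OF finN, of f] by simp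
      then have "\<not> {..<card K} \<subseteq> f ` ?N" using finN card_mono[of "f ` ?N" "{..<card K}"] by auto
      then obtain c where c: "c < card K" "c \<notin> f ` ?N" by blast
      show ?thesis
        by (rule exI[of _ K], rule exI[of _ "f(y := c)"]) (use K c ext[OF c(2)] in auto)
    next
      case False
      have "card ?N \<notin> f ` ?N" using K(3) False by fastforce
      note ext' = ext[OF this]
      have "E y v \<and> E v y" if "v \<in> ?N" for v using that E(2)[of y v] by blast
      then have "is_clique E (insert y ?N)" using Ncl unfolding is_clique_def by blast
      moreover have "card (insert y ?N) = Suc (card ?N)" using finN by simp
      moreover have "(f(y := card ?N)) v < Suc (card ?N)" if "v \<in> W" for v
      proof (cases "v = y")
        case v: False
        then have "f v < card K" using K(3) that by blast
        then show ?thesis using False v by simp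
      qed simp
      moreover have "insert y ?N \<subseteq> W" using \<open>y \<in> W\<close> by blast
      ultimately show ?thesis
        by (intro exI[of _ "insert y ?N"] exI[of _ "f(y := card ?N)"] conjI ballI impI)
          (blast, blast, simp only:, rule ext')
    qed
  qed
qed

lemma perfect_on_split_join:
  assumes V: "V \<subseteq> A \<union> B \<union> C" and A: "is_clique E A" "finite A" and B: "is_stable E B" and C: "perfect_on C E" "finite C"
    and dis: "A \<inter> B = {}" "A \<inter> C = {}" "B \<inter> C = {}"
    and AC: "\<And>a c. a \<in> A \<Longrightarrow> c \<in> C \<Longrightarrow> E a c" and BC: "\<And>b c. b \<in> B \<Longrightarrow> c \<in> C \<Longrightarrow> \<not> E b c"
    and E: "\<And>x. \<not> E x x" "\<And>x y. E x y \<Longrightarrow> E y x"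
  shows "perfect_on V E"
proof (rule perfect_onI)
  fix W assume WV: "W \<subseteq> V"
  then have W: "W \<subseteq> A \<union> B \<union> C" using V by blast
  let ?A = "W \<inter> A"
  have finA: "finite ?A" using A by simp
  have Acl: "is_clique E ?A" using A(1) unfolding is_clique_def by blast
  obtain h where h: "bij_betw h ?A {..<card ?A}" using finite_same_card_bij[OF finA, of "{..<card ?A}"] by auto
  have hlt: "h a < card ?A" if "a \<in> ?A" for a using bij_betwE[OF h] that by blast
  have hinj: "h a \<noteq> h b" if "a \<in> ?A" "b \<in> ?A" "a \<noteq> b" for a b
    using h that unfolding bij_betw_def inj_on_def by blast
  show "\<exists>K (f :: 'a \<Rightarrow> nat). K \<subseteq> W \<and> is_clique E K \<and> (\<forall>v\<in>W. f v < card K) \<and> (\<forall>x\<in>W. \<forall>y\<in>W. E x y \<longrightarrow> f x \<noteq> f y)"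
  proof (cases "W \<inter> C = {}")
    case True
    let ?full = "\<lambda>b. \<forall>a\<in>?A. E b a"
    \<comment> \<open>This is a split graph: a vertex outside \<open>A\<close> borrows the colour of
      a non-neighbour in \<open>A\<close>, and only those complete to \<open>W \<inter> A\<close>
      need the extra colour; any of them enlarges the clique.\<close>
    define g where "g v = (if v \<in> A then h v else if ?full v then card ?A else h (SOME a. a \<in> ?A \<and> \<not> E v a))" for v
    have some: "(SOME a. a \<in> ?A \<and> \<not> E v a) \<in> ?A" "\<not> E v (SOME a. a \<in> ?A \<and> \<not> E v a)" if "\<not> ?full v" for v
      using someI_ex[of "\<lambda>a. a \<in> ?A \<and> \<not> E v a"] that by blast+
    have gA: "g v = h v" if "v \<in> ?A" for v using that by (simp add: g_def)
    have cross: "g a \<noteq> g b" if "a \<in> ?A" "b \<in> W" "b \<notin> A" "E a b" for a b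
    proof (cases "?full b")
      case True
      then show ?thesis using gA[OF that(1)] hlt[OF that(1)] that by (simp add: g_def)
    next
      case False
      let ?c = "SOME a. a \<in> ?A \<and> \<not> E b a"
      have "a \<noteq> ?c" using some(2)[OF False] E(2)[OF that(4)] by blast
      then have "h a \<noteq> h ?c" using hinj[OF that(1) some(1)[OF False]] by blast
      moreover have "g b = h ?c" unfolding g_def if_not_P[OF that(3)] if_not_P[OF False] ..
      ultimately show ?thesis using gA[OF that(1)] by simp
    qed
    have col: "g x \<noteq> g y" if "x \<in> W" "y \<in> W" "E x y" for x y
    proof -
      have xy: "x \<noteq> y" "E y x" using that E by blast+
      consider "x \<in> A" "y \<in> A" | "x \<in> A" "y \<notin> A" | "x \<notin> A" "y \<in> A" | "x \<notin> A" "y \<notin> A" by blast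
      then show ?thesis
      proof cases
        case 1
        then show ?thesis using hinj[of x y] gA that xy by auto
      next
        case 2
        then show ?thesis using cross[of x y] that by auto
      next
        case 3
        then show ?thesis using cross[of y x] that xy by auto
      next
        case 4
        then have "x \<in> B" "y \<in> B" using that W True by auto
        then show ?thesis using B that(3) unfolding is_stable_def by blast
      qed
    qed
    have lt: "g v < card ?A" if "v \<in> W" "v \<in> A \<or> \<not> ?full v" for v
    proof (cases "v \<in> A")
      case True
      then show ?thesis using hlt[of v] gA[of v] that by auto
    next
      case False
      then show ?thesis using that hlt[OF some(1)[of v]] by (auto simp: g_def)
    qed
    show ?thesis
    proof (cases "\<exists>b\<in>W - A. ?full b")
      case True
      then obtain b where b: "b \<in> W" "b \<notin> A" "?full b" by blast
      have "E b a \<and> E a b" if "a \<in> ?A" for a using b(3) that E(2)[of b a] by blast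
      then have "is_clique E (insert b ?A)" using Acl unfolding is_clique_def by blast
      moreover have c: "card (insert b ?A) = Suc (card ?A)" using b finA by simp
      moreover have "g v < Suc (card ?A)" if "v \<in> W" for v
        using lt[OF that] by (cases "v \<in> A \<or> \<not> ?full v") (auto simp: g_def)
      ultimately show ?thesis using b col by (intro exI[of _ "insert b ?A"] exI[of _ g]) auto
    next
      case False
      then show ?thesis using Acl lt col by (intro exI[of _ ?A] exI[of _ g]) auto
    qed
  next
    case False
    have "W \<inter> C \<subseteq> C" by blast
    then obtain K and f :: "'a \<Rightarrow> nat" where K: "K \<subseteq> W \<inter> C" "is_clique E K" "\<forall>v\<in>W \<inter> C. f v < card K"
      "\<forall>x\<in>W \<inter> C. \<forall>y\<in>W \<inter> C. E x y \<longrightarrow> f x \<noteq> f y" by (rule perfect_onE[OF C(1)])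
    have K0: "card K > 0" using False K(3) by fastforce
    have finK: "finite K" using K0 card_gt_0_iff by blast
    \<comment> \<open>Since \<open>W\<close> meets \<open>C\<close>, colour 0 already exists there.
      It is reused for \<open>B\<close>, which is anticomplete to \<open>C\<close>, while the
      colours of \<open>A\<close> are shifted past those of \<open>C\<close>.\<close>
    define g where "g v = (if v \<in> A then card K + h v else if v \<in> B then 0 else f v)" for v
    have low: "g v < card K" if "v \<in> W" "v \<notin> A" for v
    proof (cases "v \<in> B")
      case False
      then have "v \<in> W \<inter> C" using that W by blast
      then show ?thesis using K(3) False that by (auto simp: g_def)
    qed (use K0 that in \<open>simp add: g_def\<close>)
    have "E a c \<and> E c a" if "a \<in> ?A" "c \<in> K" for a c using that K(1) AC[of a c] E(2)[of a c] by blast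
    then have "is_clique E (?A \<union> K)" using Acl K(2) unfolding is_clique_def by blast
    moreover have "card (?A \<union> K) = card ?A + card K" using finA finK K(1) dis by (intro card_Un_disjoint) auto
    moreover have "g v < card ?A + card K" if "v \<in> W" for v
      using low[OF that] hlt[of v] that by (cases "v \<in> A") (auto simp: g_def)
    moreover have "g x \<noteq> g y" if "x \<in> W" "y \<in> W" "E x y" for x y
    proof -
      have xy: "x \<noteq> y" "E y x" using that E by blast+
      consider "x \<in> A" "y \<in> A" | "x \<in> A" "y \<notin> A" | "x \<notin> A" "y \<in> A" | "x \<notin> A" "y \<notin> A" by blast
      then show ?thesis
      proof cases
        case 1
        then show ?thesis using hinj[of x y] that xy by (auto simp: g_def)
      next
        case 2
        then show ?thesis using low[OF that(2)] by (auto simp: g_def)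
      next
        case 3
        then show ?thesis using low[OF that(1)] by (auto simp: g_def)
      next
        case 4
        then have "x \<in> B \<or> x \<in> C" "y \<in> B \<or> y \<in> C" using that W by auto
        moreover have "\<not> (x \<in> B \<and> y \<in> B)" using B that(3) unfolding is_stable_def by blast
        moreover have "\<not> (x \<in> B \<and> y \<in> C)" "\<not> (y \<in> B \<and> x \<in> C)" using BC that(3) xy by blast+
        ultimately have "x \<in> C" "y \<in> C" "x \<notin> B" "y \<notin> B" using dis by blast+
        then show ?thesis using K(4) that 4 by (auto simp: g_def)
      qed
    qed
    ultimately show ?thesis using K(1) by (intro exI[of _ "?A \<union> K"] exI[of _ g]) auto
  qed
qed

section \<open>Circulant realizations\<close>

lemma even_sum_deg:
  assumes E: "sgraph V E"
  shows "even (\<Sum>v\<in>V. deg E v)"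
proof -
  obtain f :: "'a \<Rightarrow> nat" where f: "inj_on f V" using finite_imp_inj_to_nat_seg[OF sgraphD(1)[OF E]] by blast
  let ?L = "{(u,v). E u v \<and> f u < f v}" and ?G = "{(u,v). E u v \<and> f v < f u}"
  have fin: "finite ?L" "finite ?G"
    by (rule finite_subset[of _ "V \<times> V"]; use sgraphD(1-3)[OF E] in auto)+
  have "(\<Sum>v\<in>V. deg E v) = card (SIGMA v:V. {w. E v w})"
    unfolding deg_def using sgraphD(1,7)[OF E] by simp
  also have "(SIGMA v:V. {w. E v w}) = ?L \<union> ?G"
    using f sgraphD(2,3,5)[OF E] unfolding inj_on_def by (auto simp: linorder_neq_iff) (metis linorder_neqE_nat)+
  also have "card (?L \<union> ?G) = card ?L + card ?G" using fin by (intro card_Un_disjoint) auto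
  also have "card ?G = card ?L"
  proof (rule bij_betw_same_card[of prod.swap])
    show "bij_betw prod.swap ?G ?L"
      by (rule bij_betw_byWitness[where f' = prod.swap]) (use sgraphD(4)[OF E] in auto)
  qed
  finally show ?thesis by simp
qed

text \<open>
  The r-regular circulant bipartite graph on k + k vertices minus a matching of size c.
\<close>

definition circ :: "nat \<Rightarrow> nat \<Rightarrow> nat \<Rightarrow> nat \<Rightarrow> nat \<Rightarrow> bool" where
  "circ k r c i j \<longleftrightarrow> i < k \<and> j < k \<and> (if i \<le> j then j - i else j + k - i) < r \<and> \<not> (i = j \<and> i < c)"

text \<open>For positive \<open>r\<close> the offset 0 is allowed, so the removed diagonal entries
  were present.\<close>

lemma card_circ_row:
  assumes "r \<le> k" "i < k" "c > 0 \<Longrightarrow> r > 0"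
  shows "card {j. circ k r c i j} = r - of_bool (i < c)"
proof -
  let ?f = "\<lambda>j. if i \<le> j then j - i else j + k - i"
  let ?R = "{j. j < k \<and> ?f j < r}"
  have "bij_betw ?f ?R {..<r}"
    by (rule bij_betw_byWitness[where f' = "\<lambda>x. if i + x < k then i + x else i + x - k"])
      (use assms(1,2) in \<open>auto\<close>)
  then have c: "card ?R = r" using bij_betw_same_card by fastforce
  have eq: "{j. circ k r c i j} = (if i < c then ?R - {i} else ?R)"
    using assms(2) by (auto simp: circ_def)
  have "i \<in> ?R" if "i < c" using assms that by auto
  then show ?thesis unfolding eq using c by auto
qed

lemma card_circ_col:
  assumes "r \<le> k" "j < k" "c > 0 \<Longrightarrow> r > 0"
  shows "card {i. circ k r c i j} = r - of_bool (j < c)"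
proof -
  let ?f = "\<lambda>i. if i \<le> j then j - i else j + k - i"
  let ?R = "{i. i < k \<and> ?f i < r}"
  have "bij_betw ?f ?R {..<r}"
    by (rule bij_betw_byWitness[where f' = "\<lambda>x. if x \<le> j then j - x else j + k - x"])
      (use assms(1,2) in \<open>auto\<close>)
  then have c: "card ?R = r" using bij_betw_same_card by fastforce
  have eq: "{i. circ k r c i j} = (if j < c then ?R - {j} else ?R)"
    using assms(2) by (auto simp: circ_def)
  have "j \<in> ?R" if "j < c" using assms that by auto
  then show ?thesis unfolding eq using c by auto
qed

text \<open>\<open>SpecialV\<close> stands for the vertex of exceptional degree;
  \<open>ExtraV\<close> is the unpaired vertex when the others are odd in number.\<close>

datatype slot = LeftV nat | RightV nat | ExtraV | SpecialV

fun half :: "(nat \<Rightarrow> nat \<Rightarrow> bool) \<Rightarrow> nat set \<Rightarrow> nat set \<Rightarrow> nat set \<Rightarrow> nat set \<Rightarrow> bool \<Rightarrow> slot \<Rightarrow> slot \<Rightarrow> bool" where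
  "half B PX QX PY QY b (LeftV i) (RightV j) = B i j"
| "half B PX QX PY QY b (LeftV i) ExtraV = (i \<in> PX)"
| "half B PX QX PY QY b (RightV i) ExtraV = (i \<in> QX)"
| "half B PX QX PY QY b (LeftV i) SpecialV = (i \<in> PY)"
| "half B PX QX PY QY b (RightV i) SpecialV = (i \<in> QY)"
| "half B PX QX PY QY b ExtraV SpecialV = b"
| "half B PX QX PY QY b _ _ = False"

text \<open>\<open>PX\<close> and \<open>QX\<close> are the left and right neighbours of
  \<open>ExtraV\<close>, \<open>PY\<close> and \<open>QY\<close> those of \<open>SpecialV\<close>;
  \<open>b\<close> tells whether these two are adjacent.\<close>

definition model :: "(nat \<Rightarrow> nat \<Rightarrow> bool) \<Rightarrow> nat set \<Rightarrow> nat set \<Rightarrow> nat set \<Rightarrow> nat set \<Rightarrow> bool \<Rightarrow> slot \<Rightarrow> slot \<Rightarrow> bool" where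
  "model B PX QX PY QY b x y \<longleftrightarrow> half B PX QX PY QY b x y \<or> half B PX QX PY QY b y x"

lemma model_simps:
  "model B PX QX PY QY b (LeftV i) (LeftV j) \<longleftrightarrow> False"
  "model B PX QX PY QY b (RightV i) (RightV j) \<longleftrightarrow> False"
  "model B PX QX PY QY b (LeftV i) (RightV j) \<longleftrightarrow> B i j"
  "model B PX QX PY QY b (RightV j) (LeftV i) \<longleftrightarrow> B i j"
  "model B PX QX PY QY b (LeftV i) ExtraV \<longleftrightarrow> i \<in> PX"
  "model B PX QX PY QY b ExtraV (LeftV i) \<longleftrightarrow> i \<in> PX"
  "model B PX QX PY QY b (RightV i) ExtraV \<longleftrightarrow> i \<in> QX"
  "model B PX QX PY QY b ExtraV (RightV i) \<longleftrightarrow> i \<in> QX"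
  "model B PX QX PY QY b (LeftV i) SpecialV \<longleftrightarrow> i \<in> PY"
  "model B PX QX PY QY b SpecialV (LeftV i) \<longleftrightarrow> i \<in> PY"
  "model B PX QX PY QY b (RightV i) SpecialV \<longleftrightarrow> i \<in> QY"
  "model B PX QX PY QY b SpecialV (RightV i) \<longleftrightarrow> i \<in> QY"
  "model B PX QX PY QY b ExtraV SpecialV \<longleftrightarrow> b" "model B PX QX PY QY b SpecialV ExtraV \<longleftrightarrow> b"
  "model B PX QX PY QY b ExtraV ExtraV \<longleftrightarrow> False" "model B PX QX PY QY b SpecialV SpecialV \<longleftrightarrow> False"
  by (auto simp: model_def)

lemma deg_model:
  assumes "finite PX" "finite QX" "finite PY" "finite QY"
    "\<And>i. finite {j. B i j}" "\<And>j. finite {i. B i j}"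
  shows "deg (model B PX QX PY QY b) (LeftV i) = card {j. B i j} + of_bool (i \<in> PX) + of_bool (i \<in> PY)"
    "deg (model B PX QX PY QY b) (RightV j) = card {i. B i j} + of_bool (j \<in> QX) + of_bool (j \<in> QY)"
    "deg (model B PX QX PY QY b) ExtraV = card PX + card QX + of_bool b"
    "deg (model B PX QX PY QY b) SpecialV = card PY + card QY + of_bool b"
proof -
  let ?M = "model B PX QX PY QY b"
  have *: "{w. p w} = LeftV ` {i. p (LeftV i)} \<union> RightV ` {i. p (RightV i)} \<union> (if p ExtraV then {ExtraV} else {}) \<union> (if p SpecialV then {SpecialV} else {})" for p
  proof (intro set_eqI)
    fix w show "w \<in> {w. p w} \<longleftrightarrow> w \<in> LeftV ` {i. p (LeftV i)} \<union> RightV ` {i. p (RightV i)} \<union> (if p ExtraV then {ExtraV} else {}) \<union> (if p SpecialV then {SpecialV} else {})"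
      by (cases w) auto
  qed
  have c: "card {w. p w} = card {i. p (LeftV i)} + card {i. p (RightV i)} + of_bool (p ExtraV) + of_bool (p SpecialV)"
    if "finite {i. p (LeftV i)}" "finite {i. p (RightV i)}" for p
  proof -
    have "card (LeftV ` {i. p (LeftV i)} \<union> RightV ` {i. p (RightV i)}) = card {i. p (LeftV i)} + card {i. p (RightV i)}"
      using that by (subst card_Un_disjoint) (auto simp: card_image inj_on_def)
    moreover have "card (LeftV ` {i. p (LeftV i)} \<union> RightV ` {i. p (RightV i)} \<union> (if p ExtraV then {ExtraV} else {}))
      = card (LeftV ` {i. p (LeftV i)} \<union> RightV ` {i. p (RightV i)}) + of_bool (p ExtraV)"
      using that by (subst card_Un_disjoint) auto
    moreover have "card (LeftV ` {i. p (LeftV i)} \<union> RightV ` {i. p (RightV i)} \<union> (if p ExtraV then {ExtraV} else {}) \<union> (if p SpecialV then {SpecialV} else {}))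
      = card (LeftV ` {i. p (LeftV i)} \<union> RightV ` {i. p (RightV i)} \<union> (if p ExtraV then {ExtraV} else {})) + of_bool (p SpecialV)"
      using that by (subst card_Un_disjoint) auto
    ultimately show ?thesis by (subst *) simp
  qed
  show "deg ?M (LeftV i) = card {j. B i j} + of_bool (i \<in> PX) + of_bool (i \<in> PY)"
    unfolding deg_def using assms c[of "?M (LeftV i)"] by (simp add: model_simps)
  show "deg ?M (RightV j) = card {i. B i j} + of_bool (j \<in> QX) + of_bool (j \<in> QY)"
    unfolding deg_def using assms c[of "?M (RightV j)"] by (simp add: model_simps)
  show "deg ?M ExtraV = card PX + card QX + of_bool b"
    unfolding deg_def using assms c[of "?M ExtraV"] by (simp add: model_simps)
  show "deg ?M SpecialV = card PY + card QY + of_bool b"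
    unfolding deg_def using assms c[of "?M SpecialV"] by (simp add: model_simps)
qed

lemma iso_to_realization:
  assumes u: "unigraph_on C E" and S: "sgraph S F" and card: "card C = card S"
    and y: "y \<in> C" "z \<in> S" "deg E y = deg F z"
    and t: "\<And>v. v \<in> C \<Longrightarrow> v \<noteq> y \<Longrightarrow> deg E v = t" "\<And>x. x \<in> S \<Longrightarrow> x \<noteq> z \<Longrightarrow> deg F x = t"
  obtains h where "bij_betw h C S" "\<And>a b. a \<in> C \<Longrightarrow> b \<in> C \<Longrightarrow> E a b \<longleftrightarrow> F (h a) (h b)"
proof -
  note E = unigraph_onD[OF u]
  have fC: "finite C" and fS: "finite S" using sgraphD(1) E S by auto
  have "card (C - {y}) = card (S - {z})" using card y fC fS by simp
  then obtain g where g: "bij_betw g (C - {y}) (S - {z})"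
    using finite_same_card_bij[of "C - {y}" "S - {z}"] fC fS by auto
  define \<phi> where "\<phi> = g(y := z)"
  have phi: "bij_betw \<phi> C S"
  proof -
    have "bij_betw \<phi> (C - {y}) (S - {z})" using g by (subst bij_betw_cong[of _ _ g]) (auto simp: \<phi>_def)
    moreover have "bij_betw \<phi> {y} {z}" by (simp add: \<phi>_def bij_betw_def)
    ultimately have "bij_betw \<phi> ((C - {y}) \<union> {y}) ((S - {z}) \<union> {z})" by (rule bij_betw_combine) simp
    moreover have "(C - {y}) \<union> {y} = C" "(S - {z}) \<union> {z} = S" using y by auto
    ultimately show ?thesis by simp
  qed
  have phiS: "\<phi> v \<in> S" if "v \<in> C" for v using bij_betwE[OF phi] that by blast
  have phiz: "\<phi> v \<noteq> z" if "v \<in> C" "v \<noteq> y" for v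
    using phi that y unfolding bij_betw_def inj_on_def by (metis \<phi>_def fun_upd_same)
  define E' where "E' a b \<longleftrightarrow> a \<in> C \<and> b \<in> C \<and> F (\<phi> a) (\<phi> b)" for a b
  have sE': "sgraph C E'"
    using fC sgraphD(4,5)[OF S] unfolding sgraph_def E'_def by blast
  have iso: "\<forall>a\<in>C. \<forall>b\<in>C. E' a b \<longleftrightarrow> F (\<phi> a) (\<phi> b)" by (simp add: E'_def)
  have "deg E' v = deg E v" for v
  proof (cases "v \<in> C")
    case True
    have "deg E' v = deg F (\<phi> v)" using iso_deg[OF S sE' phi iso True] by simp
    also have "\<dots> = deg E v"
    proof (cases "v = y")
      case False
      then show ?thesis using t(1)[OF True False] t(2)[OF phiS[OF True] phiz[OF True False]] by simp
    qed (simp add: \<phi>_def y(3))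
    finally show ?thesis .
  qed (simp add: deg_outside[OF E] deg_outside[OF sE'])
  with sE' have "realizes C E E'" by (simp add: realizes_def)
  then obtain f where f: "bij_betw f C C" "\<forall>a\<in>C. \<forall>b\<in>C. E' a b \<longleftrightarrow> E (f a) (f b)"
    using u unfolding unigraph_on_def by blast
  let ?i = "the_inv_into C f"
  have i: "bij_betw ?i C C" using f(1) by (rule bij_betw_the_inv_into)
  have fi: "f (?i a) = a" if "a \<in> C" for a
    using f(1) that by (auto simp: bij_betw_def intro!: f_the_inv_into_f)
  have iC: "?i a \<in> C" if "a \<in> C" for a using bij_betwE[OF i] that by blast
  show thesis
  proof (rule that)
    show "bij_betw (\<phi> \<circ> ?i) C S" using i phi by (rule bij_betw_trans)
    fix a b assume ab: "a \<in> C" "b \<in> C"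
    have "E a b \<longleftrightarrow> E' (?i a) (?i b)" using f(2) iC[OF ab(1)] iC[OF ab(2)] fi ab by simp
    then show "E a b \<longleftrightarrow> F ((\<phi> \<circ> ?i) a) ((\<phi> \<circ> ?i) b)" using iso iC ab by simp
  qed
qed

lemma perfect_on_transfer:
  assumes h: "bij_betw h C S" "\<And>a b. a \<in> C \<Longrightarrow> b \<in> C \<Longrightarrow> E a b \<longleftrightarrow> F (h a) (h b)"
    and z: "z \<in> S" "perfect_on (S - {z}) F" "perfect_on (S - {z}) (compl_on S F)"
  obtains v where "v \<in> C" "perfect_on (C - {v}) E" "perfect_on (C - {v}) (compl_on C E)"
proof -
  obtain v where v: "v \<in> C" "h v = z" using h(1) z(1) by (auto simp: bij_betw_def)
  have inj: "h a = h b \<longleftrightarrow> a = b" if "a \<in> C" "b \<in> C" for a b using h(1) that by (auto simp: bij_betw_def inj_on_def)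
  have hS: "h a \<in> S" if "a \<in> C" for a using bij_betwE[OF h(1)] that by blast
  have b: "bij_betw h (C - {v}) (S - {z})"
    using h(1) v by (metis bij_betw_DiffI bij_betw_singletonI empty_subsetI insert_subset singletonD z(1))
  show thesis
  proof (rule that[OF v(1)])
    show "perfect_on (C - {v}) E" by (rule perfect_on_iso[OF z(2) b]) (use h(2) in auto)
    show "perfect_on (C - {v}) (compl_on C E)"
      by (rule perfect_on_iso[OF z(3) b]) (use h(2) inj hS in \<open>auto simp: compl_on_def\<close>)
  qed
qed

lemma co_stable: "is_stable E A \<Longrightarrow> A \<subseteq> S \<Longrightarrow> is_clique (compl_on S E) A"
  unfolding is_stable_def is_clique_def compl_on_def by blast

lemma perfect_on_bip_both:
  assumes S: "sgraph S E" and W: "W \<subseteq> S" "W = A \<union> B" "A \<inter> B = {}" "is_stable E A" "is_stable E B"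
  shows "perfect_on W E" "perfect_on W (compl_on S E)"
proof -
  have fin: "finite W" using W(1) sgraphD(1)[OF S] by (rule finite_subset)
  note S' = sgraph_co[OF sgraphD(1)[OF S] S]
  show "perfect_on W E" by (rule perfect_on_bip[OF fin W(2,4,5) sgraphD(5)[OF S] sgraphD(4)[OF S]])
  have "is_clique (compl_on S E) A" "is_clique (compl_on S E) B" using co_stable W by auto
  then show "perfect_on W (compl_on S E)"
    by (rule perfect_on_cobip[OF fin W(2,3) _ _ sgraphD(5)[OF S'] sgraphD(4)[OF S']])
qed

text \<open>In the complement y sees only vertices of \<open>A\<close>, which form a clique there,
  so y is simplicial over a cobipartite graph.\<close>

lemma perfect_on_bip_plus_both:
  assumes S: "sgraph S E" and W: "W \<subseteq> S" "W = insert y (A \<union> B)" "y \<notin> A \<union> B" "A \<inter> B = {}"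
    "is_stable E A" "is_stable E B" "\<And>b. b \<in> B \<Longrightarrow> E y b"
  shows "perfect_on W E" "perfect_on W (compl_on S E)"
proof -
  have fin: "finite W" using W(1) sgraphD(1)[OF S] by (rule finite_subset)
  note S' = sgraph_co[OF sgraphD(1)[OF S] S]
  show "perfect_on W E" by (rule perfect_on_bip_plus[OF fin W(2,3,5,6,7) sgraphD(5)[OF S] sgraphD(4)[OF S]])
  have "perfect_on (A \<union> B) (compl_on S E)"
    by (rule perfect_on_bip_both(2)[OF S _ refl W(4-6)]) (use W in auto)
  moreover have "is_clique (compl_on S E) A" using co_stable W by auto
  then have "is_clique (compl_on S E) {v \<in> A \<union> B. compl_on S E y v}"
    using W(7) unfolding is_clique_def compl_on_def by blast
  ultimately show "perfect_on W (compl_on S E)"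
    unfolding W(2) using fin W(2,3)
    by (intro perfect_on_simplicial[OF _ _ _ _ sgraphD(5)[OF S'] sgraphD(4)[OF S']]) auto
qed

definition slots :: "nat \<Rightarrow> bool \<Rightarrow> slot set" where
  "slots k hasX = LeftV ` {..<k} \<union> RightV ` {..<k} \<union> {SpecialV} \<union> (if hasX then {ExtraV} else {})"

lemma apex_circulant:
  fixes k r c t :: nat and PX QX PY QY :: "nat set" and b hasX :: bool and E :: "'a \<Rightarrow> 'a \<Rightarrow> bool" and z :: slot
  defines "S \<equiv> slots k hasX" and "F \<equiv> model (circ k r c) PX QX PY QY b"
  assumes u: "unigraph_on C E" and y: "y \<in> C" and t: "\<And>v. v \<in> C \<Longrightarrow> v \<noteq> y \<Longrightarrow> deg E v = t"
    and z: "z \<in> S" and pf: "sgraph S F \<Longrightarrow> perfect_on (S - {z}) F \<and> perfect_on (S - {z}) (compl_on S F)"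
    and r: "r \<le> k" "c > 0 \<Longrightarrow> r > 0" and sub: "PX \<subseteq> {..<k}" "QX \<subseteq> {..<k}" "PY \<subseteq> {..<k}" "QY \<subseteq> {..<k}"
    and noX: "\<not> hasX \<Longrightarrow> PX = {} \<and> QX = {} \<and> \<not> b" and card: "card C = 2 * k + 1 + of_bool hasX"
    and dP: "\<And>i. i < k \<Longrightarrow> r - of_bool (i < c) + of_bool (i \<in> PX) + of_bool (i \<in> PY) = t"
    and dQ: "\<And>i. i < k \<Longrightarrow> r - of_bool (i < c) + of_bool (i \<in> QX) + of_bool (i \<in> QY) = t"
    and dX: "hasX \<Longrightarrow> card PX + card QX + of_bool b = t"
    and dY: "card PY + card QY + of_bool b = deg E y"
  shows "\<exists>v\<in>C. perfect_on (C - {v}) E \<and> perfect_on (C - {v}) (compl_on C E)"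
proof -
  have fin: "finite PX" "finite QX" "finite PY" "finite QY"
    using sub finite_subset[OF _ finite_lessThan] by auto
  have finc: "finite {j. circ k r c i j}" "finite {i. circ k r c i j}" for i j
    by (rule finite_subset[of _ "{..<k}"]; force simp: circ_def)+
  note dg = deg_model[OF fin, of "circ k r c", OF finc, of b, folded F_def]
  have sg: "sgraph S F"
  proof -
    have "F v w \<Longrightarrow> v \<in> S \<and> w \<in> S" for v w
      using sub noX unfolding S_def slots_def F_def
      by (cases v; cases w) (auto simp: model_simps circ_def)
    moreover have "\<not> F v v" for v unfolding F_def by (cases v) (auto simp: model_simps)
    moreover have "F v w \<Longrightarrow> F w v" for v w unfolding F_def model_def by blast
    moreover have "finite S" by (auto simp: S_def slots_def)
    ultimately show ?thesis unfolding sgraph_def by metis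
  qed
  have "card S = 2 * k + 1 + of_bool hasX"
  proof -
    have "card (LeftV ` {..<k} \<union> RightV ` {..<k}) = 2 * k"
      by (subst card_Un_disjoint) (auto simp: card_image inj_on_def)
    moreover have "card (LeftV ` {..<k} \<union> RightV ` {..<k} \<union> {SpecialV}) = card (LeftV ` {..<k} \<union> RightV ` {..<k}) + 1"
      by (subst card_Un_disjoint) auto
    moreover have "card S = card (LeftV ` {..<k} \<union> RightV ` {..<k} \<union> {SpecialV}) + of_bool hasX"
      unfolding S_def slots_def by (subst card_Un_disjoint) auto
    ultimately show ?thesis by simp
  qed
  then have cS: "card C = card S" using card by simp
  have dS: "deg F x = t" if "x \<in> S" "x \<noteq> SpecialV" for x
  proof (cases x)
    case (LeftV i)
    then have "i < k" using that by (auto simp: S_def slots_def split: if_splits)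
    then show ?thesis using LeftV dg(1)[of i] dP[of i] card_circ_row[OF r(1) _ r(2)] by simp
  next
    case (RightV i)
    then have "i < k" using that by (auto simp: S_def slots_def split: if_splits)
    then show ?thesis using RightV dg(2)[of i] dQ[of i] card_circ_col[OF r(1) _ r(2)] by simp
  next
    case ExtraV
    then have hasX using that by (auto simp: S_def slots_def split: if_splits)
    then show ?thesis using ExtraV dg(3) dX by simp
  qed (use that in simp)
  have YS: "SpecialV \<in> S" by (simp add: S_def slots_def)
  have "deg E y = deg F SpecialV" using dg(4) dY by simp
  then obtain h where h: "bij_betw h C S" "\<And>a b. a \<in> C \<Longrightarrow> b \<in> C \<Longrightarrow> E a b \<longleftrightarrow> F (h a) (h b)"
    using iso_to_realization[OF u sg cS y YS _ t dS] by blast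
  show ?thesis using perfect_on_transfer[where h = h and C = C and S = S and E = E and F = F, OF h z] pf[OF sg] by blast
qed

text \<open>
  A graph in which all vertices but y have degree t is realized by a circulant bipartite
  graph, minus a matching whose ends are joined to y, or to y and one further vertex when
  the number of the other vertices is odd. Deleting one of these two leaves a graph whose
  perfection, and that of its complement, is elementary.
\<close>

lemma near_regular_sparse:
  assumes u: "unigraph_on C E" and y: "y \<in> C" and t: "\<And>v. v \<in> C \<Longrightarrow> v \<noteq> y \<Longrightarrow> deg E v = t"
    and half: "t \<le> (card C - 1) div 2"
  shows "\<exists>v\<in>C. perfect_on (C - {v}) E \<and> perfect_on (C - {v}) (compl_on C E)"
proof -
  note E = unigraph_onD[OF u]
  have fC: "finite C" by (rule sgraphD(1)[OF E])
  define g where "g = deg E y"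
  define k where "k = (card C - 1) div 2"
  have tk: "t \<le> k" using half by (simp add: k_def)
  have cpos: "card C > 0" using y fC card_gt_0_iff by blast
  have gle: "g + 1 \<le> card C" using deg_co[OF E y] by (simp add: g_def)
  have "(\<Sum>v\<in>C. deg E v) = deg E y + (\<Sum>v\<in>C - {y}. deg E v)" using fC y by (rule sum.remove)
  also have "(\<Sum>v\<in>C - {y}. deg E v) = (card C - 1) * t" using t y fC by simp
  finally have ev: "even (g + (card C - 1) * t)" using even_sum_deg[OF E] by (simp add: g_def)
  \<comment> \<open>A matching can only be removed if t is positive. A neighbour of y has degree t,
    so this holds whenever y has an edge.\<close>
  have tpos: "t > 0" if "g > 0"
  proof -
    have "{w. E y w} \<noteq> {}" using that unfolding g_def deg_def by (metis card.empty less_irrefl)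
    then obtain w where w: "E y w" by blast
    then have "w \<in> C" "w \<noteq> y" "y \<in> {x. E w x}" using sgraphD(3-5)[OF E] by blast+
    moreover have "card {x. E w x} > 0" using calculation(3) sgraphD(7)[OF E, of w] by (auto simp: card_gt_0_iff)
    ultimately show ?thesis using t[of w] unfolding deg_def by simp
  qed
  let ?P = "LeftV ` {..<k}" and ?Q = "RightV ` {..<k}"
  consider (even) "card C = 2 * k + 1" | (odd) "card C = 2 * k + 2"
    using cpos unfolding k_def by linarith
  then show ?thesis
  proof cases
    case even
    have "even g" using ev even by simp
    \<comment> \<open>All \<open>2 * c\<close> ends of the removed matching are joined to the
      special vertex. Its degree is even by the handshake lemma.\<close>
    define c where "c = g div 2"
    have c: "c + c = g" "c \<le> k" using \<open>even g\<close> gle even by (auto simp: c_def)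
    have c0: "0 < t" if "0 < c" using tpos that by (auto simp: c_def)
    have pf: "perfect_on (slots k False - {SpecialV}) F \<and> perfect_on (slots k False - {SpecialV}) (compl_on (slots k False) F)"
      if "sgraph (slots k False) F" "F = model B {} {} PY QY b" for F B PY QY b
    proof -
      have SpecialV: "slots k False - {SpecialV} = ?P \<union> ?Q" by (auto simp: slots_def)
      have "is_stable F ?P" "is_stable F ?Q" unfolding that(2) is_stable_def by (auto simp: model_simps)
      then show ?thesis using perfect_on_bip_both[OF that(1) _ SpecialV] by auto
    qed
    show ?thesis
      by (rule apex_circulant[where k = k and r = t and c = c and PX = "{}" and QX = "{}"
            and PY = "{..<c}" and QY = "{..<c}" and b = False and hasX = False and z = SpecialV, OF u y t])
        (use pf[OF _ refl] c c0 tk even in \<open>auto simp: slots_def g_def\<close>)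
  next
    case odd
    have par: "even (g + t)" using ev odd by (cases "even t") auto
    show ?thesis
    proof (cases "g \<le> t")
      case gt: True
      \<comment> \<open>The left ends of a matching of size i and the first j right ends go to the
        extra vertex, the other i - j right ends to the special one. This requires i + j = t and i -
        j = g. Without the extra vertex the graph is bipartite.\<close>
      define i where "i = (t + g) div 2"
      define j where "j = (t - g) div 2"
      have ij: "i + j = t" "i = j + g" using par gt unfolding i_def j_def by presburger+
      have pf: "perfect_on (slots k True - {ExtraV}) F \<and> perfect_on (slots k True - {ExtraV}) (compl_on (slots k True) F)"
        if "sgraph (slots k True) F" "F = model B PX QX {} QY b" for F B PX QX QY b
      proof -
        have SpecialV: "slots k True - {ExtraV} = insert SpecialV ?P \<union> ?Q" by (auto simp: slots_def)
        have "is_stable F (insert SpecialV ?P)" "is_stable F ?Q" unfolding that(2) is_stable_def by (auto simp: model_simps)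
        then show ?thesis using perfect_on_bip_both[OF that(1) _ SpecialV] by auto
      qed
      show ?thesis
        by (rule apex_circulant[where k = k and r = t and c = i and PX = "{..<i}" and QX = "{..<j}"
              and PY = "{}" and QY = "{j..<i}" and b = False and hasX = True and z = ExtraV, OF u y t])
          (use pf[OF _ refl] ij tk odd in \<open>auto simp: slots_def g_def\<close>)
    next
      case gt: False
      then have t0: "t > 0" using tpos by simp
      show ?thesis
      proof (cases "g + t \<le> 2 * k")
        case True
        \<comment> \<open>The matching has size t + a: all right ends and a left ends go to the
          special vertex, the other t left ends to the extra one. Thus g = t + 2a, and g + t at most
          2k makes the matching fit.\<close>
        define a where "a = (g - t) div 2"
        have a: "g = t + 2 * a" "t + a \<le> k" using par gt True unfolding a_def by presburger+
        have pf: "perfect_on (slots k True - {SpecialV}) F \<and> perfect_on (slots k True - {SpecialV}) (compl_on (slots k True) F)"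
          if "sgraph (slots k True) F" "F = model B PX {} PY QY b" for F B PX PY QY b
        proof -
          have SpecialV: "slots k True - {SpecialV} = ?P \<union> insert ExtraV ?Q" by (auto simp: slots_def)
          have "is_stable F ?P" "is_stable F (insert ExtraV ?Q)" unfolding that(2) is_stable_def by (auto simp: model_simps)
          then show ?thesis using perfect_on_bip_both[OF that(1) _ SpecialV] by auto
        qed
        show ?thesis
          by (rule apex_circulant[where k = k and r = t and c = "t + a" and PX = "{..<t}" and QX = "{}"
                and PY = "{t..<t+a}" and QY = "{..<t+a}" and b = False and hasX = True and z = SpecialV, OF u y t])
            (use pf[OF _ refl] a t0 tk odd in \<open>auto simp: slots_def g_def\<close>)
      next
        case False
        \<comment> \<open>l is the number of vertices missed by the special vertex. As l is small,
          start from degree t - 1, join the special vertex to everything except l left vertices, and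
          let the extra vertex serve these; j further vertices on each side are served as well and
          lose a matching edge in return.\<close>
        define l where "l = 2 * k + 1 - g"
        have l1: "l + g = 2 * k + 1" using gle odd unfolding l_def by simp
        then have "odd (l + g)" by simp
        then have par': "odd (l + t)" using par by auto
        then have l: "l + g = 2 * k + 1" "l + 1 \<le> t"
        proof -
          have "l \<noteq> t" using par' by auto
          then show "l + 1 \<le> t" using l1 False by linarith
        qed (rule l1)
        obtain i where i: "l + t = 2 * i + 1" using par' by (rule oddE)
        define j where "j = i - l"
        have ij: "i + j + 1 = t" "i = j + l" using l(2) i unfolding j_def by linarith+
        have pf: "perfect_on (slots k True - {ExtraV}) F \<and> perfect_on (slots k True - {ExtraV}) (compl_on (slots k True) F)"
          if "sgraph (slots k True) F" "F = model B PX QX PY {..<k} b" for F B PX QX PY b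
        proof -
          have SpecialV: "slots k True - {ExtraV} = insert SpecialV (?P \<union> ?Q)" by (auto simp: slots_def)
          have "is_stable F ?P" "is_stable F ?Q" "\<And>b. b \<in> ?Q \<Longrightarrow> F SpecialV b"
            unfolding that(2) is_stable_def by (auto simp: model_simps)
          then show ?thesis using perfect_on_bip_plus_both[OF that(1) _ SpecialV] by auto
        qed
        have cPY: "card ({..<k} - {j..<i}) = k - l"
          using ij tk by (subst card_Diff_subset) auto
        show ?thesis
          by (rule apex_circulant[where k = k and r = "t - 1" and c = j and PX = "{..<i}" and QX = "{..<j}"
                and PY = "{..<k} - {j..<i}" and QY = "{..<k}" and b = True and hasX = True and z = ExtraV, OF u y t])
            (use pf[OF _ refl] ij l tk odd cPY in \<open>auto simp: slots_def g_def\<close>)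
      qed
    qed
  qed
qed

text \<open>If t exceeds half of the available range, the complement is sparse; the sparse case was
  proved for both a graph and its complement so that it can be read backwards here.\<close>

lemma near_regular:
  assumes u: "unigraph_on C E" and y: "y \<in> C" and t: "\<And>v. v \<in> C \<Longrightarrow> v \<noteq> y \<Longrightarrow> deg E v = t"
  shows "\<exists>v\<in>C. perfect_on (C - {v}) E"
proof (cases "t \<le> (card C - 1) div 2")
  case True
  then show ?thesis using near_regular_sparse[OF u y t] by blast
next
  case False
  note E = unigraph_onD[OF u]
  have t': "deg (compl_on C E) v = card C - 1 - t" if "v \<in> C" "v \<noteq> y" for v
    using deg_co[OF E that(1)] t[OF that] by simp
  have "card C - 1 - t \<le> (card C - 1) div 2" using False by linarith
  then show ?thesis
    using near_regular_sparse[OF unigraph_on_co[OF u] y t'] co_co[OF E] by auto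
qed

section \<open>Apex-perfection of unigraphs\<close>

theorem unigraph_on_apex_perf:
  assumes u: "unigraph_on V E" and ne: "V \<noteq> {}"
  shows "\<exists>v\<in>V. perfect_on (V - {v}) E"
proof -
  note E = unigraph_onD[OF u] note S = sgraphD(4,5)[OF E] and fV = sgraphD(1)[OF E]
  show ?thesis
  proof (cases "\<exists>t. mixed V E t")
    case False
    obtain A where A: "A \<subseteq> V" "is_clique E A" "is_stable E (V - A)" using no_mixed_split[OF u False] .
    have e: "perfect_on {} E" unfolding perfect_on_def is_clique_def by auto
    have "perfect_on V E"
      by (rule perfect_on_split_join[OF _ A(2) finite_subset[OF A(1) fV] A(3) e finite.emptyI _ _ _ _ _ S(2,1)]) auto
    then show ?thesis using ne perfect_on_subset[of V E] by blast
  next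
    case True
    then obtain t where "mixed V E t" by blast
    then obtain C y k where C: "C \<subseteq> V" "y \<in> C" "\<And>v x. v \<in> C \<Longrightarrow> x \<in> V \<Longrightarrow> deg E x = deg E v \<Longrightarrow> x \<in> C"
      "\<And>v. v \<in> C \<Longrightarrow> v \<noteq> y \<Longrightarrow> card {x \<in> C. E v x} = k"
      "\<And>x. x \<in> V - C \<Longrightarrow> (\<forall>v\<in>C. E x v) \<or> (\<forall>v\<in>C. \<not> E x v)"
      "is_clique E {x \<in> V - C. \<forall>v\<in>C. E x v}" "is_stable E {x \<in> V - C. \<forall>v\<in>C. \<not> E x v}"
      by (rule mixed_core[OF u]) blast
    let ?G = "\<lambda>x v. x \<in> C \<and> v \<in> C \<and> E x v" and ?A = "{x \<in> V - C. \<forall>v\<in>C. E x v}" and ?B = "{x \<in> V - C. \<forall>v\<in>C. \<not> E x v}"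
    have uG: "unigraph_on C ?G" by (rule unigraph_on_restrict[OF u C(1)]) (rule C(3))
    have dG: "deg ?G v = k" if "v \<in> C" "v \<noteq> y" for v
      using C(4)[OF that] that unfolding deg_def by simp
    have "\<exists>v\<in>C. perfect_on (C - {v}) ?G" by (rule near_regular[OF uG C(2)]) (rule dG)
    then obtain v where v: "v \<in> C" "perfect_on (C - {v}) ?G" by (elim bexE)
    have "perfect_on (C - {v}) E"
      by (rule perfect_on_iso[OF v(2) bij_betw_id]) auto
    moreover have "V - {v} \<subseteq> ?A \<union> ?B \<union> (C - {v})" using C(5) by blast
    moreover have "?A \<inter> ?B = {}" "?A \<inter> (C - {v}) = {}" "?B \<inter> (C - {v}) = {}" using C(2) by blast+
    moreover have "finite ?A" "finite (C - {v})" using fV finite_subset[OF C(1) fV] by auto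
    ultimately have "perfect_on (V - {v}) E"
      by (intro perfect_on_split_join[of "V - {v}" ?A ?B "C - {v}" E, OF _ C(6) _ C(7)]) (use S in blast)+
    then show ?thesis using v C(1) by blast
  qed
qed

section \<open>Translation from digraphs to adjacency relations\<close>

abbreviation adj :: "('a,'b) pre_digraph \<Rightarrow> 'a \<Rightarrow> 'a \<Rightarrow> bool" where
  "adj G \<equiv> \<lambda>u v. u \<rightarrow>\<^bsub>G\<^esub> v"

lemma adj_conv: "adj G u v \<longleftrightarrow> (\<exists>e\<in>arcs G. tail G e = u \<and> head G e = v)"
  by (auto simp: arcs_ends_conv)

lemma sgraph_adj:
  assumes "graph G"
  shows "sgraph (verts G) (adj G)"
proof -
  interpret graph G by fact
  show ?thesis unfolding sgraph_def
    using adj_in_verts adj_not_same arcs_ends_symmetric[OF sym_arcs] finite_verts by blast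
qed

lemma deg_adj:
  assumes "graph G"
  shows "deg (adj G) v = out_degree G v"
proof -
  interpret graph G by fact
  have "{w. adj G v w} = head G ` out_arcs G v"
    by (auto simp: adj_conv out_arcs_def)
  moreover have "inj_on (head G) (out_arcs G v)"
    by (rule inj_onI) (auto simp: out_arcs_def arc_to_ends_def intro: no_multi_arcs)
  ultimately show ?thesis by (simp add: deg_def out_degree_def card_image)
qed

lemma digraph_iso_adj:
  assumes "digraph_iso G H"
  obtains f where "bij_betw f (verts G) (verts H)"
    "\<And>u v. u \<in> verts G \<Longrightarrow> v \<in> verts G \<Longrightarrow> adj G u v \<longleftrightarrow> adj H (f u) (f v)"
proof -
  obtain i where i: "pre_digraph.digraph_isomorphism G i" "H = app_iso i G"
    using assms by (auto simp: digraph_iso_def)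
  then interpret wf_digraph G by (simp add: pre_digraph.digraph_isomorphism_def)
  let ?f = "iso_verts i"
  have inj: "inj_on ?f (verts G)" and ends: "\<And>a. a \<in> arcs G \<Longrightarrow> iso_tail i (iso_arcs i a) = ?f (tail G a)"
    "\<And>a. a \<in> arcs G \<Longrightarrow> iso_head i (iso_arcs i a) = ?f (head G a)"
    using i(1) by (auto simp: pre_digraph.digraph_isomorphism_def)
  show thesis
  proof (rule that[of ?f])
    show "bij_betw ?f (verts G) (verts H)" using inj i(2) by (simp add: bij_betw_def)
    fix u v assume uv: "u \<in> verts G" "v \<in> verts G"
    have "adj H (?f u) (?f v) \<longleftrightarrow> (\<exists>a\<in>arcs G. ?f (tail G a) = ?f u \<and> ?f (head G a) = ?f v)"
      unfolding adj_conv i(2) using ends by auto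
    also have "\<dots> \<longleftrightarrow> (\<exists>a\<in>arcs G. tail G a = u \<and> head G a = v)"
      using inj_on_eq_iff[OF inj] uv by (metis tail_in_verts head_in_verts)
    finally show "adj G u v \<longleftrightarrow> adj H (?f u) (?f v)" by (simp add: adj_conv)
  qed
qed

text \<open>A competing relation is encoded with vertex pairs as arcs. This arc type may differ from
  that of \<open>U\<close>, hence the appeal to \<open>unigraph_iso_any_type\<close>.\<close>

lemma unigraph_uni:
  fixes U :: "('c,'d) pre_digraph"
  assumes "unigraph U"
  shows "unigraph_on (verts U) (adj U)"
  unfolding unigraph_on_def
proof (intro conjI allI impI)
  have gU: "graph U" using assms by (simp add: unigraph_def)
  show "sgraph (verts U) (adj U)" by (rule sgraph_adj[OF gU])
  fix E' assume E': "realizes (verts U) (adj U) E'"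
  then have s: "sgraph (verts U) E'" and d: "\<And>v. deg E' v = deg (adj U) v" by (auto simp: realizes_def)
  define H :: "('c, 'c \<times> 'c) pre_digraph" where
    "H = \<lparr>verts = verts U, arcs = {(u,v). E' u v}, tail = fst, head = snd\<rparr>"
  have arcsV: "{(u,v). E' u v} \<subseteq> verts U \<times> verts U" using sgraphD(2,3)[OF s] by auto
  have adjH: "adj H = E'" unfolding adj_conv fun_eq_iff by (auto simp: H_def)
  have gH: "graph H"
  proof
    show "tail H e \<in> verts H" "head H e \<in> verts H" if "e \<in> arcs H" for e
      using that arcsV by (auto simp: H_def)
    show "finite (verts H)" using sgraphD(1)[OF s] by (simp add: H_def)
    show "finite (arcs H)" using sgraphD(1)[OF s] finite_subset[OF arcsV] by (simp add: H_def)
    show "tail H e \<noteq> head H e" if "e \<in> arcs H" for e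
      using that sgraphD(5)[OF s] by (auto simp: H_def)
    show "e1 = e2" if "e1 \<in> arcs H" "e2 \<in> arcs H" "arc_to_ends H e1 = arc_to_ends H e2" for e1 e2
      using that by (auto simp: H_def arc_to_ends_def prod_eq_iff)
    show "symmetric H"
      unfolding symmetric_def using adjH sgraphD(4)[OF s] by (metis symI)
  qed
  have "out_degree H = out_degree U"
    using deg_adj[OF gH] deg_adj[OF gU] d adjH by (simp add: fun_eq_iff)
  moreover have "verts H = verts U" by (simp add: H_def)
  note VH = this
  ultimately have "degree_sequence H = degree_sequence U"
    unfolding degree_sequence_eq_iff by simp
  then have "digraph_iso H U" by (rule unigraph_iso_any_type[OF assms gH])
  then obtain f where "bij_betw f (verts H) (verts U)"
    "\<And>u v. u \<in> verts H \<Longrightarrow> v \<in> verts H \<Longrightarrow> E' u v \<longleftrightarrow> adj U (f u) (f v)"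
    unfolding adjH[symmetric] by (rule digraph_iso_adj) blast
  then show "\<exists>f. bij_betw f (verts U) (verts U) \<and>
      (\<forall>u\<in>verts U. \<forall>v\<in>verts U. E' u v \<longleftrightarrow> adj U (f u) (f v))"
    unfolding VH by blast
qed

lemma adj_induced:
  assumes "induced_subgraph H G" "u \<in> verts H" "v \<in> verts H"
  shows "adj H u v \<longleftrightarrow> adj G u v"
proof -
  have "tail H = tail G" "head H = head G" "arcs H = {e \<in> arcs G. tail G e \<in> verts H \<and> head G e \<in> verts H}"
    using assms(1) by (auto simp: induced_subgraph_def subgraph_def compatible_def)
  then show ?thesis unfolding adj_conv using assms(2,3) by auto
qed

lemma clique_iff: "clique G K \<longleftrightarrow> K \<subseteq> verts G \<and> is_clique (adj G) K"
  unfolding clique_def is_clique_def ..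

lemma finite_cliques: "finite (verts G) \<Longrightarrow> finite (card ` {C. clique G C})"
  by (rule finite_imageI, rule finite_subset[of _ "Pow (verts G)"]) (auto simp: clique_def)

lemma clique_number_ge: "finite (verts G) \<Longrightarrow> clique G K \<Longrightarrow> card K \<le> clique_number G"
  unfolding clique_number_def using finite_cliques by (intro Max_ge) auto

lemma clique_number_le_chromatic_number:
  assumes fin: "finite (verts G)" and c: "proper_colouring G k c"
  shows "clique_number G \<le> chromatic_number G"
proof -
  obtain c where c: "proper_colouring G (chromatic_number G) c"
    unfolding chromatic_number_def using LeastI_ex[of "\<lambda>k. \<exists>c. proper_colouring G k c"] c by blast
  have "clique G {}" by (simp add: clique_def)
  then have "clique_number G \<in> card ` {C. clique G C}"
    unfolding clique_number_def using finite_cliques[OF fin] by (intro Max_in) auto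
  then obtain K where K: "clique G K" "clique_number G = card K" by auto
  have "inj_on c K" using K(1) c unfolding inj_on_def clique_def proper_colouring_def by blast
  moreover have "c ` K \<subseteq> {..<chromatic_number G}" using K(1) c unfolding clique_def proper_colouring_def by auto
  ultimately show ?thesis using K(2) by (metis card_inj_on_le card_lessThan finite_lessThan)
qed

lemma chromatic_number_le: "proper_colouring G k c \<Longrightarrow> chromatic_number G \<le> k"
  unfolding chromatic_number_def by (rule Least_le) blast

lemma perfect_on_chromatic_clique:
  assumes "graph G" "perfect_on (verts G) (adj G)"
  shows "chromatic_number G = clique_number G"
proof -
  interpret graph G by fact
  obtain K f where K: "K \<subseteq> verts G" "is_clique (adj G) K" "\<forall>v\<in>verts G. f v < card K"
    "\<forall>x\<in>verts G. \<forall>y\<in>verts G. adj G x y \<longrightarrow> f x \<noteq> f y" by (rule perfect_onE[OF assms(2) subset_refl])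
  have c: "proper_colouring G (card K) f"
    using K(3,4) adj_in_verts unfolding proper_colouring_def by blast
  have "chromatic_number G \<le> card K" using c by (rule chromatic_number_le)
  also have "card K \<le> clique_number G" using K(1,2) by (intro clique_number_ge) (auto simp: clique_iff)
  finally show ?thesis using clique_number_le_chromatic_number[OF finite_verts c] by simp
qed

lemma graph_induced:
  assumes "graph G" "induced_subgraph H G"
  shows "graph H"
proof -
  interpret graph G by fact
  have H: "tail H = tail G" "head H = head G" "arcs H = {e \<in> arcs G. tail G e \<in> verts H \<and> head G e \<in> verts H}"
    "verts H \<subseteq> verts G"
    using assms(2) by (auto simp: induced_subgraph_def subgraph_def compatible_def)
  show ?thesis
  proof
    show "tail H e \<in> verts H" "head H e \<in> verts H" if "e \<in> arcs H" for e using that H by auto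
    show "finite (verts H)" "finite (arcs H)" using H finite_subset[OF H(4)] by auto
    show "tail H e \<noteq> head H e" if "e \<in> arcs H" for e using that H no_loops by auto
    show "e1 = e2" if "e1 \<in> arcs H" "e2 \<in> arcs H" "arc_to_ends H e1 = arc_to_ends H e2" for e1 e2
      using that H by (auto simp: arc_to_ends_def intro: no_multi_arcs)
    show "symmetric H"
      unfolding symmetric_conv
    proof
      fix e assume e: "e \<in> arcs H"
      then obtain e' where "e' \<in> arcs G" "tail G e = head G e'" "head G e = tail G e'"
        using sym_arcs H(3) unfolding symmetric_conv by blast
      then show "\<exists>e'\<in>arcs H. tail H e = head H e' \<and> head H e = tail H e'" using e H by auto
    qed
  qed
qed

lemma perfect_on_perfect_graph:
  assumes "graph G" "perfect_on (verts G) (adj G)"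
  shows "perfect_graph G"
  unfolding perfect_graph_def
proof (intro conjI allI impI)
  fix H assume H: "induced_subgraph H G"
  have "verts H \<subseteq> verts G" using H by (auto simp: induced_subgraph_def subgraph_def)
  then have "perfect_on (verts H) (adj G)" by (rule perfect_on_subset[OF assms(2)])
  then have "perfect_on (verts H) (adj H)"
    by (rule perfect_on_iso[OF _ bij_betw_id]) (use adj_induced[OF H] in auto)
  then show "chromatic_number H = clique_number H"
    by (rule perfect_on_chromatic_clique[OF graph_induced[OF assms(1) H]])
qed (rule assms(1))

lemma induced_del_vert: "wf_digraph G \<Longrightarrow> induced_subgraph (pre_digraph.del_vert G v) G"
  unfolding induced_subgraph_def
  using wf_digraph.subgraph_del_vert[of G v]
  by (auto simp: pre_digraph.del_vert_simps wf_digraph.tail_in_verts wf_digraph.head_in_verts)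

text \<open>The deleted vertex receives a fresh colour.\<close>

lemma chromatic_number_le_Suc:
  assumes "graph G" and v: "v \<in> verts G" and pf: "perfect_on (verts G - {v}) (adj G)"
  shows "chromatic_number G \<le> clique_number G + 1"
proof -
  interpret graph G by fact
  obtain K f where K: "K \<subseteq> verts G - {v}" "is_clique (adj G) K" "\<forall>x\<in>verts G - {v}. f x < card K"
    "\<forall>x\<in>verts G - {v}. \<forall>y\<in>verts G - {v}. adj G x y \<longrightarrow> f x \<noteq> f y" by (rule perfect_onE[OF pf subset_refl])
  have "proper_colouring G (card K + 1) (f(v := card K))"
    unfolding proper_colouring_def
  proof (intro conjI ballI allI impI)
    fix x assume "x \<in> verts G"
    then show "(f(v := card K)) x < card K + 1" using K(3) by (cases "x = v") (auto simp: less_Suc_eq)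
  next
    fix x y assume xy: "adj G x y"
    then have "x \<in> verts G" "y \<in> verts G" "x \<noteq> y" using adj_in_verts adj_not_same by auto
    then show "(f(v := card K)) x \<noteq> (f(v := card K)) y"
    proof (cases "x = v \<or> y = v")
      case True
      then show ?thesis
        using K(3)[rule_format, of x] K(3)[rule_format, of y] \<open>x \<in> _\<close> \<open>y \<in> _\<close> \<open>x \<noteq> y\<close> by auto
    next
      case False
      then show ?thesis using K(4) xy \<open>x \<in> _\<close> \<open>y \<in> _\<close> by simp
    qed
  qed
  then have "chromatic_number G \<le> card K + 1" by (rule chromatic_number_le)
  moreover have "card K \<le> clique_number G" using K(1,2) by (intro clique_number_ge) (auto simp: clique_iff)
  ultimately show ?thesis by simp
qed

theorem theorem3p2:
  fixes G :: "('a,'b) pre_digraph" and H U :: "('c,'d) pre_digraph"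
  assumes "graph G"
    and "unigraph U" and "induced_subgraph H U" and "digraph_iso G H"
  shows "(verts G \<noteq> {} \<longrightarrow> apex_perfect G) \<and> chromatic_number G \<le> clique_number G + 1"
proof (cases "verts G = {}")
  case True
  interpret graph G by fact
  have "proper_colouring G 0 (\<lambda>_. 0)"
    using True adj_in_verts unfolding proper_colouring_def by blast
  then show ?thesis using True chromatic_number_le[of G 0] by force
next
  case False
  interpret graph G by fact
  obtain f where f: "bij_betw f (verts G) (verts H)"
    "\<And>u v. u \<in> verts G \<Longrightarrow> v \<in> verts G \<Longrightarrow> adj G u v \<longleftrightarrow> adj H (f u) (f v)"
    by (rule digraph_iso_adj[OF assms(4)]) blast
  have HU: "verts H \<subseteq> verts U" using assms(3) by (auto simp: induced_subgraph_def subgraph_def)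
  have fH: "f u \<in> verts H" if "u \<in> verts G" for u using bij_betwE[OF f(1)] that by blast
  have "verts U \<noteq> {}" using False fH HU by blast
  then obtain w where w: "w \<in> verts U" "perfect_on (verts U - {w}) (adj U)"
    using unigraph_on_apex_perf[OF unigraph_uni[OF assms(2)]] by blast
  \<comment> \<open>If the apex w of \<open>U\<close> lies outside the copy of \<open>G\<close>,
    that copy is already perfect and any vertex may be deleted.\<close>
  obtain v where v: "v \<in> verts G" "w \<notin> f ` (verts G - {v})"
  proof (cases "w \<in> verts H")
    case True
    then have "w \<in> f ` verts G" using f(1) by (simp add: bij_betw_def)
    then obtain v where v: "v \<in> verts G" "f v = w" by blast
    then have "w \<notin> f ` (verts G - {v})" using f(1) by (auto simp: bij_betw_def inj_on_def)
    with v that show thesis by blast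
  next
    case wH: False
    then show thesis using that False fH by blast
  qed
  have "f ` (verts G - {v}) \<subseteq> verts U - {w}" using v(2) fH HU by blast
  then have "perfect_on (f ` (verts G - {v})) (adj U)" by (rule perfect_on_subset[OF w(2)])
  moreover have "bij_betw f (verts G - {v}) (f ` (verts G - {v}))"
    using f(1) by (auto simp: bij_betw_def intro: inj_on_subset)
  moreover have "adj G x y \<longleftrightarrow> adj U (f x) (f y)" if "x \<in> verts G" "y \<in> verts G" for x y
    using f(2)[OF that] adj_induced[OF assms(3) fH[OF that(1)] fH[OF that(2)]] by simp
  ultimately have pf: "perfect_on (verts G - {v}) (adj G)"
    by (intro perfect_on_iso[of _ "adj U" f "verts G - {v}" "adj G"]) blast+
  let ?D = "pre_digraph.del_vert G v"
  have D: "induced_subgraph ?D G" by (rule induced_del_vert[OF wf_digraph_axioms])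
  have "perfect_on (verts ?D) (adj ?D)"
    unfolding verts_del_vert
    by (rule perfect_on_iso[OF pf bij_betw_id]) (use adj_induced[OF D] in \<open>auto simp: verts_del_vert\<close>)
  then have "perfect_graph ?D" by (rule perfect_on_perfect_graph[OF graph_induced[OF assms(1) D]])
  then have "apex_perfect G" using assms(1) v(1) by (auto simp: apex_perfect_def)
  then show ?thesis using chromatic_number_le_Suc[OF assms(1) v(1) pf] by blast
qed

end
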